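(* Let $n\ge 1$, let $\mathfrak g$ be the Lie algebra of Killing fields on Euclidean space $\mathbb R^{n+1}$, and let $\operatorname{rad}\mathfrak g\subset\mathfrak g$ denote the subalgebra of constant vector fields. Let $\Sigma$ be a smooth, orientable, simply-connected, $n$-dimensional manifold, let $A$ be any Lie algebroid over $\Sigma$ with anchor $\#\colon A\to T\Sigma$, and let $\omega\colon A\to\mathfrak g$ be a Lie algebroid morphism. Assume: (1) $\operatorname{rank}A=n(n+3)/2$. (2) The anchor $\#\colon A\to T\Sigma$ is surjective. (3) $\omega\colon A\to\mathfrak g$ is injective on fibres. (4) For some (and consequently any) $x_0\in\Sigma$, $\omega$ maps $\ker\#\cap A|_{x_0}$ (the intersection of the kernel of $\#$ with the fibre of $A$ over $x_0$) to a subspace of $\mathfrak g$ transverse to $\operatorname{rad}\mathfrak g$. Then $\Sigma$ can be realised as an immersed hypersurface in $\mathbb R^{n+1}$ in such a way that its associated Lie algebroid is isomorphic to $A$ and its logarithmic derivative is $\omega$. That is, there exist a smooth immersion $f\colon\Sigma\to\mathbb R^{n+1}$ and an isomorphism of Lie algebroids $\Phi\colon A\to A_f$ covering the identity of $\Sigma$ such that $\omega_f\circ\Phi=\omega$, where $A_f$ is the Lie algebroid associated with $f$ and $\omega_f\colon A_f\to\mathfrak g$ is the logarithmic derivative of $f$.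
   Context: All manifolds, bundles and maps are smooth. A Killing field on $\mathbb R^{n+1}$ is a vector field whose local flows are rigid motions; the Killing fields form a finite-dimensional Lie algebra $\mathfrak g$ under the Jacobi-Lie bracket of vector fields, denoted $[\cdot,\cdot]_{\mathfrak g}$. Lie algebroid: a Lie algebroid with base $\Sigma$ is a vector bundle $A$ over $\Sigma$, together with a vector bundle morphism $\#\colon A\to T\Sigma$ covering the identity (the anchor) and a Lie bracket on the space of sections $\Gamma(A)$, such that $[X,fY]=f[X,Y]+df(\#X)\,Y$ for all $X,Y\in\Gamma(A)$ and all smooth $f\colon\Sigma\to\mathbb R$. (The anchor then automatically satisfies $\#[X,Y]=[\#X,\#Y]$.) A vector bundle map between Lie algebroids over the same base, covering the identity, is a Lie algebroid morphism if the induced map on section spaces is a Lie algebra homomorphism. For any manifold $\Sigma$, sections of the trivial bundle $\mathfrak g\times\Sigma$ are identified with $\mathfrak g$-valued functions on $\Sigma$; $\nabla$ denotes the canonical flat connection on $\mathfrak g\times\Sigma$, and $\{X,Y\}(x):=[X(x),Y(x)]_{\mathfrak g}$. Morphism into a Lie algebra: for a Lie algebroid $A$ over $\Sigma$, a (smooth, fibrewise linear) map $\omega\colon A\to\mathfrak g$ is a Lie algebroid morphism if its obvious extension to a vector bundle morphism $\bar\omega\colon A\to\mathfrak g\times\Sigma$ covering the identity satisfies $$\bar\omega([X,Y])=\nabla_{\#X}\bar\omega(Y)-\nabla_{\#Y}\bar\omega(X)+\{\bar\omega(X),\bar\omega(Y)\}\qquad\text{for all }X,Y\in\Gamma(A).$$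 Lie algebroid and logarithmic derivative of an immersed hypersurface: let $f\colon\Sigma\to\mathbb R^{n+1}$ be an immersion of an $n$-dimensional manifold. Its associated Lie algebroid is the subbundle $$A_f=\{(X,x)\in\mathfrak g\times\Sigma : X(f(x))\in df(T_x\Sigma)\}$$ of $\mathfrak g\times\Sigma$, with anchor $\#\colon A_f\to T\Sigma$ determined by $df(\#(X,x))=X(f(x))$ and with bracket on sections $[X,Y]=\nabla_{\#X}Y-\nabla_{\#Y}X+\{X,Y\}$ (this is well-defined and makes $A_f$ a Lie algebroid). The logarithmic derivative of $f$ is the Lie algebroid morphism $\omega_f\colon A_f\to\mathfrak g$ obtained by composing the inclusion $A_f\subset\mathfrak g\times\Sigma$ with the projection $\mathfrak g\times\Sigma\to\mathfrak g$. *)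

theory Defs
  imports "HOL-Analysis.Analysis"
begin

section \<open>Smooth maps between open subsets of Euclidean spaces\<close>

text \<open>On an open set of a finite-dimensional space, \<open>Ck_on k S f\<close> says that \<open>f\<close> is \<open>k\<close> times
  continuously differentiable on \<open>S\<close>. Only the values of \<open>f\<close> on \<open>S\<close> matter.\<close>

fun Ck_on :: "nat \<Rightarrow> 'e::euclidean_space set \<Rightarrow> ('e \<Rightarrow> 'v::real_normed_vector) \<Rightarrow> bool" where
  "Ck_on 0 S f \<longleftrightarrow> continuous_on S f"
| "Ck_on (Suc k) S f \<longleftrightarrow>
     (\<forall>x\<in>S. f differentiable (at x)) \<and> (\<forall>v. Ck_on k S (\<lambda>x. frechet_derivative f (at x) v))"

definition smooth_on :: "'e::euclidean_space set \<Rightarrow> ('e \<Rightarrow> 'v::real_normed_vector) \<Rightarrow> bool" where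
  "smooth_on S f \<longleftrightarrow> open S \<and> (\<forall>k. Ck_on k S f)"


section \<open>Manifolds, smooth maps and tangent vectors\<close>

type_synonym ('a, 'e) chart = "'a set \<times> ('a \<Rightarrow> 'e)"

abbreviation chart_inv :: "('a, 'e) chart \<Rightarrow> 'e \<Rightarrow> 'a" where
  "chart_inv c \<equiv> inv_into (fst c) (snd c)"

definition smoothly_compatible ::
    "('a, 'e::euclidean_space) chart \<Rightarrow> ('a, 'e) chart \<Rightarrow> bool" where
  "smoothly_compatible c d \<longleftrightarrow> smooth_on (snd c ` (fst c \<inter> fst d)) (snd d \<circ> chart_inv c)"

text \<open>The manifold is the whole type \<open>'a\<close>, with its given topology; the classes imposed on \<open>'a\<close>
  make it Hausdorff and second countable. The atlas need not be maximal.\<close>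

definition smooth_atlas ::
    "('a::{t2_space,second_countable_topology}, 'e::euclidean_space) chart set \<Rightarrow> bool" where
  "smooth_atlas M \<longleftrightarrow>
     (\<Union>c\<in>M. fst c) = UNIV \<and>
     (\<forall>c\<in>M. open (fst c) \<and> open (snd c ` fst c) \<and>
            homeomorphism (fst c) (snd c ` fst c) (snd c) (chart_inv c)) \<and>
     (\<forall>c\<in>M. \<forall>d\<in>M. smoothly_compatible c d)"

definition orientable :: "('a::{t2_space,second_countable_topology}, real^'n) chart set \<Rightarrow> bool" where
  "orientable M \<longleftrightarrow>
     (\<exists>P. smooth_atlas P \<and> smooth_atlas (M \<union> P) \<and>
          (\<forall>c\<in>P. \<forall>d\<in>P. \<forall>p\<in>snd c ` (fst c \<inter> fst d).
             det (matrix (frechet_derivative (snd d \<circ> chart_inv c) (at p))) > 0))"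

text \<open>Smoothness of a map from the manifold covered by the charts \<open>C\<close> to the one covered by the
  charts \<open>D\<close>. Openness of each set \<open>snd c ` (fst c \<inter> f -` fst d)\<close>, which is part of
  \<^const>\<open>smooth_on\<close>, expresses that \<open>f\<close> is continuous for the topologies defined by the charts.\<close>

definition smooth_map ::
    "('a, 'e::euclidean_space) chart set \<Rightarrow> ('b, 'f::euclidean_space) chart set \<Rightarrow> ('a \<Rightarrow> 'b) \<Rightarrow> bool"
  where
  "smooth_map C D f \<longleftrightarrow>
     f ` (\<Union>c\<in>C. fst c) \<subseteq> (\<Union>d\<in>D. fst d) \<and>
     (\<forall>c\<in>C. \<forall>d\<in>D. smooth_on (snd c ` (fst c \<inter> f -` fst d)) (snd d \<circ> f \<circ> chart_inv c))"

definition euclidean_charts :: "('e, 'e::euclidean_space) chart set" where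
  "euclidean_charts = {(UNIV, \<lambda>x. x)}"

definition restrict_charts :: "'a set \<Rightarrow> ('a, 'e) chart set \<Rightarrow> ('a, 'e) chart set" where
  "restrict_charts U C = (\<lambda>c. (fst c \<inter> U, snd c)) ` C"

text \<open>A tangent vector at \<open>x\<close> is a pair \<open>(x, v)\<close>, where \<open>v\<close> assigns to each chart of the atlas
  around \<open>x\<close> a coordinate vector, subject to the usual transformation law (and \<open>v\<close> is \<open>0\<close> on
  everything that is not such a chart).\<close>

type_synonym ('a, 'n) tangent = "'a \<times> (('a, real^'n) chart \<Rightarrow> real^'n)"

definition tangent_space :: "('a, real^'n) chart set \<Rightarrow> 'a \<Rightarrow> ('a, 'n) tangent set" where
  "tangent_space M x =
     {(x, v) | v.
        (\<forall>c\<in>M. \<forall>d\<in>M. x \<in> fst c \<and> x \<in> fst d \<longrightarrow>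
           v d = frechet_derivative (snd d \<circ> chart_inv c) (at (snd c x)) (v c)) \<and>
        (\<forall>c. \<not> (c \<in> M \<and> x \<in> fst c) \<longrightarrow> v c = 0)}"

text \<open>The differential of a vector-space valued function, applied to a tangent vector. By the
  chain rule the choice of the chart is irrelevant.\<close>

definition mdiff ::
    "('a, real^'n) chart set \<Rightarrow> ('a \<Rightarrow> 'v::real_normed_vector) \<Rightarrow> ('a, 'n) tangent \<Rightarrow> 'v" where
  "mdiff M f t =
     (let c = SOME c. c \<in> M \<and> fst t \<in> fst c
      in frechet_derivative (f \<circ> chart_inv c) (at (snd c (fst t))) (snd t c))"

definition immersion :: "('a, real^'n) chart set \<Rightarrow> ('a \<Rightarrow> 'e::euclidean_space) \<Rightarrow> bool" where
  "immersion M f \<longleftrightarrow>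
     smooth_map M euclidean_charts f \<and> (\<forall>x. inj_on (mdiff M f) (tangent_space M x))"


section \<open>Vector bundles\<close>

text \<open>A vector bundle of rank \<open>CARD('k)\<close> over \<open>'a\<close>: the total space, the projection, the fibrewise
  vector space operations, and a family of local trivialisations \<open>(U, \<psi>)\<close>, where \<open>\<psi>\<close> is the fibre
  coordinate, defined on the part of the total space that lies over \<open>U\<close>. The vector space axioms
  in the fibres, and the smooth structure of the total space, come from the trivialisations.\<close>

record ('a, 'b, 'k::finite) vbundle =
  tot_space :: "'b set"
  proj :: "'b \<Rightarrow> 'a"
  fadd :: "'b \<Rightarrow> 'b \<Rightarrow> 'b"
  fscale :: "real \<Rightarrow> 'b \<Rightarrow> 'b"
  trivs :: "('a set \<times> ('b \<Rightarrow> real^'k)) set"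

definition vb_rank :: "('a, 'b, 'k::finite, 'z) vbundle_scheme \<Rightarrow> nat" where
  "vb_rank E = CARD('k)"

definition fibre :: "('a, 'b, 'k::finite, 'z) vbundle_scheme \<Rightarrow> 'a \<Rightarrow> 'b set" where
  "fibre E x = {e \<in> tot_space E. proj E e = x}"

definition fibrewise_triv ::
    "('a, 'b, 'k::finite, 'z) vbundle_scheme \<Rightarrow> 'a set \<times> ('b \<Rightarrow> real^'k) \<Rightarrow> bool" where
  "fibrewise_triv E t \<longleftrightarrow>
     (\<forall>x\<in>fst t. bij_betw (snd t) (fibre E x) UNIV \<and>
        (\<forall>e\<in>fibre E x. \<forall>e'\<in>fibre E x. snd t (fadd E e e') = snd t e + snd t e') \<and>
        (\<forall>r. \<forall>e\<in>fibre E x. snd t (fscale E r e) = r *\<^sub>R snd t e))"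

definition vector_bundle ::
    "('a::{t2_space,second_countable_topology}, real^'n) chart set
      \<Rightarrow> ('a, 'b, 'k::finite, 'z) vbundle_scheme \<Rightarrow> bool" where
  "vector_bundle M E \<longleftrightarrow>
     smooth_atlas M \<and>
     (\<forall>x. \<forall>e\<in>fibre E x. \<forall>e'\<in>fibre E x. fadd E e e' \<in> fibre E x) \<and>
     (\<forall>x r. \<forall>e\<in>fibre E x. fscale E r e \<in> fibre E x) \<and>
     (\<Union>t\<in>trivs E. fst t) = UNIV \<and>
     (\<forall>t\<in>trivs E. open (fst t) \<and> fibrewise_triv E t) \<and>
     (\<forall>t\<in>trivs E. \<forall>s\<in>trivs E. \<forall>v.
        smooth_map (restrict_charts (fst t \<inter> fst s) M) euclidean_charts
          (\<lambda>x. snd s (inv_into (fibre E x) (snd t) v)))"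

definition bundle_charts ::
    "('a, real^'n) chart set \<Rightarrow> ('a, 'b, 'k::finite, 'z) vbundle_scheme
      \<Rightarrow> ('b, (real^'n) \<times> (real^'k)) chart set" where
  "bundle_charts M E =
     {({e \<in> tot_space E. proj E e \<in> fst c \<inter> fst t}, \<lambda>e. (snd c (proj E e), snd t e)) | c t.
        c \<in> M \<and> t \<in> trivs E}"

definition sections ::
    "('a, real^'n) chart set \<Rightarrow> ('a, 'b, 'k::finite, 'z) vbundle_scheme \<Rightarrow> ('a \<Rightarrow> 'b) set" where
  "sections M E = {X. (\<forall>x. X x \<in> fibre E x) \<and> smooth_map M (bundle_charts M E) X}"

text \<open>Vector bundle morphisms covering the identity\<close>

definition vb_morphism ::
    "('a, real^'n) chart set \<Rightarrow> ('a, 'b, 'k::finite, 'z) vbundle_scheme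
      \<Rightarrow> ('a, 'c, 'l::finite, 'y) vbundle_scheme \<Rightarrow> ('b \<Rightarrow> 'c) \<Rightarrow> bool" where
  "vb_morphism M E F \<Phi> \<longleftrightarrow>
     (\<forall>x. \<forall>e\<in>fibre E x. \<Phi> e \<in> fibre F x) \<and>
     (\<forall>x. \<forall>e\<in>fibre E x. \<forall>e'\<in>fibre E x. \<Phi> (fadd E e e') = fadd F (\<Phi> e) (\<Phi> e')) \<and>
     (\<forall>x r. \<forall>e\<in>fibre E x. \<Phi> (fscale E r e) = fscale F r (\<Phi> e)) \<and>
     smooth_map (bundle_charts M E) (bundle_charts M F) \<Phi>"

definition tangent_bundle ::
    "('a, real^'n) chart set \<Rightarrow> ('a, ('a, 'n::finite) tangent, 'n) vbundle" where
  "tangent_bundle M =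
     \<lparr> tot_space = (\<Union>x. tangent_space M x),
       proj = fst,
       fadd = (\<lambda>s t. (fst s, \<lambda>c. snd s c + snd t c)),
       fscale = (\<lambda>r s. (fst s, \<lambda>c. r *\<^sub>R snd s c)),
       trivs = (\<lambda>c. (fst c, \<lambda>s. snd s c)) ` M \<rparr>"


section \<open>Lie algebroids\<close>

record ('a, 'b, 'k::finite, 'n::finite) algebroid = "('a, 'b, 'k) vbundle" +
  anchor :: "'b \<Rightarrow> ('a, 'n) tangent"
  bracket :: "('a \<Rightarrow> 'b) \<Rightarrow> ('a \<Rightarrow> 'b) \<Rightarrow> ('a \<Rightarrow> 'b)"

definition anchor_kernel :: "('a, 'b, 'k::finite, 'n::finite) algebroid \<Rightarrow> 'a \<Rightarrow> 'b set" where
  "anchor_kernel A x = {a \<in> fibre A x. anchor A a = (x, \<lambda>_. 0)}"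

definition lie_algebroid ::
    "('a::{t2_space,second_countable_topology}, real^'n) chart set
      \<Rightarrow> ('a, 'b, 'k::finite, 'n::finite) algebroid \<Rightarrow> bool" where
  "lie_algebroid M A \<longleftrightarrow>
     vector_bundle M A \<and>
     vb_morphism M A (tangent_bundle M) (anchor A) \<and>
     (\<forall>X\<in>sections M A. \<forall>Y\<in>sections M A. bracket A X Y \<in> sections M A) \<and>
     (\<forall>X\<in>sections M A. \<forall>Y\<in>sections M A. \<forall>Z\<in>sections M A.
        bracket A X (\<lambda>x. fadd A (Y x) (Z x))
          = (\<lambda>x. fadd A (bracket A X Y x) (bracket A X Z x))) \<and>
     (\<forall>X\<in>sections M A. \<forall>Y\<in>sections M A. \<forall>r.
        bracket A X (\<lambda>x. fscale A r (Y x)) = (\<lambda>x. fscale A r (bracket A X Y x))) \<and>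
     (\<forall>X\<in>sections M A. \<forall>Y\<in>sections M A.
        bracket A Y X = (\<lambda>x. fscale A (- 1) (bracket A X Y x))) \<and>
     (\<forall>X\<in>sections M A. \<forall>Y\<in>sections M A. \<forall>Z\<in>sections M A.
        (\<lambda>x. fadd A (fadd A (bracket A X (bracket A Y Z) x) (bracket A Y (bracket A Z X) x))
                    (bracket A Z (bracket A X Y) x))
          = (\<lambda>x. fscale A 0 (X x))) \<and>
     (\<forall>X\<in>sections M A. \<forall>Y\<in>sections M A. \<forall>h::'a \<Rightarrow> real. smooth_map M euclidean_charts h \<longrightarrow>
        bracket A X (\<lambda>x. fscale A (h x) (Y x))
          = (\<lambda>x. fadd A (fscale A (h x) (bracket A X Y x))
                        (fscale A (mdiff M h (anchor A (X x))) (Y x))))"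

definition algebroid_morphism ::
    "('a::{t2_space,second_countable_topology}, real^'n) chart set
      \<Rightarrow> ('a, 'b, 'k::finite, 'n::finite) algebroid \<Rightarrow> ('a, 'c, 'l::finite, 'n) algebroid
      \<Rightarrow> ('b \<Rightarrow> 'c) \<Rightarrow> bool" where
  "algebroid_morphism M A B \<Phi> \<longleftrightarrow>
     lie_algebroid M A \<and> lie_algebroid M B \<and> vb_morphism M A B \<Phi> \<and>
     (\<forall>X\<in>sections M A. \<forall>Y\<in>sections M A.
        (\<lambda>x. \<Phi> (bracket A X Y x)) = bracket B (\<lambda>x. \<Phi> (X x)) (\<lambda>x. \<Phi> (Y x)))"

definition algebroid_iso ::
    "('a::{t2_space,second_countable_topology}, real^'n) chart set
      \<Rightarrow> ('a, 'b, 'k::finite, 'n::finite) algebroid \<Rightarrow> ('a, 'c, 'l::finite, 'n) algebroid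
      \<Rightarrow> ('b \<Rightarrow> 'c) \<Rightarrow> bool" where
  "algebroid_iso M A B \<Phi> \<longleftrightarrow>
     algebroid_morphism M A B \<Phi> \<and> bij_betw \<Phi> (tot_space A) (tot_space B) \<and>
     algebroid_morphism M B A (inv_into (tot_space A) \<Phi>)"


section \<open>Killing fields\<close>

text \<open>Rigid motions are taken to be all isometries; for the members of a flow, which starts at the
  identity, requiring preservation of orientation as well would change nothing.\<close>

definition rigid_motion :: "(real^'m \<Rightarrow> real^'m) \<Rightarrow> bool" where
  "rigid_motion g \<longleftrightarrow> (\<forall>x y. dist (g x) (g y) = dist x y)"

text \<open>No regularity of \<open>\<phi>\<close> is demanded: for a smooth \<open>X\<close> it follows from the uniqueness of
  integral curves.\<close>

definition local_flow ::
    "(real^'m \<Rightarrow> real^'m) \<Rightarrow> real \<Rightarrow> (real^'m) set \<Rightarrow> (real \<Rightarrow> real^'m \<Rightarrow> real^'m) \<Rightarrow> bool" where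
  "local_flow X \<epsilon> U \<phi> \<longleftrightarrow>
     \<epsilon> > 0 \<and> open U \<and>
     (\<forall>x\<in>U. \<phi> 0 x = x \<and>
        (\<forall>t\<in>{-\<epsilon><..<\<epsilon>}. ((\<lambda>s. \<phi> s x) has_vector_derivative X (\<phi> t x)) (at t)))"

definition killing_fields :: "(real^'m \<Rightarrow> real^'m) set" where
  "killing_fields =
     {X. smooth_on UNIV X \<and>
         (\<forall>\<epsilon> U \<phi>. local_flow X \<epsilon> U \<phi> \<longrightarrow>
            (\<forall>t\<in>{-\<epsilon><..<\<epsilon>}. \<exists>g. rigid_motion g \<and> (\<forall>x\<in>U. \<phi> t x = g x)))}"

definition constant_fields :: "(real^'m \<Rightarrow> real^'m) set" where
  "constant_fields = {X \<in> killing_fields. \<exists>v. X = (\<lambda>_. v)}"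

text \<open>Jacobi--Lie bracket, with the sign for which \<open>[X, Y] h = X (Y h) - Y (X h)\<close>\<close>

definition jl_bracket ::
    "(real^'m \<Rightarrow> real^'m) \<Rightarrow> (real^'m \<Rightarrow> real^'m) \<Rightarrow> (real^'m \<Rightarrow> real^'m)" where
  "jl_bracket X Y =
     (\<lambda>y. frechet_derivative Y (at y) (X y) - frechet_derivative X (at y) (Y y))"

definition transverse_in_killing ::
    "(real^'m \<Rightarrow> real^'m) set \<Rightarrow> (real^'m \<Rightarrow> real^'m) set \<Rightarrow> bool" where
  "transverse_in_killing V W \<longleftrightarrow> {\<lambda>y. X y + Y y | X Y. X \<in> V \<and> Y \<in> W} = killing_fields"

text \<open>The Killing fields form a finite-dimensional vector space, whose smooth structure is the one
  given by linear coordinates. Hence a map into it is smooth iff its composition with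
  every linear functional is smooth.\<close>

definition killing_functional :: "((real^'m \<Rightarrow> real^'m) \<Rightarrow> real) \<Rightarrow> bool" where
  "killing_functional l \<longleftrightarrow>
     (\<forall>X\<in>killing_fields. \<forall>Y\<in>killing_fields. l (\<lambda>y. X y + Y y) = l X + l Y) \<and>
     (\<forall>r. \<forall>X\<in>killing_fields. l (\<lambda>y. r *\<^sub>R X y) = r * l X)"

definition smooth_into_killing ::
    "('a, 'e::euclidean_space) chart set \<Rightarrow> ('a \<Rightarrow> real^'m \<Rightarrow> real^'m) \<Rightarrow> bool" where
  "smooth_into_killing C F \<longleftrightarrow>
     F ` (\<Union>c\<in>C. fst c) \<subseteq> killing_fields \<and>
     (\<forall>l. killing_functional l \<longrightarrow> smooth_map C euclidean_charts (\<lambda>x. l (F x)))"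

text \<open>The flat connection on the trivial bundle with fibre the Killing fields, applied to a section
  \<open>F\<close> regarded as a function. Evaluation at \<open>y\<close> is linear, so the derivative of \<open>F\<close> is
  computed pointwise in \<open>y\<close>.\<close>

definition flat_conn ::
    "('a, real^'n) chart set \<Rightarrow> ('a, 'n) tangent \<Rightarrow> ('a \<Rightarrow> real^'m \<Rightarrow> real^'m) \<Rightarrow> real^'m \<Rightarrow> real^'m"
  where
  "flat_conn M t F = (\<lambda>y. mdiff M (\<lambda>x. F x y) t)"

definition killing_morphism ::
    "('a::{t2_space,second_countable_topology}, real^'n) chart set
      \<Rightarrow> ('a, 'b, 'k::finite, 'n::finite) algebroid \<Rightarrow> ('b \<Rightarrow> real^'m \<Rightarrow> real^'m) \<Rightarrow> bool" where
  "killing_morphism M A \<omega> \<longleftrightarrow>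
     smooth_into_killing (bundle_charts M A) \<omega> \<and>
     (\<forall>x. \<forall>a\<in>fibre A x. \<forall>b\<in>fibre A x. \<omega> (fadd A a b) = (\<lambda>y. \<omega> a y + \<omega> b y)) \<and>
     (\<forall>x r. \<forall>a\<in>fibre A x. \<omega> (fscale A r a) = (\<lambda>y. r *\<^sub>R \<omega> a y)) \<and>
     (\<forall>X\<in>sections M A. \<forall>Y\<in>sections M A. \<forall>x.
        \<omega> (bracket A X Y x) =
          (\<lambda>y. flat_conn M (anchor A (X x)) (\<lambda>x. \<omega> (Y x)) y
             - flat_conn M (anchor A (Y x)) (\<lambda>x. \<omega> (X x)) y
             + jl_bracket (\<omega> (X x)) (\<omega> (Y x)) y))"


section \<open>The Lie algebroid of an immersed hypersurface\<close>

definition hyp_tot_space ::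
    "('a, real^'n) chart set \<Rightarrow> ('a \<Rightarrow> real^'m) \<Rightarrow> ((real^'m \<Rightarrow> real^'m) \<times> 'a) set" where
  "hyp_tot_space M f =
     {(X, x) | X x. X \<in> killing_fields \<and> X (f x) \<in> mdiff M f ` tangent_space M x}"

definition hyp_anchor ::
    "('a, real^'n) chart set \<Rightarrow> ('a \<Rightarrow> real^'m) \<Rightarrow> (real^'m \<Rightarrow> real^'m) \<times> 'a \<Rightarrow> ('a, 'n) tangent" where
  "hyp_anchor M f a =
     (THE t. t \<in> tangent_space M (snd a) \<and> mdiff M f t = fst a (f (snd a)))"

definition hyp_bundle ::
    "('a, real^'n) chart set \<Rightarrow> ('a \<Rightarrow> real^'m)
      \<Rightarrow> (('a set \<times> ((real^'m \<Rightarrow> real^'m) \<times> 'a \<Rightarrow> real^'k)) set)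
      \<Rightarrow> ('a, (real^'m \<Rightarrow> real^'m) \<times> 'a, 'k::finite) vbundle" where
  "hyp_bundle M f T =
     \<lparr> tot_space = hyp_tot_space M f,
       proj = snd,
       fadd = (\<lambda>a b. (\<lambda>y. fst a y + fst b y, snd a)),
       fscale = (\<lambda>r a. (\<lambda>y. r *\<^sub>R fst a y, snd a)),
       trivs = T \<rparr>"

text \<open>The subbundle structure: all fibrewise linear trivialisations \<open>(U, \<psi>)\<close> for which the
  associated local frames are smooth as functions with values in the Killing fields. For an
  immersion \<open>f\<close> of a hypersurface they exist around every point exactly if \<open>CARD('k)\<close> is the
  dimension of the fibres.\<close>

definition hyp_trivs ::
    "('a::{t2_space,second_countable_topology}, real^'n) chart set \<Rightarrow> ('a \<Rightarrow> real^'m)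
      \<Rightarrow> ('a set \<times> ((real^'m \<Rightarrow> real^'m) \<times> 'a \<Rightarrow> real^'k::finite)) set" where
  "hyp_trivs M f =
     {t. open (fst t) \<and> fibrewise_triv (hyp_bundle M f {}) t \<and>
         (\<forall>v. smooth_into_killing (restrict_charts (fst t) M)
                (\<lambda>x. fst (inv_into (fibre (hyp_bundle M f {} :: ('a, _, 'k) vbundle) x) (snd t) v)))}"

definition hypersurface_algebroid ::
    "('a::{t2_space,second_countable_topology}, real^'n) chart set \<Rightarrow> ('a \<Rightarrow> real^'m)
      \<Rightarrow> ('a, (real^'m \<Rightarrow> real^'m) \<times> 'a, 'k::finite, 'n::finite) algebroid" where
  "hypersurface_algebroid M f =
     vbundle.extend (hyp_bundle M f (hyp_trivs M f))
       (algebroid.fields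
          (hyp_anchor M f)
          (\<lambda>S T x.
             (\<lambda>y. flat_conn M (hyp_anchor M f (S x)) (\<lambda>x. fst (T x)) y
                - flat_conn M (hyp_anchor M f (T x)) (\<lambda>x. fst (S x)) y
                + jl_bracket (fst (S x)) (fst (T x)) y,
              x)))"

definition log_derivative :: "(real^'m \<Rightarrow> real^'m) \<times> 'a \<Rightarrow> real^'m \<Rightarrow> real^'m" where
  "log_derivative a = fst a"

end

(*
  Let f(x) be the common zero of the Killing fields w(ker #_x). It exists because ker # is closed
  under the bracket, so that w(ker #_x) is a subalgebra; where it is a complement of the constant
  fields it is, by Whitehead's lemma for so(n+1), the isotropy algebra of a point. Differentiating
  w(Y)(f) = 0 for sections Y of ker #, and comparing with w([X, Y])(f) = 0, gives df(#X) = w(X)(f).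
  This makes f an immersion and identifies w(A_x) with the Killing fields tangent to f at x. The set
  of points with the complement property is open; it is closed because along a curve f satisfies
  g' = S g + b with S skew, and the solutions of such an equation stay bounded.
*)
theory Submission
  imports Defs
begin

section \<open>Calculus of smooth maps\<close>

text \<open>Killing fields are given through their flows, so they must first be identified. That
  skew affine fields are Killing is checked on flows; that there are no others is read off from
  transversality at \<open>x\<^sub>0\<close>: the rank n(n+3)/2 = n + n(n+1)/2 leaves ker # exactly
  the dimension of so(n+1). The same count later turns inclusions of w(ker #_x) into equalities. The
  definition of a Lie algebroid does not say that the anchor respects brackets; the part needed,
  that ker # absorbs brackets, is extracted from the Jacobi and Leibniz rules. Objects defined
  implicitly (lifts through the anchor, the point f(x), changes of frame) are shown to be smooth by
  one device: each solves a linear system with smooth invertible matrix, so Cramer's rule applies.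
  For f the matrix is a sum of squares of rotation parts; at the base point it is the Casimir
  operator of so(m), the scalar -2(m-1) with m = n+1. Brackets are defined on global sections only,
  so every local construction is cut off by a bump function. The axioms for A_f are transported
  along the bijection with A.\<close>

lemma Ck_on_cong:
  assumes "open S" "\<And>x. x \<in> S \<Longrightarrow> f x = g x"
  shows "Ck_on k S f \<longleftrightarrow> Ck_on k S g"
  using assms(2)
proof (induction k arbitrary: f g)
  case 0
  then show ?case by (auto cong: continuous_on_cong)
next
  case (Suc k)
  have d: "g' differentiable (at x)"
    if "\<And>x. x \<in> S \<Longrightarrow> f' x = g' x" "f' differentiable (at x)" "x \<in> S"
    for f' g' :: "'a \<Rightarrow> 'b" and x
    using that assms(1) unfolding differentiable_def
    by (meson has_derivative_transform_within_open)
  show ?case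
  proof (cases "\<forall>x\<in>S. f differentiable (at x)")
    case True
    have "frechet_derivative f (at x) v = frechet_derivative g (at x) v" if "x \<in> S" for x v
      using frechet_derivative_transform_within_open[of f x S g] True that assms(1) Suc.prems by auto
    then have "Ck_on k S (\<lambda>x. frechet_derivative f (at x) v) \<longleftrightarrow>
        Ck_on k S (\<lambda>x. frechet_derivative g (at x) v)" for v
      by (intro Suc.IH) auto
    moreover have "\<forall>x\<in>S. g differentiable (at x)"
      using d[of f g] True Suc.prems by auto
    ultimately show ?thesis using True by auto
  next
    case False
    then show ?thesis using d[of g f] Suc.prems by auto
  qed
qed

lemma Ck_on_subset: "Ck_on k S f \<Longrightarrow> T \<subseteq> S \<Longrightarrow> Ck_on k T f"
  by (induction k arbitrary: f) (auto intro: continuous_on_subset)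

lemma Ck_on_Suc_imp: "Ck_on (Suc k) S f \<Longrightarrow> Ck_on k S f"
proof (induction k arbitrary: f)
  case 0
  then show ?case
    by (simp add: continuous_at_imp_continuous_on differentiable_imp_continuous_within)
next
  case (Suc k)
  then show ?case by (metis Ck_on.simps(2))
qed

lemma Ck_on_local:
  assumes "\<And>x. x \<in> S \<Longrightarrow> \<exists>T. open T \<and> x \<in> T \<and> Ck_on k T f"
  shows "Ck_on k S f"
  using assms
proof (induction k arbitrary: f)
  case 0
  have "isCont f x" if "x \<in> S" for x
    using 0[OF that] by (auto simp: continuous_on_eq_continuous_at)
  then show ?case by (simp add: continuous_at_imp_continuous_on)
next
  case (Suc k)
  have "Ck_on k S (\<lambda>x. frechet_derivative f (at x) v)" for v
    by (rule Suc.IH) (use Suc.prems in fastforce)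
  then show ?case using Suc.prems by fastforce
qed

lemma Ck_on_const: "Ck_on k S (\<lambda>x. c)"
  by (induction k arbitrary: c) auto

lemma Ck_on_add:
  assumes "open S" "Ck_on k S f" "Ck_on k S g"
  shows "Ck_on k S (\<lambda>x. f x + g x)"
  using assms(2,3)
proof (induction k arbitrary: f g)
  case 0
  then show ?case by (auto intro: continuous_intros)
next
  case (Suc k)
  have "frechet_derivative (\<lambda>x. f x + g x) (at x) v =
      frechet_derivative f (at x) v + frechet_derivative g (at x) v" if "x \<in> S" for x v
  proof -
    have "((\<lambda>x. f x + g x) has_derivative
        (\<lambda>v. frechet_derivative f (at x) v + frechet_derivative g (at x) v)) (at x)"
      using that Suc.prems by (intro has_derivative_add) (auto simp: frechet_derivative_works)
    from frechet_derivative_at[OF this, symmetric] show ?thesis by simp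
  qed
  then have "Ck_on k S (\<lambda>x. frechet_derivative (\<lambda>x. f x + g x) (at x) v)" for v
    using Suc.IH[of "\<lambda>x. frechet_derivative f (at x) v" "\<lambda>x. frechet_derivative g (at x) v"] Suc.prems
    by (subst Ck_on_cong[OF assms(1)]) auto
  then show ?case using Suc.prems by auto
qed

lemma Ck_on_bounded_linear:
  assumes "bounded_linear L" "open S" "Ck_on k S f"
  shows "Ck_on k S (\<lambda>x. L (f x))"
  using assms(3)
proof (induction k arbitrary: f)
  case 0
  then show ?case
    by (auto intro: bounded_linear.continuous_on[OF assms(1)])
next
  case (Suc k)
  have *: "((\<lambda>x. L (f x)) has_derivative (\<lambda>v. L (frechet_derivative f (at x) v))) (at x)"
    if "x \<in> S" for x
    using that Suc.prems
    by (intro bounded_linear.has_derivative[OF assms(1)]) (auto simp: frechet_derivative_works)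
  have "frechet_derivative (\<lambda>x. L (f x)) (at x) v = L (frechet_derivative f (at x) v)"
    if "x \<in> S" for x v
    using frechet_derivative_at[OF *[OF that], symmetric] by simp
  then have "Ck_on k S (\<lambda>x. frechet_derivative (\<lambda>x. L (f x)) (at x) v)" for v
    using Suc by (subst Ck_on_cong[OF assms(2)]) auto
  then show ?case using * by (auto simp: differentiable_def)
qed

lemma Ck_on_bounded_bilinear:
  assumes "bounded_bilinear B" "open S" "Ck_on k S f" "Ck_on k S g"
  shows "Ck_on k S (\<lambda>x. B (f x) (g x))"
  using assms(3,4)
proof (induction k arbitrary: f g)
  case 0
  then show ?case by (auto intro: bounded_bilinear.continuous_on[OF assms(1)])
next
  case (Suc k)
  have *: "((\<lambda>x. B (f x) (g x)) has_derivative
      (\<lambda>v. B (f x) (frechet_derivative g (at x) v) + B (frechet_derivative f (at x) v) (g x))) (at x)"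
    if "x \<in> S" for x
    using that Suc.prems
    by (intro bounded_bilinear.FDERIV[OF assms(1)]) (auto simp: frechet_derivative_works)
  have "frechet_derivative (\<lambda>x. B (f x) (g x)) (at x) v =
      B (f x) (frechet_derivative g (at x) v) + B (frechet_derivative f (at x) v) (g x)"
    if "x \<in> S" for x v
    using frechet_derivative_at[OF *[OF that], symmetric] by simp
  moreover have "Ck_on k S (\<lambda>x. B (f x) (frechet_derivative g (at x) v) + B (frechet_derivative f (at x) v) (g x))" for v
    using Suc.prems by (intro Ck_on_add[OF assms(2)] Suc.IH) (auto intro: Ck_on_Suc_imp)
  ultimately have "Ck_on k S (\<lambda>x. frechet_derivative (\<lambda>x. B (f x) (g x)) (at x) v)" for v
    by (subst Ck_on_cong[OF assms(2)]) auto
  then show ?case using * by (auto simp: differentiable_def)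
qed

lemma Ck_on_ident: "Ck_on k S (\<lambda>x. x)"
  by (cases k) (auto simp: Ck_on_const)

lemma Ck_on_sum:
  assumes "open S" "\<And>i. i \<in> I \<Longrightarrow> Ck_on k S (f i)"
  shows "Ck_on k S (\<lambda>x. \<Sum>i\<in>I. f i x)"
  using assms(2)
  by (induction I rule: infinite_finite_induct) (auto intro: Ck_on_const Ck_on_add[OF assms(1)])

text \<open>\<open>Ck_on\<close> controls derivatives in fixed directions only, whereas the chain
  rule evaluates the derivative of \<open>g\<close> in the moving direction \<open>Df v\<close>.
  Expanding that direction in the standard basis leaves products of a coefficient with a
  fixed-direction derivative, to which the induction applies.\<close>

lemma Ck_on_compose:
  fixes f :: "'a::euclidean_space \<Rightarrow> 'b::euclidean_space" and g :: "'b \<Rightarrow> 'c::real_normed_vector"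
  assumes "open S" "open T" "f ` S \<subseteq> T" "Ck_on k S f" "Ck_on k T g"
  shows "Ck_on k S (\<lambda>x. g (f x))"
  using assms(4,5)
proof (induction k arbitrary: g)
  case 0
  then show ?case using assms(3) by (auto intro: continuous_on_compose2)
next
  case (Suc k)
  have *: "((\<lambda>x. g (f x)) has_derivative
      (\<lambda>v. frechet_derivative g (at (f x)) (frechet_derivative f (at x) v))) (at x)"
    if "x \<in> S" for x
    using that Suc.prems assms(3) diff_chain_at[of f _ x g]
    by (auto simp: frechet_derivative_works o_def)
  have "frechet_derivative (\<lambda>x. g (f x)) (at x) v =
      (\<Sum>b\<in>Basis. (frechet_derivative f (at x) v \<bullet> b) *\<^sub>R frechet_derivative g (at (f x)) b)"
    if "x \<in> S" for x v
  proof -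
    have l: "linear (frechet_derivative g (at (f x)))"
      using that Suc.prems assms(3) by (intro linear_frechet_derivative) auto
    have "frechet_derivative (\<lambda>x. g (f x)) (at x) v =
      frechet_derivative g (at (f x)) (\<Sum>b\<in>Basis. (frechet_derivative f (at x) v \<bullet> b) *\<^sub>R b)"
      using frechet_derivative_at[OF *[OF that], symmetric] by (simp add: euclidean_representation)
    also have "\<dots> = (\<Sum>b\<in>Basis. (frechet_derivative f (at x) v \<bullet> b) *\<^sub>R frechet_derivative g (at (f x)) b)"
      by (simp add: linear_sum[OF l] linear_cmul[OF l])
    finally show ?thesis .
  qed
  moreover have "Ck_on k S (\<lambda>x. \<Sum>b\<in>Basis. (frechet_derivative f (at x) v \<bullet> b) *\<^sub>R
      frechet_derivative g (at (f x)) b)" for v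
  proof (intro Ck_on_sum[OF assms(1)])
    fix b :: 'b
    have "Ck_on k S (\<lambda>x. frechet_derivative f (at x) v \<bullet> b)"
      using Suc.prems by (intro Ck_on_bounded_linear[OF bounded_linear_inner_left assms(1)]) auto
    moreover have "Ck_on k S (\<lambda>x. frechet_derivative g (at (f x)) b)"
      using Suc.prems by (intro Suc.IH) (auto intro: Ck_on_Suc_imp)
    ultimately show "Ck_on k S (\<lambda>x. (frechet_derivative f (at x) v \<bullet> b) *\<^sub>R
      frechet_derivative g (at (f x)) b)"
      by (rule Ck_on_bounded_bilinear[OF bounded_bilinear_scaleR assms(1)])
  qed
  ultimately have "Ck_on k S (\<lambda>x. frechet_derivative (\<lambda>x. g (f x)) (at x) v)" for v
    by (subst Ck_on_cong[OF assms(1)]) auto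
  then show ?case using * by (auto simp: differentiable_def)
qed

lemma Ck_on_real_deriv:
  fixes f f' :: "real \<Rightarrow> real"
  assumes "open S" "\<And>x. x \<in> S \<Longrightarrow> (f has_real_derivative f' x) (at x)" "Ck_on k S f'"
  shows "Ck_on (Suc k) S f"
proof -
  have *: "(f has_derivative (\<lambda>v. v * f' x)) (at x)" if "x \<in> S" for x
    using assms(2)[OF that] unfolding has_field_derivative_def
    by (rule has_derivative_eq_rhs) (simp add: fun_eq_iff mult.commute)
  have "frechet_derivative f (at x) v = v * f' x" if "x \<in> S" for x v
    using frechet_derivative_at[OF *[OF that], symmetric] by simp
  then have "Ck_on k S (\<lambda>x. frechet_derivative f (at x) v)" for v
    using Ck_on_bounded_linear[OF bounded_linear_mult_right[of v] assms(1,3)]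
    by (subst Ck_on_cong[OF assms(1)]) auto
  then show ?thesis using * by (auto simp: differentiable_def)
qed

text \<open>The derivative is a polynomial in the function itself, so the induction on the order
  closes.\<close>

lemma Ck_on_inverse_real: "Ck_on k (-{0}) (inverse :: real \<Rightarrow> real)"
proof (induction k)
  case 0
  then show ?case by (auto intro: continuous_intros)
next
  case (Suc k)
  show ?case
  proof (rule Ck_on_real_deriv)
    show "open (-{0::real})" by auto
    fix x :: real assume "x \<in> -{0}"
    then show "(inverse has_real_derivative (-1) * (inverse x * inverse x)) (at x)"
      by (auto intro!: derivative_eq_intros simp: power2_eq_square)
  next
    show "Ck_on k (-{0::real}) (\<lambda>x. (-1) * (inverse x * inverse x))"
      by (intro Ck_on_bounded_linear[OF bounded_linear_mult_right]
          Ck_on_bounded_bilinear[OF bounded_bilinear_mult]) (auto intro: Suc)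
  qed
qed

section \<open>Maps that are smooth to all orders\<close>

lemma smooth_on_open: "smooth_on S f \<Longrightarrow> open S"
  by (simp add: smooth_on_def)

lemma smooth_on_cong:
  assumes "\<And>x. x \<in> S \<Longrightarrow> f x = g x"
  shows "smooth_on S f \<longleftrightarrow> smooth_on S g"
  using Ck_on_cong[of S f g] assms unfolding smooth_on_def by blast

lemma smooth_on_subset: "smooth_on S f \<Longrightarrow> T \<subseteq> S \<Longrightarrow> open T \<Longrightarrow> smooth_on T f"
  using Ck_on_subset unfolding smooth_on_def by blast

lemma smooth_on_local:
  assumes "\<And>x. x \<in> S \<Longrightarrow> \<exists>T. x \<in> T \<and> T \<subseteq> S \<and> smooth_on T f"
  shows "smooth_on S f"
proof -
  have "open S"
    unfolding open_subopen[of S] using assms smooth_on_open by blast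
  moreover have "Ck_on k S f" for k
    by (rule Ck_on_local) (use assms in \<open>fastforce simp: smooth_on_def\<close>)
  ultimately show ?thesis by (simp add: smooth_on_def)
qed

lemma smooth_on_const: "open S \<Longrightarrow> smooth_on S (\<lambda>x. c)"
  by (simp add: smooth_on_def Ck_on_const)

lemma smooth_on_ident: "open S \<Longrightarrow> smooth_on S (\<lambda>x. x)"
  by (simp add: smooth_on_def Ck_on_ident)

lemma smooth_on_add: "smooth_on S f \<Longrightarrow> smooth_on S g \<Longrightarrow> smooth_on S (\<lambda>x. f x + g x)"
  by (simp add: smooth_on_def Ck_on_add)

lemma smooth_on_bounded_linear:
  "bounded_linear L \<Longrightarrow> smooth_on S f \<Longrightarrow> smooth_on S (\<lambda>x. L (f x))"
  by (simp add: smooth_on_def Ck_on_bounded_linear)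

lemma smooth_on_linear:
  fixes L :: "'v::euclidean_space \<Rightarrow> 'w::real_normed_vector"
  shows "linear L \<Longrightarrow> smooth_on S f \<Longrightarrow> smooth_on S (\<lambda>x. L (f x))"
  using smooth_on_bounded_linear linear_conv_bounded_linear by blast

lemma smooth_on_bounded_bilinear:
  "bounded_bilinear B \<Longrightarrow> smooth_on S f \<Longrightarrow> smooth_on S g \<Longrightarrow> smooth_on S (\<lambda>x. B (f x) (g x))"
  by (simp add: smooth_on_def Ck_on_bounded_bilinear)

lemma smooth_on_sum:
  "open S \<Longrightarrow> (\<And>i. i \<in> I \<Longrightarrow> smooth_on S (f i)) \<Longrightarrow> smooth_on S (\<lambda>x. \<Sum>i\<in>I. f i x)"
  by (simp add: smooth_on_def Ck_on_sum)

lemma smooth_on_mult: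
  fixes f g :: "'e::euclidean_space \<Rightarrow> real"
  shows "smooth_on S f \<Longrightarrow> smooth_on S g \<Longrightarrow> smooth_on S (\<lambda>x. f x * g x)"
  by (rule smooth_on_bounded_bilinear[OF bounded_bilinear_mult])

lemma smooth_on_prod:
  fixes f :: "'i \<Rightarrow> 'e::euclidean_space \<Rightarrow> real"
  assumes "open S" "\<And>i. i \<in> I \<Longrightarrow> smooth_on S (f i)"
  shows "smooth_on S (\<lambda>x. \<Prod>i\<in>I. f i x)"
  using assms(2)
  by (induction I rule: infinite_finite_induct)
    (auto intro: smooth_on_const[OF assms(1)] smooth_on_mult)

lemma smooth_on_compose:
  fixes f :: "'a::euclidean_space \<Rightarrow> 'b::euclidean_space"
  assumes "smooth_on S f" "smooth_on T g" "f ` S \<subseteq> T"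
  shows "smooth_on S (\<lambda>x. g (f x))"
  using assms by (auto simp: smooth_on_def intro: Ck_on_compose)

lemma smooth_on_componentwise:
  fixes f :: "'e::euclidean_space \<Rightarrow> 'v::euclidean_space"
  assumes "open S" "\<And>b. b \<in> Basis \<Longrightarrow> smooth_on S (\<lambda>x. f x \<bullet> b)"
  shows "smooth_on S f"
proof -
  have "smooth_on S (\<lambda>x. \<Sum>b\<in>Basis. (f x \<bullet> b) *\<^sub>R b)"
    using assms
    by (intro smooth_on_sum smooth_on_bounded_linear[OF bounded_linear_scaleR_left]) auto
  then show ?thesis by (simp add: euclidean_representation)
qed

lemma smooth_on_Pair:
  fixes f :: "'e::euclidean_space \<Rightarrow> 'v::real_normed_vector" and g :: "'e \<Rightarrow> 'w::real_normed_vector"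
  assumes "smooth_on S f" "smooth_on S g"
  shows "smooth_on S (\<lambda>x. (f x, g x))"
proof -
  have "smooth_on S (\<lambda>x. (f x, 0) + (0, g x))"
    using assms
    by (intro smooth_on_add smooth_on_bounded_linear[where L="\<lambda>y. (y, 0)"]
        smooth_on_bounded_linear[where L="\<lambda>y. (0, y)"])
      (auto intro!: bounded_linear_Pair bounded_linear_ident bounded_linear_zero)
  then show ?thesis by simp
qed

lemma smooth_on_inverse:
  fixes f :: "'e::euclidean_space \<Rightarrow> real"
  assumes "smooth_on S f" "\<And>x. x \<in> S \<Longrightarrow> f x \<noteq> 0"
  shows "smooth_on S (\<lambda>x. inverse (f x))"
proof (rule smooth_on_compose[OF assms(1), where g=inverse and T="-{0}"])
  show "smooth_on (-{0}) (inverse :: real \<Rightarrow> real)"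
    by (simp add: smooth_on_def Ck_on_inverse_real open_Compl)
qed (use assms(2) in auto)

lemma smooth_on_divide:
  fixes f g :: "'e::euclidean_space \<Rightarrow> real"
  assumes "smooth_on S f" "smooth_on S g" "\<And>x. x \<in> S \<Longrightarrow> g x \<noteq> 0"
  shows "smooth_on S (\<lambda>x. f x / g x)"
  unfolding divide_inverse by (rule smooth_on_mult[OF assms(1) smooth_on_inverse[OF assms(2,3)]])

lemma smooth_on_vec_lambda:
  fixes f :: "'i::finite \<Rightarrow> 'e::euclidean_space \<Rightarrow> 'v::euclidean_space"
  assumes "open S" "\<And>i. smooth_on S (f i)"
  shows "smooth_on S (\<lambda>x. \<chi> i. f i x)"
proof (rule smooth_on_componentwise[OF assms(1)])
  fix b :: "'v^'i" assume "b \<in> Basis"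
  then obtain i u where "b = axis i u" unfolding Basis_vec_def by blast
  then show "smooth_on S (\<lambda>x. (\<chi> i. f i x) \<bullet> b)"
    using smooth_on_bounded_linear[OF bounded_linear_inner_left[of u] assms(2)[of i]]
    by (simp only: inner_axis vec_lambda_beta)
qed

lemma smooth_on_vec_nth:
  fixes f :: "'e::euclidean_space \<Rightarrow> ('v::real_normed_vector)^'i"
  shows "smooth_on S f \<Longrightarrow> smooth_on S (\<lambda>x. f x $ i)"
  by (rule smooth_on_bounded_linear[OF bounded_linear_vec_nth])

lemma smooth_on_det:
  fixes f :: "'e::euclidean_space \<Rightarrow> real^'i^'i"
  assumes "smooth_on S f"
  shows "smooth_on S (\<lambda>x. det (f x))"
  unfolding det_def using smooth_on_open[OF assms]
  by (intro smooth_on_sum smooth_on_mult smooth_on_const smooth_on_prod smooth_on_vec_nth assms) auto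

text \<open>Cramer's rule writes the components of \<open>u\<close> as quotients of determinants of
  smooth matrices. Nothing is assumed about the regularity of \<open>u\<close>, which is what makes
  the lemma usable for solutions obtained by pointwise choice.\<close>

lemma smooth_on_solve:
  fixes G :: "'e::euclidean_space \<Rightarrow> real^'i^'i"
  assumes G: "smooth_on S G" and b: "smooth_on S b"
    and det: "\<And>x. x \<in> S \<Longrightarrow> det (G x) \<noteq> 0" and eq: "\<And>x. x \<in> S \<Longrightarrow> G x *v u x = b x"
  shows "smooth_on S u"
proof -
  note op = smooth_on_open[OF G]
  have "smooth_on S (\<lambda>x. \<chi> k. det (\<chi> i j. if j = k then b x $ i else G x $ i $ j) / det (G x))"
  proof (intro smooth_on_vec_lambda smooth_on_divide smooth_on_det op G det)
    fix k i j :: 'i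
    show "smooth_on S (\<lambda>x. if j = k then b x $ i else G x $ i $ j)"
      using smooth_on_vec_nth[OF smooth_on_vec_nth[OF G]] smooth_on_vec_nth[OF b] by (cases "j = k") simp_all
  qed
  moreover have "(\<chi> k. det (\<chi> i j. if j = k then b x $ i else G x $ i $ j) / det (G x)) = u x"
    if "x \<in> S" for x
    using iffD1[OF cramer[OF det[OF that]] eq[OF that]] by simp
  ultimately show ?thesis by (rule iffD1[OF smooth_on_cong, rotated])
qed

subsection \<open>Bump functions\<close>

lemma tendsto_inverse_power_exp:
  "((\<lambda>t::real. inverse t ^ j * exp (- inverse t)) \<longlongrightarrow> 0) (at_right 0)"
proof -
  have "((\<lambda>x::real. x ^ j / exp x) \<longlongrightarrow> 0) at_top"
    by (rule tendsto_power_div_exp_0)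
  then have "((\<lambda>t::real. inverse t ^ j / exp (inverse t)) \<longlongrightarrow> 0) (at_right 0)"
    by (rule filterlim_compose) (rule filterlim_inverse_at_top_right)
  then show ?thesis by (simp only: exp_minus divide_inverse)
qed

text \<open>For \<open>j = 0\<close> this is the classical function exp(-1/t), extended by zero. The
  negative powers are carried along because the family is closed under differentiation, which lets
  the order of smoothness be raised by induction for all \<open>j\<close> at once.\<close>

definition flat_exp :: "nat \<Rightarrow> real \<Rightarrow> real" where
  "flat_exp j t = (if t > 0 then inverse t ^ j * exp (- inverse t) else 0)"

lemma flat_exp_deriv:
  "(flat_exp j has_real_derivative (- real j * flat_exp (Suc j) t + flat_exp (Suc (Suc j)) t)) (at t)"
proof -
  consider "t < 0" | "t > 0" | "t = 0" by linarith
  then show ?thesis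
  proof cases
    case 1
    have "((\<lambda>t. 0) has_real_derivative 0) (at t)" by auto
    then have "(flat_exp j has_real_derivative 0) (at t)"
      by (rule has_field_derivative_transform_within_open[of _ _ _ "{..<0}"])
        (use 1 in \<open>auto simp: flat_exp_def\<close>)
    then show ?thesis using 1 by (simp add: flat_exp_def)
  next
    case 2
    have "((\<lambda>t. inverse t) has_real_derivative - (inverse t * inverse t)) (at t)"
      using DERIV_inverse[of t] 2 by (simp add: power2_eq_square)
    moreover have "((\<lambda>u. u ^ j * exp (- u)) has_real_derivative
        (real j * u ^ (j - 1) - u ^ j) * exp (- u)) (at u)" for u :: real
      by (auto intro!: derivative_eq_intros simp: algebra_simps)
    ultimately have "((\<lambda>t. inverse t ^ j * exp (- inverse t)) has_real_derivative
       ((real j * inverse t ^ (j - 1) - inverse t ^ j) * exp (- inverse t)) * (- (inverse t * inverse t))) (at t)"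
      by (rule DERIV_chain2[rotated])
    moreover have "((real j * inverse t ^ (j - 1) - inverse t ^ j) * exp (- inverse t)) * (- (inverse t * inverse t))
      = - real j * (inverse t ^ Suc j * exp (- inverse t)) + inverse t ^ Suc (Suc j) * exp (- inverse t)"
      by (cases j) (simp_all add: algebra_simps)
    ultimately have "((\<lambda>t. inverse t ^ j * exp (- inverse t)) has_real_derivative
       (- real j * (inverse t ^ Suc j * exp (- inverse t)) + inverse t ^ Suc (Suc j) * exp (- inverse t))) (at t)"
      by simp
    then have "(flat_exp j has_real_derivative
       (- real j * (inverse t ^ Suc j * exp (- inverse t)) + inverse t ^ Suc (Suc j) * exp (- inverse t))) (at t)"
      by (rule has_field_derivative_transform_within_open[of _ _ _ "{0<..}"])
        (use 2 in \<open>auto simp: flat_exp_def\<close>)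
    then show ?thesis using 2 by (simp add: flat_exp_def)
  next
    case 3
    have "((\<lambda>y. flat_exp (Suc j) y) \<longlongrightarrow> 0) (at_right 0)"
      by (rule Lim_transform_eventually[OF tendsto_inverse_power_exp[of "Suc j"]])
        (auto simp: flat_exp_def eventually_at_filter)
    moreover have "((\<lambda>y. flat_exp (Suc j) y) \<longlongrightarrow> 0) (at_left 0)"
      by (rule Lim_transform_eventually[OF tendsto_const])
        (auto simp: flat_exp_def eventually_at_filter)
    ultimately have "((\<lambda>y. flat_exp (Suc j) y) \<longlongrightarrow> 0) (at 0)"
      by (simp add: filterlim_at_split)
    \<comment> \<open>At 0 the difference quotient of the function with index \<open>j\<close> is
      the function with index \<open>Suc j\<close>, whose limit is known.\<close>
    then have "((\<lambda>y. (flat_exp j y - flat_exp j 0) / (y - 0)) \<longlongrightarrow> 0) (at 0)"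
      by (rule Lim_transform_eventually)
        (auto simp: flat_exp_def divide_inverse eventually_at_filter)
    then show ?thesis using 3 by (simp add: has_field_derivative_iff flat_exp_def)
  qed
qed

lemma Ck_on_flat_exp: "Ck_on k UNIV (flat_exp j)"
proof (induction k arbitrary: j)
  case 0
  have "isCont (flat_exp j) x" for x using flat_exp_deriv DERIV_isCont by blast
  then show ?case by (simp add: continuous_at_imp_continuous_on)
next
  case (Suc k)
  have "Ck_on k UNIV (\<lambda>t. - real j * flat_exp (Suc j) t + flat_exp (Suc (Suc j)) t)"
    by (intro Ck_on_add Ck_on_bounded_linear[OF bounded_linear_mult_right] Suc) auto
  then show ?case by (intro Ck_on_real_deriv[OF _ flat_exp_deriv]) auto
qed

lemma euclidean_bump:
  fixes p :: "'e::euclidean_space"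
  assumes "r > 0"
  obtains \<beta> :: "'e \<Rightarrow> real"
  where "smooth_on UNIV \<beta>" "\<beta> p = 1" "\<And>x. x \<notin> ball p r \<Longrightarrow> \<beta> x = 0"
proof
  \<comment> \<open>The squared distance is taken because it is polynomial, while the norm is not
    differentiable at \<open>p\<close>. The factor in \<open>?b\<close> normalises the value at
    \<open>p\<close> to 1.\<close>
  let ?q = "\<lambda>x. r\<^sup>2 - (x - p) \<bullet> (x - p)"
  let ?b = "\<lambda>x. inverse (flat_exp 0 (r\<^sup>2)) * flat_exp 0 (?q x)"
  have "smooth_on UNIV (\<lambda>x. r\<^sup>2 + (-1) * ((x + - p) \<bullet> (x + - p)))"
    by (intro smooth_on_add smooth_on_mult smooth_on_bounded_bilinear[OF bounded_bilinear_inner]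
        smooth_on_const smooth_on_ident) auto
  then have "smooth_on UNIV ?q" by simp
  moreover have "smooth_on UNIV (flat_exp 0)" by (simp add: smooth_on_def Ck_on_flat_exp)
  ultimately have "smooth_on UNIV (\<lambda>x. flat_exp 0 (?q x))"
    using smooth_on_compose by blast
  then show "smooth_on UNIV ?b" by (intro smooth_on_mult smooth_on_const) auto
  show "?b p = 1" using assms by (auto simp: flat_exp_def)
  show "?b x = 0" if "x \<notin> ball p r" for x
  proof -
    have "r \<le> norm (x - p)" using that by (simp add: dist_norm norm_minus_commute)
    then have "r\<^sup>2 \<le> (norm (x - p))\<^sup>2" using assms by (intro power_mono) auto
    then show ?thesis by (simp add: flat_exp_def power2_norm_eq_inner)
  qed
qed

lemma smooth_on_has_derivative:
  assumes "smooth_on S f" "p \<in> S"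
  shows "(f has_derivative frechet_derivative f (at p)) (at p)"
proof -
  have "Ck_on (Suc 0) S f" using assms(1) unfolding smooth_on_def by blast
  then show ?thesis using assms(2) by (simp add: frechet_derivative_works)
qed

lemma smooth_on_frechet_derivative:
  assumes "smooth_on S f"
  shows "smooth_on S (\<lambda>p. frechet_derivative f (at p) v)"
  unfolding smooth_on_def
proof (intro conjI allI)
  fix k
  have "Ck_on (Suc k) S f" using assms unfolding smooth_on_def by blast
  then show "Ck_on k S (\<lambda>p. frechet_derivative f (at p) v)" by simp
qed (use assms smooth_on_open in blast)

lemma smooth_on_continuous: "smooth_on S f \<Longrightarrow> continuous_on S f"
  unfolding smooth_on_def using Ck_on.simps(1) by blast

section \<open>Smooth functions on a manifold\<close>

text \<open>Injectivity of the charts is enough, since openness of the coordinate domains is built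
  into \<open>smooth_on\<close>. The lemma thus covers bundle charts, whose total space carries no
  topology.\<close>

lemma smooth_map_comp:
  assumes f: "smooth_map C D f" and g: "smooth_map D E g"
    and C: "\<And>c. c \<in> C \<Longrightarrow> inj_on (snd c) (fst c)" and D: "\<And>d. d \<in> D \<Longrightarrow> inj_on (snd d) (fst d)"
  shows "smooth_map C E (\<lambda>x. g (f x))"
  unfolding smooth_map_def
proof (intro conjI ballI)
  show "(\<lambda>x. g (f x)) ` (\<Union>c\<in>C. fst c) \<subseteq> (\<Union>d\<in>E. fst d)"
    using conjunct1[OF f[unfolded smooth_map_def]] conjunct1[OF g[unfolded smooth_map_def]]
    by (fastforce simp: image_subset_iff)
  fix c e assume c: "c \<in> C" and e: "e \<in> E"
  show "smooth_on (snd c ` (fst c \<inter> (\<lambda>x. g (f x)) -` fst e)) (snd e \<circ> (\<lambda>x. g (f x)) \<circ> chart_inv c)"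
  proof (rule smooth_on_local)
    fix p assume "p \<in> snd c ` (fst c \<inter> (\<lambda>x. g (f x)) -` fst e)"
    then obtain x where x: "x \<in> fst c" "g (f x) \<in> fst e" "p = snd c x" by blast
    then have "f x \<in> (\<Union>d\<in>D. fst d)" using f c unfolding smooth_map_def by blast
    then obtain d where d: "d \<in> D" "f x \<in> fst d" by blast
    define A where "A = snd c ` (fst c \<inter> f -` fst d)"
    define B where "B = snd d ` (fst d \<inter> g -` fst e)"
    have A: "smooth_on A (snd d \<circ> f \<circ> chart_inv c)"
      using f c d unfolding smooth_map_def A_def by blast
    have B: "smooth_on B (snd e \<circ> g \<circ> chart_inv d)"
      using g e d unfolding smooth_map_def B_def by blast
    \<comment> \<open>Around \<open>p\<close> the intermediate value can be kept inside the single
      chart \<open>d\<close>; on \<open>T\<close> both this and membership of the final value in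
      \<open>e\<close> hold, so the coordinate expressions really compose.\<close>
    define T where "T = A \<inter> (snd d \<circ> f \<circ> chart_inv c) -` B"
    have T: "open T"
      unfolding T_def
      by (rule continuous_open_preimage[OF smooth_on_continuous[OF A] smooth_on_open[OF A] smooth_on_open[OF B]])
    have pT: "p \<in> T"
      using x d C[OF c] unfolding T_def A_def B_def by auto
    have T_elim: "\<exists>y. y \<in> fst c \<and> f y \<in> fst d \<and> g (f y) \<in> fst e \<and> q = snd c y" if "q \<in> T" for q
    proof -
      from that obtain y where y: "y \<in> fst c" "f y \<in> fst d" "q = snd c y"
        unfolding T_def A_def by blast
      have "snd d (f y) \<in> B" using that y C[OF c] unfolding T_def by auto
      then obtain z where z: "z \<in> fst d" "g z \<in> fst e" "snd d (f y) = snd d z"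
        unfolding B_def by blast
      then have "f y = z" using D[OF d(1)] y(2) by (meson inj_onD)
      with y z show ?thesis by blast
    qed
    have "smooth_on T (\<lambda>q. (snd e \<circ> g \<circ> chart_inv d) ((snd d \<circ> f \<circ> chart_inv c) q))"
      by (rule smooth_on_compose[OF smooth_on_subset[OF A _ T] B]) (auto simp: T_def)
    moreover have "(snd e \<circ> g \<circ> chart_inv d) ((snd d \<circ> f \<circ> chart_inv c) q) =
        (snd e \<circ> (\<lambda>x. g (f x)) \<circ> chart_inv c) q" if "q \<in> T" for q
    proof -
      from T_elim[OF that] obtain y where y: "y \<in> fst c" "f y \<in> fst d" "q = snd c y" by blast
      then show ?thesis using C[OF c] D[OF d(1)] by simp
    qed
    ultimately have "smooth_on T (snd e \<circ> (\<lambda>x. g (f x)) \<circ> chart_inv c)"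
      by (rule iffD1[OF smooth_on_cong, rotated])
    moreover have "T \<subseteq> snd c ` (fst c \<inter> (\<lambda>x. g (f x)) -` fst e)"
      using T_elim by blast
    ultimately show "\<exists>T. p \<in> T \<and> T \<subseteq> snd c ` (fst c \<inter> (\<lambda>x. g (f x)) -` fst e) \<and>
        smooth_on T (snd e \<circ> (\<lambda>x. g (f x)) \<circ> chart_inv c)"
      using pT by blast
  qed
qed

text \<open>A form of \<open>smooth_map\<close> for vector-valued maps on an open part of the
  manifold. The inverse of the full chart is used, which agrees on the relevant set with the inverse
  of the restricted chart and avoids carrying restricted atlases around.\<close>

definition msmooth ::
    "('a::topological_space, 'e::euclidean_space) chart set \<Rightarrow> 'a set \<Rightarrow> ('a \<Rightarrow> 'v::real_normed_vector) \<Rightarrow> bool"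
  where
  "msmooth M U F \<longleftrightarrow>
     open U \<and> (\<forall>c\<in>M. smooth_on (snd c ` (fst c \<inter> U)) (\<lambda>p. F (chart_inv c p)))"

lemma msmooth_open: "msmooth M U F \<Longrightarrow> open U"
  by (simp add: msmooth_def)

lemma msmooth_compose:
  fixes F :: "_ \<Rightarrow> 'v::euclidean_space"
  assumes "msmooth M U F" "smooth_on T g" "\<And>x. x \<in> U \<Longrightarrow> F x \<in> T"
    and inj: "\<And>c. c \<in> M \<Longrightarrow> inj_on (snd c) (fst c)"
  shows "msmooth M U (\<lambda>x. g (F x))"
  unfolding msmooth_def
proof (intro conjI ballI)
  fix c assume c: "c \<in> M"
  show "smooth_on (snd c ` (fst c \<inter> U)) (\<lambda>p. g (F (chart_inv c p)))"
    by (rule smooth_on_compose[where T=T]) (use assms(1-3) inj[OF c] c in \<open>auto simp: msmooth_def\<close>)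
qed (use assms msmooth_open in blast)

lemma msmooth_bounded_linear:
  assumes "bounded_linear L" "msmooth M U F"
  shows "msmooth M U (\<lambda>x. L (F x))"
  unfolding msmooth_def
proof (intro conjI ballI)
  fix c assume "c \<in> M"
  then have "smooth_on (snd c ` (fst c \<inter> U)) (\<lambda>p. F (chart_inv c p))"
    using assms(2) unfolding msmooth_def by blast
  then show "smooth_on (snd c ` (fst c \<inter> U)) (\<lambda>p. L (F (chart_inv c p)))"
    by (rule smooth_on_bounded_linear[OF assms(1)])
qed (use assms msmooth_open in blast)

lemma msmooth_linear:
  fixes L :: "'v::euclidean_space \<Rightarrow> 'w::real_normed_vector"
  assumes "linear L" "msmooth M U F"
  shows "msmooth M U (\<lambda>x. L (F x))"
  by (rule msmooth_bounded_linear[OF linear_conv_bounded_linear[THEN iffD1, OF assms(1)] assms(2)])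

lemma msmooth_bounded_bilinear:
  assumes "bounded_bilinear B" "msmooth M U F" "msmooth M U G"
  shows "msmooth M U (\<lambda>x. B (F x) (G x))"
  unfolding msmooth_def
proof (intro conjI ballI)
  fix c assume "c \<in> M"
  then have "smooth_on (snd c ` (fst c \<inter> U)) (\<lambda>p. F (chart_inv c p))"
      "smooth_on (snd c ` (fst c \<inter> U)) (\<lambda>p. G (chart_inv c p))"
    using assms(2,3) unfolding msmooth_def by blast+
  then show "smooth_on (snd c ` (fst c \<inter> U)) (\<lambda>p. B (F (chart_inv c p)) (G (chart_inv c p)))"
    by (rule smooth_on_bounded_bilinear[OF assms(1)])
qed (use assms msmooth_open in blast)

lemma msmooth_add: "msmooth M U F \<Longrightarrow> msmooth M U G \<Longrightarrow> msmooth M U (\<lambda>x. F x + G x)"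
  unfolding msmooth_def by (simp add: smooth_on_add)

lemma msmooth_diff: "msmooth M U F \<Longrightarrow> msmooth M U G \<Longrightarrow> msmooth M U (\<lambda>x. F x - G x)"
  using msmooth_add[OF _ msmooth_bounded_linear[OF bounded_linear_minus[OF bounded_linear_ident]], of M U F G]
  by simp

lemma msmooth_scaleR:
  "msmooth M U h \<Longrightarrow> msmooth M U F \<Longrightarrow> msmooth M U (\<lambda>x. h x *\<^sub>R F x)"
  by (rule msmooth_bounded_bilinear[OF bounded_bilinear_scaleR])

lemma bounded_bilinear_matrix_vector_mult:
  "bounded_bilinear ((*v) :: real^'n^'m \<Rightarrow> real^'n \<Rightarrow> real^'m)"
  by (rule bilinear_conv_bounded_bilinear[THEN iffD1])
    (auto simp: bilinear_def linear_iff matrix_vector_mult_add_rdistrib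
      matrix_vector_right_distrib scaleR_matrix_vector_assoc matrix_vector_mult_scaleR)

lemma msmooth_matrix_vector_mult:
  "msmooth M U F \<Longrightarrow> msmooth M U G \<Longrightarrow> msmooth M U (\<lambda>x. F x *v (G x :: real^'n))"
  by (rule msmooth_bounded_bilinear[OF bounded_bilinear_matrix_vector_mult])

locale manifold =
  fixes M :: "('a::{t2_space,second_countable_topology}, real^'n) chart set"
  assumes atlas: "smooth_atlas M"
begin

lemma chart_around: "\<exists>c\<in>M. x \<in> fst c"
  using atlas unfolding smooth_atlas_def by blast

lemma chart_open: "c \<in> M \<Longrightarrow> open (fst c)"
  using atlas unfolding smooth_atlas_def by blast

lemma chart_homeo: "c \<in> M \<Longrightarrow> homeomorphism (fst c) (snd c ` fst c) (snd c) (chart_inv c)"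
  using atlas unfolding smooth_atlas_def by blast

lemma chart_inv_chart [simp]: "c \<in> M \<Longrightarrow> x \<in> fst c \<Longrightarrow> chart_inv c (snd c x) = x"
  using chart_homeo homeomorphism_apply1 by blast

lemma chart_inj: "c \<in> M \<Longrightarrow> inj_on (snd c) (fst c)"
  by (rule inj_on_inverseI[of _ "chart_inv c"]) simp

lemma chart_image_open:
  assumes "c \<in> M" "open U"
  shows "open (snd c ` (fst c \<inter> U))"
proof -
  have "openin (top_of_set (snd c ` fst c)) (snd c ` (fst c \<inter> U))"
    using homeomorphism_imp_open_map[OF chart_homeo[OF assms(1)]] assms(2)
    by (simp add: openin_open_Int)
  moreover have "open (snd c ` fst c)"
    using atlas assms(1) unfolding smooth_atlas_def by blast
  ultimately show ?thesis by (rule openin_open_trans)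
qed

lemma chart_cont: "c \<in> M \<Longrightarrow> continuous_on (fst c) (snd c)"
  using chart_homeo homeomorphism_cont1 by blast

lemma chart_inv_cont: "c \<in> M \<Longrightarrow> continuous_on (snd c ` fst c) (chart_inv c)"
  using chart_homeo homeomorphism_cont2 by blast

lemma chart_transition:
  "c \<in> M \<Longrightarrow> d \<in> M \<Longrightarrow> smooth_on (snd c ` (fst c \<inter> fst d)) (\<lambda>p. snd d (chart_inv c p))"
  using atlas unfolding smooth_atlas_def smoothly_compatible_def o_def by blast

lemma msmoothD: "msmooth M U F \<Longrightarrow> c \<in> M \<Longrightarrow> smooth_on (snd c ` (fst c \<inter> U)) (\<lambda>p. F (chart_inv c p))"
  unfolding msmooth_def by blast

text \<open>One chart suffices because the expression in any other chart differs by a smooth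
  transition map.\<close>

lemma msmooth_chartI:
  assumes "c \<in> M" "open V" "V \<subseteq> fst c" "smooth_on (snd c ` V) (\<lambda>p. F (chart_inv c p))"
  shows "msmooth M V F"
  unfolding msmooth_def
proof (intro conjI ballI)
  fix d assume d: "d \<in> M"
  have "smooth_on (snd d ` (fst d \<inter> V)) (\<lambda>p. snd c (chart_inv d p))"
    by (rule smooth_on_subset[OF chart_transition[OF d assms(1)]])
      (use assms chart_image_open[OF d] in auto)
  then have "smooth_on (snd d ` (fst d \<inter> V)) (\<lambda>p. F (chart_inv c (snd c (chart_inv d p))))"
    by (rule smooth_on_compose[OF _ assms(4)]) (use d in auto)
  then show "smooth_on (snd d ` (fst d \<inter> V)) (\<lambda>p. F (chart_inv d p))"
    by (rule iffD1[OF smooth_on_cong, rotated]) (use assms d in auto)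
qed (rule assms)

lemma msmooth_local:
  assumes "\<And>x. x \<in> U \<Longrightarrow> \<exists>V. x \<in> V \<and> V \<subseteq> U \<and> msmooth M V F"
  shows "msmooth M U F"
  unfolding msmooth_def
proof (intro conjI ballI)
  show U: "open U"
  proof (subst open_subopen, intro ballI)
    fix x assume "x \<in> U"
    from assms[OF this] obtain V where "x \<in> V" "V \<subseteq> U" "msmooth M V F" by auto
    then show "\<exists>T. open T \<and> x \<in> T \<and> T \<subseteq> U"
      by (intro exI[of _ V]) (simp add: msmooth_open)
  qed
  fix c assume c: "c \<in> M"
  show "smooth_on (snd c ` (fst c \<inter> U)) (\<lambda>p. F (chart_inv c p))"
  proof (rule smooth_on_local)
    fix p assume "p \<in> snd c ` (fst c \<inter> U)"
    then obtain x where x: "x \<in> fst c" "x \<in> U" "p = snd c x" by blast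
    obtain V where V: "x \<in> V" "V \<subseteq> U" "msmooth M V F" using assms[OF x(2)] by blast
    have "p \<in> snd c ` (fst c \<inter> V)" "snd c ` (fst c \<inter> V) \<subseteq> snd c ` (fst c \<inter> U)"
      using x V by auto
    then show "\<exists>T. p \<in> T \<and> T \<subseteq> snd c ` (fst c \<inter> U) \<and> smooth_on T (\<lambda>p. F (chart_inv c p))"
      using msmoothD[OF V(3) c] by (intro exI[of _ "snd c ` (fst c \<inter> V)"] conjI)
  qed
qed

lemma msmooth_cong:
  assumes "\<And>x. x \<in> U \<Longrightarrow> F x = G x"
  shows "msmooth M U F \<longleftrightarrow> msmooth M U G"
proof -
  have "smooth_on (snd c ` (fst c \<inter> U)) (\<lambda>p. F (chart_inv c p)) \<longleftrightarrow>
      smooth_on (snd c ` (fst c \<inter> U)) (\<lambda>p. G (chart_inv c p))" if "c \<in> M" for c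
    by (rule smooth_on_cong) (use assms that in auto)
  then show ?thesis unfolding msmooth_def by blast
qed

lemma msmooth_subset:
  assumes "msmooth M U F" "V \<subseteq> U" "open V"
  shows "msmooth M V F"
  unfolding msmooth_def
proof (intro conjI ballI)
  fix c assume c: "c \<in> M"
  show "smooth_on (snd c ` (fst c \<inter> V)) (\<lambda>p. F (chart_inv c p))"
    by (rule smooth_on_subset[OF msmoothD[OF assms(1) c]])
      (use assms(2) chart_image_open[OF c assms(3)] in auto)
qed (rule assms)

lemma msmooth_const: "open U \<Longrightarrow> msmooth M U (\<lambda>x. k)"
  unfolding msmooth_def by (auto intro: smooth_on_const chart_image_open)

lemma msmooth_sum:
  "open U \<Longrightarrow> (\<And>i. i \<in> I \<Longrightarrow> msmooth M U (F i)) \<Longrightarrow> msmooth M U (\<lambda>x. \<Sum>i\<in>I. F i x)"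
  unfolding msmooth_def by (auto intro!: smooth_on_sum chart_image_open)

lemma msmooth_vec_lambda:
  fixes F :: "'i::finite \<Rightarrow> 'a \<Rightarrow> 'v::euclidean_space"
  shows "open U \<Longrightarrow> (\<And>i. msmooth M U (F i)) \<Longrightarrow> msmooth M U (\<lambda>x. \<chi> i. F i x)"
  unfolding msmooth_def by (auto intro!: smooth_on_vec_lambda chart_image_open)

lemma msmooth_componentwise:
  fixes F :: "'a \<Rightarrow> 'v::euclidean_space"
  assumes "open U" "\<And>b. b \<in> Basis \<Longrightarrow> msmooth M U (\<lambda>x. F x \<bullet> b)"
  shows "msmooth M U F"
  unfolding msmooth_def
proof (intro conjI ballI)
  fix c assume c: "c \<in> M"
  show "smooth_on (snd c ` (fst c \<inter> U)) (\<lambda>p. F (chart_inv c p))"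
    by (rule smooth_on_componentwise[OF chart_image_open[OF c assms(1)] msmoothD[OF assms(2) c]])
qed (rule assms)

lemma msmooth_det:
  fixes F :: "'a \<Rightarrow> real^'i^'i"
  shows "msmooth M U F \<Longrightarrow> msmooth M U (\<lambda>x. det (F x))"
  unfolding msmooth_def by (auto intro: smooth_on_det)

lemma msmooth_solve:
  fixes G :: "'a \<Rightarrow> real^'i^'i"
  assumes "msmooth M U G" "msmooth M U b"
    and "\<And>x. x \<in> U \<Longrightarrow> det (G x) \<noteq> 0" "\<And>x. x \<in> U \<Longrightarrow> G x *v u x = b x"
  shows "msmooth M U u"
  unfolding msmooth_def
proof (intro conjI ballI)
  fix c assume c: "c \<in> M"
  show "smooth_on (snd c ` (fst c \<inter> U)) (\<lambda>p. u (chart_inv c p))"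
    by (rule smooth_on_solve[OF msmoothD[OF assms(1) c] msmoothD[OF assms(2) c]])
      (use assms(3,4) c in auto)
qed (use assms msmooth_open in blast)

lemma msmooth_chart: "c \<in> M \<Longrightarrow> msmooth M (fst c) (snd c)"
proof (rule msmooth_chartI[of c])
  assume c: "c \<in> M"
  have "smooth_on (snd c ` fst c) (\<lambda>p. p)"
    using smooth_on_ident chart_image_open[OF c, of UNIV] by auto
  then show "smooth_on (snd c ` fst c) (\<lambda>p. snd c (chart_inv c p))"
    by (rule iffD1[OF smooth_on_cong, rotated]) (use c in auto)
qed (auto simp: chart_open)

lemma msmooth_continuous:
  assumes "msmooth M U F"
  shows "continuous_on U F"
proof -
  have "continuous (at x) F" if x: "x \<in> U" for x
  proof -
    obtain c where c: "c \<in> M" "x \<in> fst c" using chart_around by blast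
    have "continuous_on (fst c \<inter> U) (\<lambda>x. F (chart_inv c (snd c x)))"
      by (rule continuous_on_compose2[OF smooth_on_continuous[OF msmoothD[OF assms c(1)]]
          continuous_on_subset[OF chart_cont[OF c(1)]]]) auto
    then have "continuous_on (fst c \<inter> U) F"
      by (rule continuous_on_eq) (use c in auto)
    moreover have "open (fst c \<inter> U)" using chart_open[OF c(1)] msmooth_open[OF assms] by auto
    ultimately show ?thesis using x c by (simp add: continuous_on_eq_continuous_at)
  qed
  then show ?thesis by (simp add: continuous_at_imp_continuous_on)
qed

text \<open>The inverses of a chart and of its restriction agree on the image of the smaller set, by
  injectivity. This is the bridge from the definitions, phrased with \<open>restrict_charts\<close>,
  to \<open>msmooth\<close>.\<close>

lemma smooth_map_restrict_iff:
  assumes "open U"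
  shows "smooth_map (restrict_charts U M) euclidean_charts F \<longleftrightarrow> msmooth M U F"
proof -
  have "smooth_on (snd c ` (fst c \<inter> U)) (F \<circ> inv_into (fst c \<inter> U) (snd c)) \<longleftrightarrow>
      smooth_on (snd c ` (fst c \<inter> U)) (\<lambda>p. F (chart_inv c p))" if c: "c \<in> M" for c
  proof (rule smooth_on_cong)
    fix p assume "p \<in> snd c ` (fst c \<inter> U)"
    then obtain x where x: "x \<in> fst c" "x \<in> U" "p = snd c x" by blast
    have "inj_on (snd c) (fst c \<inter> U)" using chart_inj[OF c] inj_on_subset by blast
    then show "(F \<circ> inv_into (fst c \<inter> U) (snd c)) p = F (chart_inv c p)"
      using x c by simp
  qed
  moreover have "smooth_map (restrict_charts U M) euclidean_charts F \<longleftrightarrow>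
      (\<forall>c\<in>M. smooth_on (snd c ` (fst c \<inter> U)) (F \<circ> inv_into (fst c \<inter> U) (snd c)))"
    unfolding smooth_map_def restrict_charts_def euclidean_charts_def by (simp add: comp_def)
  ultimately show ?thesis using assms unfolding msmooth_def by blast
qed

lemma smooth_map_iff: "smooth_map M euclidean_charts F \<longleftrightarrow> msmooth M UNIV F"
proof -
  have "restrict_charts UNIV M = M" unfolding restrict_charts_def by simp
  then show ?thesis using smooth_map_restrict_iff[OF open_UNIV, of F] by simp
qed

subsection \<open>Differentials\<close>

lemma tangent_space_iff:
  "t \<in> tangent_space M x \<longleftrightarrow> fst t = x \<and>
     (\<forall>c\<in>M. \<forall>d\<in>M. x \<in> fst c \<and> x \<in> fst d \<longrightarrow>
       snd t d = frechet_derivative (\<lambda>p. snd d (chart_inv c p)) (at (snd c x)) (snd t c)) \<and>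
     (\<forall>c. \<not> (c \<in> M \<and> x \<in> fst c) \<longrightarrow> snd t c = 0)"
proof -
  have *: "t \<in> {(x, v) | v. P v} \<longleftrightarrow> fst t = x \<and> P (snd t)" for P :: "(('a, real^'n) chart \<Rightarrow> real^'n) \<Rightarrow> bool"
    by (cases t) auto
  show ?thesis unfolding tangent_space_def * comp_def ..
qed

lemma tangent_fst: "t \<in> tangent_space M x \<Longrightarrow> fst t = x"
  unfolding tangent_space_iff by blast

lemma tangent_zero: "(x, \<lambda>_. 0) \<in> tangent_space M x"
proof -
  have "frechet_derivative (\<lambda>p. snd d (chart_inv c p)) (at (snd c x)) 0 = 0"
    if "c \<in> M" "d \<in> M" "x \<in> fst c" "x \<in> fst d" for c d
  proof -
    have "(\<lambda>p. snd d (chart_inv c p)) differentiable (at (snd c x))"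
      using smooth_on_has_derivative[OF chart_transition[OF that(1,2)], of "snd c x"] that
      unfolding differentiable_def by blast
    then show ?thesis by (rule linear_0[OF linear_frechet_derivative])
  qed
  then show ?thesis by (simp add: tangent_space_iff)
qed

lemma tangent_transform:
  assumes "t \<in> tangent_space M x" "c \<in> M" "d \<in> M" "x \<in> fst c" "x \<in> fst d"
  shows "snd t d = frechet_derivative (\<lambda>p. snd d (chart_inv c p)) (at (snd c x)) (snd t c)"
  using assms unfolding tangent_space_iff by blast

text \<open>A tangent vector is determined by one coordinate vector: the transformation law fixes
  its values in the other charts around \<open>x\<close>, and elsewhere it has the default value
  0.\<close>

lemma tangent_eqI:
  assumes "t \<in> tangent_space M x" "t' \<in> tangent_space M x" "c \<in> M" "x \<in> fst c" "snd t c = snd t' c"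
  shows "t = t'"
proof (rule prod_eqI)
  show "fst t = fst t'" using tangent_fst assms by metis
  show "snd t = snd t'"
  proof
    fix d
    show "snd t d = snd t' d"
    proof (cases "d \<in> M \<and> x \<in> fst d")
      case True
      then show ?thesis
        using tangent_transform[OF assms(1,3) _ assms(4)] tangent_transform[OF assms(2,3) _ assms(4)] assms(5)
        by simp
    next
      case False
      then have "snd t d = 0" "snd t' d = 0" using assms(1,2) unfolding tangent_space_iff by blast+
      then show ?thesis by simp
    qed
  qed
qed

lemma msmooth_has_derivative:
  assumes "msmooth M U F" "x \<in> U" "c \<in> M" "x \<in> fst c"
  shows "((\<lambda>p. F (chart_inv c p)) has_derivative
    frechet_derivative (\<lambda>p. F (chart_inv c p)) (at (snd c x))) (at (snd c x))"
  using smooth_on_has_derivative[OF msmoothD[OF assms(1,3)]] assms(2,4) by blast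

text \<open>The definition of \<open>mdiff\<close> uses an arbitrary chosen chart. The chain rule
  for the transition map cancels against the transformation law of \<open>t\<close>, so any chart
  may be used for computation.\<close>

lemma mdiff_chart:
  assumes t: "t \<in> tangent_space M x" and c: "c \<in> M" "x \<in> fst c" and F: "msmooth M U F" "x \<in> U"
  shows "mdiff M F t = frechet_derivative (\<lambda>p. F (chart_inv c p)) (at (snd c x)) (snd t c)"
proof -
  define e where "e = (SOME c. c \<in> M \<and> x \<in> fst c)"
  have "e \<in> M \<and> x \<in> fst e"
    unfolding e_def by (rule someI_ex) (use chart_around in blast)
  then have e: "e \<in> M" "x \<in> fst e" by auto
  let ?\<phi> = "\<lambda>p. snd c (chart_inv e p)"
  have "(?\<phi> has_derivative frechet_derivative ?\<phi> (at (snd e x))) (at (snd e x))"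
    using smooth_on_has_derivative[OF chart_transition[OF e(1) c(1)]] e c by blast
  moreover have "((\<lambda>p. F (chart_inv c p)) has_derivative
      frechet_derivative (\<lambda>p. F (chart_inv c p)) (at (snd c x))) (at (?\<phi> (snd e x)))"
    using msmooth_has_derivative[OF F c] e by simp
  ultimately have "((\<lambda>p. F (chart_inv c (?\<phi> p))) has_derivative (\<lambda>v.
      frechet_derivative (\<lambda>p. F (chart_inv c p)) (at (snd c x)) (frechet_derivative ?\<phi> (at (snd e x)) v)))
      (at (snd e x))"
    using diff_chain_at[unfolded o_def] by blast
  then have "((\<lambda>p. F (chart_inv e p)) has_derivative (\<lambda>v.
      frechet_derivative (\<lambda>p. F (chart_inv c p)) (at (snd c x)) (frechet_derivative ?\<phi> (at (snd e x)) v)))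
      (at (snd e x))"
    by (rule has_derivative_transform_within_open[of _ _ _ _ "snd e ` (fst e \<inter> fst c)"])
      (use e c chart_image_open[OF e(1) chart_open[OF c(1)]] in auto)
  from frechet_derivative_at[OF this, symmetric]
  have "frechet_derivative (\<lambda>p. F (chart_inv e p)) (at (snd e x)) (snd t e) =
     frechet_derivative (\<lambda>p. F (chart_inv c p)) (at (snd c x)) (frechet_derivative ?\<phi> (at (snd e x)) (snd t e))"
    by simp
  also have "frechet_derivative ?\<phi> (at (snd e x)) (snd t e) = snd t c"
    using tangent_transform[OF t e(1) c(1) e(2) c(2)] by simp
  finally show ?thesis
    unfolding mdiff_def Let_def tangent_fst[OF t] e_def[symmetric] comp_def .
qed

lemma mdiff_eqI:
  assumes t: "t \<in> tangent_space M x" and c: "c \<in> M" "x \<in> fst c" and F: "msmooth M U F" "x \<in> U"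
    and "((\<lambda>p. F (chart_inv c p)) has_derivative D) (at (snd c x))"
  shows "mdiff M F t = D (snd t c)"
  using mdiff_chart[OF t c F] frechet_derivative_at[OF assms(6)] by simp

lemma mdiff_bounded_linear:
  assumes t: "t \<in> tangent_space M x" and L: "bounded_linear L" and F: "msmooth M U F" "x \<in> U"
  shows "mdiff M (\<lambda>x. L (F x)) t = L (mdiff M F t)"
proof -
  obtain c where c: "c \<in> M" "x \<in> fst c" using chart_around by blast
  show ?thesis
    using mdiff_eqI[OF t c msmooth_bounded_linear[OF L F(1)] F(2)
        bounded_linear.has_derivative[OF L msmooth_has_derivative[OF F c]]]
    by (simp add: mdiff_chart[OF t c F])
qed

lemma mdiff_bounded_bilinear:
  assumes t: "t \<in> tangent_space M x" and B: "bounded_bilinear B"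
    and F: "msmooth M U F" "x \<in> U" and G: "msmooth M U G"
  shows "mdiff M (\<lambda>x. B (F x) (G x)) t = B (F x) (mdiff M G t) + B (mdiff M F t) (G x)"
proof -
  obtain c where c: "c \<in> M" "x \<in> fst c" using chart_around by blast
  show ?thesis
    using mdiff_eqI[OF t c msmooth_bounded_bilinear[OF B F(1) G] F(2)
        bounded_bilinear.FDERIV[OF B msmooth_has_derivative[OF F c] msmooth_has_derivative[OF G F(2) c]]]
    by (simp add: mdiff_chart[OF t c F] mdiff_chart[OF t c G F(2)] c)
qed

lemma mdiff_add:
  assumes t: "t \<in> tangent_space M x" and F: "msmooth M U F" "x \<in> U" and G: "msmooth M U G"
  shows "mdiff M (\<lambda>x. F x + G x) t = mdiff M F t + mdiff M G t"
proof -
  obtain c where c: "c \<in> M" "x \<in> fst c" using chart_around by blast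
  show ?thesis
    using mdiff_eqI[OF t c msmooth_add[OF F(1) G] F(2)
        has_derivative_add[OF msmooth_has_derivative[OF F c] msmooth_has_derivative[OF G F(2) c]]]
    by (simp add: mdiff_chart[OF t c F] mdiff_chart[OF t c G F(2)])
qed

lemma mdiff_cong:
  assumes t: "t \<in> tangent_space M x" and F: "msmooth M U F" "x \<in> U"
    and eq: "\<And>y. y \<in> U \<Longrightarrow> G y = F y"
  shows "mdiff M G t = mdiff M F t"
proof -
  obtain c where c: "c \<in> M" "x \<in> fst c" using chart_around by blast
  have G: "msmooth M U G" using msmooth_cong[of U G F] F eq by blast
  have "((\<lambda>p. G (chart_inv c p)) has_derivative
    frechet_derivative (\<lambda>p. F (chart_inv c p)) (at (snd c x))) (at (snd c x))"
    by (rule has_derivative_transform_within_open[OF msmooth_has_derivative[OF F c],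
          of "snd c ` (fst c \<inter> U)"])
      (use c F eq chart_image_open[OF c(1) msmooth_open[OF F(1)]] in auto)
  from mdiff_eqI[OF t c G F(2) this] show ?thesis by (simp add: mdiff_chart[OF t c F])
qed

lemma mdiff_const:
  assumes t: "t \<in> tangent_space M x"
  shows "mdiff M (\<lambda>x. k) t = 0"
proof -
  obtain c where c: "c \<in> M" "x \<in> fst c" using chart_around by blast
  show ?thesis
    using mdiff_eqI[OF t c msmooth_const[OF open_UNIV, of k] UNIV_I has_derivative_const] by simp
qed

lemma mdiff_zero:
  assumes F: "msmooth M U F" "x \<in> U"
  shows "mdiff M F (x, \<lambda>_. 0) = 0"
proof -
  obtain c where c: "c \<in> M" "x \<in> fst c" using chart_around by blast
  show ?thesis
    using mdiff_chart[OF tangent_zero c F] has_derivative_linear[OF msmooth_has_derivative[OF F c]]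
    by (simp add: linear_0)
qed

lemma msmooth_mdiff:
  assumes t: "\<And>x. x \<in> U \<Longrightarrow> t x \<in> tangent_space M x"
    and ts: "\<And>c. c \<in> M \<Longrightarrow> msmooth M (U \<inter> fst c) (\<lambda>x. snd (t x) c)"
    and F: "msmooth M U F"
  shows "msmooth M U (\<lambda>x. mdiff M F (t x))"
proof (rule msmooth_local)
  fix x assume x: "x \<in> U"
  obtain c where c: "c \<in> M" "x \<in> fst c" using chart_around by blast
  let ?V = "U \<inter> fst c" and ?F = "\<lambda>p. F (chart_inv c p)"
  have V: "open ?V" using msmooth_open[OF F] chart_open[OF c(1)] by auto
  have sF: "smooth_on (snd c ` ?V) ?F"
    using msmoothD[OF F c(1)] by (simp add: Int_commute)
  have sc: "smooth_on (snd c ` ?V) (\<lambda>p. snd (t (chart_inv c p)) c)"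
    using msmoothD[OF ts[OF c(1)] c(1)] by (simp add: Int_ac)
  have "msmooth M ?V (\<lambda>x. mdiff M F (t x))"
  proof (rule msmooth_chartI[OF c(1) V])
    \<comment> \<open>Smoothness is known for derivatives in fixed directions, so the moving vector
      \<open>t\<close> is expanded in the standard basis.\<close>
    have "smooth_on (snd c ` ?V) (\<lambda>p. \<Sum>b\<in>Basis. (snd (t (chart_inv c p)) c \<bullet> b) *\<^sub>R
        frechet_derivative ?F (at p) b)"
      by (intro smooth_on_sum smooth_on_open[OF sF]
          smooth_on_bounded_bilinear[OF bounded_bilinear_scaleR]
          smooth_on_bounded_linear[OF bounded_linear_inner_left] smooth_on_frechet_derivative sF sc)
    moreover have "(\<Sum>b\<in>Basis. (snd (t (chart_inv c p)) c \<bullet> b) *\<^sub>R frechet_derivative ?F (at p) b)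
        = mdiff M F (t (chart_inv c p))" if "p \<in> snd c ` ?V" for p
    proof -
      from that obtain y where y: "y \<in> U" "y \<in> fst c" "p = snd c y" by auto
      have l: "linear (frechet_derivative ?F (at p))"
        using has_derivative_linear[OF msmooth_has_derivative[OF F y(1) c(1) y(2)]] y by simp
      have "mdiff M F (t y) = frechet_derivative ?F (at p) (snd (t y) c)"
        using mdiff_chart[OF t[OF y(1)] c(1) y(2) F y(1)] y by simp
      also have "\<dots> = frechet_derivative ?F (at p) (\<Sum>b\<in>Basis. (snd (t y) c \<bullet> b) *\<^sub>R b)"
        by (simp add: euclidean_representation)
      also have "\<dots> = (\<Sum>b\<in>Basis. (snd (t y) c \<bullet> b) *\<^sub>R frechet_derivative ?F (at p) b)"
        by (simp add: linear_sum[OF l] linear_cmul[OF l])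
      finally show ?thesis using y c by simp
    qed
    ultimately show "smooth_on (snd c ` ?V) (\<lambda>p. mdiff M F (t (chart_inv c p)))"
      by (rule iffD1[OF smooth_on_cong, rotated])
  qed auto
  then show "\<exists>V. x \<in> V \<and> V \<subseteq> U \<and> msmooth M V (\<lambda>x. mdiff M F (t x))"
    using x c by (intro exI[of _ ?V]) auto
qed

subsection \<open>Cutting off\<close>

text \<open>The closed set \<open>K\<close> inside \<open>U\<close> stands for the support:
  \<open>U\<close> and the complement of \<open>K\<close> form an open cover, so a product with
  \<open>\<beta>\<close> defined on \<open>U\<close> extends smoothly by zero.\<close>

definition bump_at :: "'a set \<Rightarrow> 'a \<Rightarrow> ('a \<Rightarrow> real) \<Rightarrow> bool" where
  "bump_at U x \<beta> \<longleftrightarrow> msmooth M UNIV \<beta> \<and> \<beta> x = 1 \<and>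
     (\<exists>K. closed K \<and> K \<subseteq> U \<and> (\<forall>y. y \<notin> K \<longrightarrow> \<beta> y = 0))"

lemma ex_bump:
  assumes "open U" "x \<in> U"
  shows "\<exists>\<beta>. bump_at U x \<beta>"
proof -
  obtain c where c: "c \<in> M" "x \<in> fst c" using chart_around by blast
  let ?V = "fst c \<inter> U"
  have V: "open ?V" using assms chart_open[OF c(1)] by auto
  have "snd c x \<in> snd c ` ?V" using c assms(2) by auto
  then obtain r where r: "r > 0" "cball (snd c x) r \<subseteq> snd c ` ?V"
    using chart_image_open[OF c(1) assms(1), unfolded open_contains_cball] by blast
  obtain b :: "real^'n \<Rightarrow> real"
    where b: "smooth_on UNIV b" "b (snd c x) = 1" "\<And>p. p \<notin> ball (snd c x) r \<Longrightarrow> b p = 0"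
    using euclidean_bump[OF r(1), of "snd c x"] by blast
  define K where "K = chart_inv c ` cball (snd c x) r"
  define \<beta> where "\<beta> y = (if y \<in> ?V then b (snd c y) else 0)" for y
  have "snd c ` ?V \<subseteq> snd c ` fst c" by auto
  then have "continuous_on (cball (snd c x) r) (chart_inv c)"
    using continuous_on_subset[OF chart_inv_cont[OF c(1)]] r(2) by blast
  \<comment> \<open>\<open>K\<close> is the image of a compact ball, and compact sets are closed in
    the Hausdorff space \<open>'a\<close>; closedness in the chart domain alone would not
    do.\<close>
  then have K: "closed K"
    unfolding K_def by (intro compact_imp_closed compact_continuous_image) auto
  have KV: "K \<subseteq> ?V"
  proof
    fix y assume "y \<in> K"
    then obtain p where "p \<in> cball (snd c x) r" "y = chart_inv c p" unfolding K_def by blast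
    then obtain z where "z \<in> ?V" "p = snd c z" using r(2) by blast
    then show "y \<in> ?V" using \<open>y = chart_inv c p\<close> c by simp
  qed
  have \<beta>0: "\<beta> y = 0" if "y \<notin> K" for y
  proof (cases "y \<in> ?V")
    case True
    have "snd c y \<notin> ball (snd c x) r"
    proof
      assume "snd c y \<in> ball (snd c x) r"
      then have "chart_inv c (snd c y) \<in> K" unfolding K_def by (intro imageI) auto
      then show False using that True c by simp
    qed
    then show ?thesis using b(3) by (simp add: \<beta>_def)
  qed (auto simp: \<beta>_def)
  have "msmooth M UNIV \<beta>"
  proof (rule msmooth_local)
    fix y
    show "\<exists>V. y \<in> V \<and> V \<subseteq> UNIV \<and> msmooth M V \<beta>"
    proof (cases "y \<in> ?V")
      case True
      have "msmooth M ?V (\<lambda>y. b (snd c y))"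
        by (rule msmooth_compose[OF msmooth_subset[OF msmooth_chart[OF c(1)]] b(1)])
          (use V chart_inj in auto)
      then have "msmooth M ?V \<beta>"
        by (rule iffD1[OF msmooth_cong, rotated]) (simp add: \<beta>_def)
      then show ?thesis using True by (intro exI[of _ ?V]) auto
    next
      case False
      have "msmooth M (-K) (\<lambda>y. 0::real)" using K by (intro msmooth_const) auto
      then have "msmooth M (-K) \<beta>"
        by (rule iffD1[OF msmooth_cong, rotated]) (use \<beta>0 in auto)
      then show ?thesis using False KV by (intro exI[of _ "-K"]) auto
    qed
  qed
  moreover have "\<beta> x = 1" using c assms b by (simp add: \<beta>_def)
  ultimately show ?thesis unfolding bump_at_def using K KV \<beta>0 by blast
qed

lemma msmooth_cutoff:
  assumes b: "bump_at U x \<beta>" and F: "msmooth M U F"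
  shows "msmooth M UNIV (\<lambda>y. if y \<in> U then \<beta> y *\<^sub>R F y else 0)"
proof (rule msmooth_local)
  fix y
  obtain K where K: "closed K" "K \<subseteq> U" "\<And>y. y \<notin> K \<Longrightarrow> \<beta> y = 0"
    using b unfolding bump_at_def by blast
  let ?G = "\<lambda>y. if y \<in> U then \<beta> y *\<^sub>R F y else 0"
  show "\<exists>V. y \<in> V \<and> V \<subseteq> UNIV \<and> msmooth M V ?G"
  proof (cases "y \<in> U")
    case True
    have "msmooth M U \<beta>"
      using b msmooth_subset[of UNIV \<beta> U] msmooth_open[OF F] unfolding bump_at_def by blast
    then have "msmooth M U (\<lambda>y. \<beta> y *\<^sub>R F y)" using F by (rule msmooth_scaleR)
    then have "msmooth M U ?G"
      by (rule iffD1[OF msmooth_cong, rotated]) simp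
    then show ?thesis using True by (intro exI[of _ U]) auto
  next
    case False
    have "msmooth M (-K) (\<lambda>y. 0)" using K by (intro msmooth_const) auto
    moreover have "?G y = 0" if "y \<in> -K" for y using K(3)[of y] that by auto
    ultimately have "msmooth M (-K) ?G" by (subst msmooth_cong[of "-K" ?G "\<lambda>y. 0"]) auto
    then show ?thesis using False K(2) by (intro exI[of _ "-K"]) auto
  qed
qed

end

section \<open>Vector bundles\<close>

text \<open>For fixed \<open>v\<close> this is the local section with constant coordinate vector
  \<open>v\<close>. Smoothness of fibrewise linear maps is always tested on these sections.\<close>

definition frame :: "('a, 'b, 'k::finite, 'z) vbundle_scheme \<Rightarrow> 'a set \<times> ('b \<Rightarrow> real^'k) \<Rightarrow> 'a \<Rightarrow> real^'k \<Rightarrow> 'b"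
  where "frame E t x v = inv_into (fibre E x) (snd t) v"

lemma frame_in_fibre:
  assumes "fibrewise_triv E t" "x \<in> fst t"
  shows "frame E t x v \<in> fibre E x"
proof -
  have "bij_betw (snd t) (fibre E x) UNIV" using assms unfolding fibrewise_triv_def by blast
  then show ?thesis unfolding frame_def by (intro inv_into_into) (simp add: bij_betw_def)
qed

lemma triv_frame [simp]:
  assumes "fibrewise_triv E t" "x \<in> fst t"
  shows "snd t (frame E t x v) = v"
proof -
  have "bij_betw (snd t) (fibre E x) UNIV" using assms unfolding fibrewise_triv_def by blast
  then show ?thesis unfolding frame_def by (intro f_inv_into_f) (simp add: bij_betw_def)
qed

lemma frame_triv:
  assumes "fibrewise_triv E t" "x \<in> fst t" "e \<in> fibre E x"
  shows "frame E t x (snd t e) = e"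
proof -
  have "bij_betw (snd t) (fibre E x) UNIV" using assms unfolding fibrewise_triv_def by blast
  then show ?thesis unfolding frame_def using assms(3) by (simp add: bij_betw_def)
qed

lemma triv_add:
  "fibrewise_triv E t \<Longrightarrow> x \<in> fst t \<Longrightarrow> e \<in> fibre E x \<Longrightarrow> e' \<in> fibre E x \<Longrightarrow>
    snd t (fadd E e e') = snd t e + snd t e'"
  unfolding fibrewise_triv_def by blast

lemma triv_scale:
  "fibrewise_triv E t \<Longrightarrow> x \<in> fst t \<Longrightarrow> e \<in> fibre E x \<Longrightarrow> snd t (fscale E r e) = r *\<^sub>R snd t e"
  unfolding fibrewise_triv_def by blast

lemma triv_eqI:
  assumes "fibrewise_triv E t" "x \<in> fst t" "e \<in> fibre E x" "e' \<in> fibre E x" "snd t e = snd t e'"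
  shows "e = e'"
proof -
  have "frame E t x (snd t e) = frame E t x (snd t e')" using assms(5) by (rule arg_cong)
  then show ?thesis by (simp only: frame_triv[OF assms(1-3)] frame_triv[OF assms(1,2,4)])
qed

lemma fibreD: "e \<in> fibre E x \<Longrightarrow> e \<in> tot_space E" "e \<in> fibre E x \<Longrightarrow> proj E e = x"
  by (auto simp: fibre_def)

lemma (in manifold) bundle_charts_inj:
  assumes "\<And>t. t \<in> trivs E \<Longrightarrow> fibrewise_triv E t" "b \<in> bundle_charts M E"
  shows "inj_on (snd b) (fst b)"
proof -
  obtain c t where ct: "c \<in> M" "t \<in> trivs E"
      "b = ({e \<in> tot_space E. proj E e \<in> fst c \<inter> fst t}, \<lambda>e. (snd c (proj E e), snd t e))"
    using assms(2) unfolding bundle_charts_def by blast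
  show ?thesis
  proof (rule inj_onI)
    fix e e' assume e: "e \<in> fst b" "e' \<in> fst b" "snd b e = snd b e'"
    then have "proj E e = proj E e'"
      using ct inj_onD[OF chart_inj[OF ct(1)], of "proj E e" "proj E e'"] by simp
    then show "e = e'"
      using e ct by (intro triv_eqI[OF assms(1)[OF ct(2)], of "proj E e"]) (auto simp: fibre_def)
  qed
qed

lemma (in manifold) restrict_charts_inj:
  assumes "d \<in> restrict_charts U M"
  shows "inj_on (snd d) (fst d)"
proof -
  obtain c where "c \<in> M" "d = (fst c \<inter> U, snd c)" using assms unfolding restrict_charts_def by auto
  then show ?thesis using inj_on_subset[OF chart_inj[of c], of "fst c \<inter> U"] by simp
qed

lemma restrict_charts_UNIV: "restrict_charts UNIV M = M"
  unfolding restrict_charts_def by simp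

text \<open>Only the trivialisation at hand is assumed open, so the lemma also applies to the
  tangent bundle, for which \<open>vector_bundle\<close> is not established here.\<close>

lemma (in manifold) smooth_map_bundleD:
  assumes X: "smooth_map (restrict_charts U M) (bundle_charts M E) X" and U: "open U"
    and Xf: "\<And>x. x \<in> U \<Longrightarrow> X x \<in> fibre E x" and t: "t \<in> trivs E" "open (fst t)"
  shows "msmooth M (U \<inter> fst t) (\<lambda>x. snd t (X x))"
proof (rule msmooth_local)
  fix x assume x: "x \<in> U \<inter> fst t"
  obtain c where c: "c \<in> M" "x \<in> fst c" using chart_around by blast
  let ?V = "fst c \<inter> (U \<inter> fst t)"
  let ?b = "({e \<in> tot_space E. proj E e \<in> fst c \<inter> fst t}, \<lambda>e. (snd c (proj E e), snd t e))"
  have b: "?b \<in> bundle_charts M E" unfolding bundle_charts_def using c t by blast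
  have pX: "X x \<in> tot_space E" "proj E (X x) = x" if "x \<in> U" for x
    using fibreD[OF Xf[OF that]] by simp_all
  have "(fst c \<inter> U, snd c) \<in> restrict_charts U M" unfolding restrict_charts_def using c by auto
  with X b have "smooth_on (snd c ` ((fst c \<inter> U) \<inter> X -` fst ?b)) (snd ?b \<circ> X \<circ> inv_into (fst c \<inter> U) (snd c))"
    unfolding smooth_map_def by fastforce
  moreover have "(fst c \<inter> U) \<inter> X -` fst ?b = ?V" using pX by auto
  ultimately have "smooth_on (snd c ` ?V) (snd ?b \<circ> X \<circ> inv_into (fst c \<inter> U) (snd c))"
    by simp
  then have "smooth_on (snd c ` ?V) (\<lambda>p. snd ((snd ?b \<circ> X \<circ> inv_into (fst c \<inter> U) (snd c)) p))"
    by (rule smooth_on_bounded_linear[OF bounded_linear_snd])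
  then have "smooth_on (snd c ` ?V) (\<lambda>p. snd t (X (chart_inv c p)))"
  proof (rule iffD1[OF smooth_on_cong, rotated])
    fix p assume "p \<in> snd c ` ?V"
    then obtain y where y: "y \<in> fst c" "y \<in> U" "p = snd c y" by blast
    have "inj_on (snd c) (fst c \<inter> U)" using chart_inj[OF c(1)] inj_on_subset by blast
    then show "snd ((snd ?b \<circ> X \<circ> inv_into (fst c \<inter> U) (snd c)) p) = snd t (X (chart_inv c p))"
      using y c(1) by simp
  qed
  then have "msmooth M ?V (\<lambda>x. snd t (X x))"
    using U t(2) chart_open[OF c(1)] by (intro msmooth_chartI[OF c(1)]) auto
  then show "\<exists>V. x \<in> V \<and> V \<subseteq> U \<inter> fst t \<and> msmooth M V (\<lambda>x. snd t (X x))"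
    using x c by (intro exI[of _ ?V]) auto
qed

section \<open>Global sections of a vector bundle\<close>

locale vector_bundle_over = manifold M
  for M :: "('a::{t2_space,second_countable_topology}, real^'n) chart set" +
  fixes E :: "('a, 'b, 'k::finite, 'z) vbundle_scheme"
  assumes vector_bundle: "vector_bundle M E"
begin

lemma fadd_fibre: "e \<in> fibre E x \<Longrightarrow> e' \<in> fibre E x \<Longrightarrow> fadd E e e' \<in> fibre E x"
  using vector_bundle unfolding vector_bundle_def by blast

lemma fscale_fibre: "e \<in> fibre E x \<Longrightarrow> fscale E r e \<in> fibre E x"
  using vector_bundle unfolding vector_bundle_def by blast

lemma triv_around: "\<exists>t\<in>trivs E. x \<in> fst t"
  using vector_bundle unfolding vector_bundle_def by blast

lemma triv_open: "t \<in> trivs E \<Longrightarrow> open (fst t)"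
  using vector_bundle unfolding vector_bundle_def by blast

lemma triv_fibrewise: "t \<in> trivs E \<Longrightarrow> fibrewise_triv E t"
  using vector_bundle unfolding vector_bundle_def by blast

lemma triv_transition:
  assumes "t \<in> trivs E" "s \<in> trivs E"
  shows "msmooth M (fst t \<inter> fst s) (\<lambda>x. snd s (frame E t x v))"
proof -
  have "smooth_map (restrict_charts (fst t \<inter> fst s) M) euclidean_charts
      (\<lambda>x. snd s (inv_into (fibre E x) (snd t) v))"
    using vector_bundle assms unfolding vector_bundle_def by blast
  then show ?thesis
    unfolding frame_def
    by (rule iffD1[OF smooth_map_restrict_iff[OF open_Int[OF triv_open[OF assms(1)] triv_open[OF assms(2)]]]])
qed

lemma frame_add:
  assumes "t \<in> trivs E" "x \<in> fst t"
  shows "frame E t x (v + w) = fadd E (frame E t x v) (frame E t x w)"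
  by (rule triv_eqI[OF triv_fibrewise[OF assms(1)] assms(2)])
    (simp_all add: frame_in_fibre fadd_fibre triv_fibrewise assms triv_add[of _ _ x])

lemma frame_scale:
  assumes "t \<in> trivs E" "x \<in> fst t"
  shows "frame E t x (r *\<^sub>R v) = fscale E r (frame E t x v)"
  by (rule triv_eqI[OF triv_fibrewise[OF assms(1)] assms(2)])
    (simp_all add: frame_in_fibre fscale_fibre triv_fibrewise assms triv_scale[of _ _ x])

lemma linear_triv_frame:
  assumes "t \<in> trivs E" "x \<in> fst t"
    and add: "\<And>e e'. e \<in> fibre E x \<Longrightarrow> e' \<in> fibre E x \<Longrightarrow> L (fadd E e e') = L e + L e'"
    and scale: "\<And>e r. e \<in> fibre E x \<Longrightarrow> L (fscale E r e) = r *\<^sub>R L e"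
  shows "linear (\<lambda>v. L (frame E t x v))"
  by (rule linearI)
    (simp_all add: frame_add frame_scale assms(1,2) add scale frame_in_fibre triv_fibrewise)

lemma linear_transition:
  assumes "t \<in> trivs E" "x \<in> fst t" "s \<in> trivs E" "x \<in> fst s"
  shows "linear (\<lambda>v. snd s (frame E t x v))"
  by (rule linear_triv_frame[OF assms(1,2)])
    (simp_all add: triv_add[of _ _ x] triv_scale[of _ _ x] triv_fibrewise assms)

lemma msmooth_frame_apply:
  fixes L :: "'b \<Rightarrow> 'v::real_normed_vector"
  assumes t: "t \<in> trivs E" "U \<subseteq> fst t"
    and lin: "\<And>x. x \<in> U \<Longrightarrow> linear (\<lambda>v. L (frame E t x v))"
    and sm: "\<And>v. msmooth M U (\<lambda>x. L (frame E t x v))" and W: "msmooth M U W"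
  shows "msmooth M U (\<lambda>x. L (frame E t x (W x)))"
proof -
  have "msmooth M U (\<lambda>x. \<Sum>b\<in>Basis. (W x \<bullet> b) *\<^sub>R L (frame E t x b))"
    by (intro msmooth_sum msmooth_open[OF W] msmooth_scaleR sm
        msmooth_bounded_linear[OF bounded_linear_inner_left W])
  then show ?thesis
  proof (rule iffD1[OF msmooth_cong, rotated])
    fix x assume x: "x \<in> U"
    have "L (frame E t x (W x)) = L (frame E t x (\<Sum>b\<in>Basis. (W x \<bullet> b) *\<^sub>R b))"
      by (simp add: euclidean_representation)
    also have "\<dots> = (\<Sum>b\<in>Basis. (W x \<bullet> b) *\<^sub>R L (frame E t x b))"
      by (simp add: linear_sum[OF lin[OF x]] linear_cmul[OF lin[OF x]])
    finally show "(\<Sum>b\<in>Basis. (W x \<bullet> b) *\<^sub>R L (frame E t x b)) = L (frame E t x (W x))" by simp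
  qed
qed

lemma bundle_chart_dom:
  assumes "e \<in> fibre E x"
  shows "e \<in> (\<Union>b\<in>bundle_charts M E. fst b)"
proof -
  obtain c where c: "c \<in> M" "x \<in> fst c" using chart_around by blast
  obtain t where t: "t \<in> trivs E" "x \<in> fst t" using triv_around by blast
  have "({e \<in> tot_space E. proj E e \<in> fst c \<inter> fst t}, \<lambda>e. (snd c (proj E e), snd t e)) \<in> bundle_charts M E"
    unfolding bundle_charts_def using c(1) t(1) by blast
  then show ?thesis by (rule UN_I) (use assms c t in \<open>auto simp: fibre_def\<close>)
qed

text \<open>The base component of a section, seen in bundle charts, is a chart transition and hence
  smooth; only the fibre component carries a condition.\<close>

lemma smooth_map_bundle_iff:
  assumes U: "open U" and Xf: "\<And>x. x \<in> U \<Longrightarrow> X x \<in> fibre E x"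
  shows "smooth_map (restrict_charts U M) (bundle_charts M E) X \<longleftrightarrow>
    (\<forall>t\<in>trivs E. msmooth M (U \<inter> fst t) (\<lambda>x. snd t (X x)))" (is "?L \<longleftrightarrow> ?R")
proof
  assume ?L
  then show ?R using smooth_map_bundleD[OF _ U Xf] triv_open by simp
next
  assume R: ?R
  show ?L
    unfolding smooth_map_def
  proof (intro conjI ballI)
    show "X ` (\<Union>c\<in>restrict_charts U M. fst c) \<subseteq> (\<Union>d\<in>bundle_charts M E. fst d)"
    proof
      fix e assume "e \<in> X ` (\<Union>c\<in>restrict_charts U M. fst c)"
      then obtain x where "x \<in> U" "e = X x" unfolding restrict_charts_def by auto
      then show "e \<in> (\<Union>d\<in>bundle_charts M E. fst d)" using bundle_chart_dom[OF Xf] by simp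
    qed
    fix c' b assume "c' \<in> restrict_charts U M" "b \<in> bundle_charts M E"
    then obtain c d t where c: "c \<in> M" "c' = (fst c \<inter> U, snd c)"
      and d: "d \<in> M" and t: "t \<in> trivs E"
      and b: "b = ({e \<in> tot_space E. proj E e \<in> fst d \<inter> fst t}, \<lambda>e. (snd d (proj E e), snd t e))"
      unfolding restrict_charts_def bundle_charts_def by blast
    let ?V = "fst c \<inter> (U \<inter> fst d \<inter> fst t)"
    have V: "fst c' \<inter> X -` fst b = ?V" using fibreD[OF Xf] c b by auto
    have oV: "open (snd c ` ?V)"
      using chart_image_open[OF c(1), of "U \<inter> fst d \<inter> fst t"] U chart_open[OF d] triv_open[OF t]
      by (simp add: open_Int)
    have "smooth_on (snd c ` ?V) (\<lambda>p. snd d (chart_inv c p))"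
      by (rule smooth_on_subset[OF chart_transition[OF c(1) d] _ oV]) auto
    moreover have "smooth_on (snd c ` ?V) (\<lambda>p. snd t (X (chart_inv c p)))"
      by (rule smooth_on_subset[OF msmoothD[OF R[rule_format, OF t] c(1)] _ oV]) auto
    ultimately have "smooth_on (snd c ` ?V) (\<lambda>p. (snd d (chart_inv c p), snd t (X (chart_inv c p))))"
      by (rule smooth_on_Pair)
    then have "smooth_on (snd c ` ?V) (snd b \<circ> X \<circ> inv_into (fst c \<inter> U) (snd c))"
    proof (rule iffD1[OF smooth_on_cong, rotated])
      fix p assume "p \<in> snd c ` ?V"
      then obtain y where y: "y \<in> fst c" "y \<in> U" "p = snd c y" by blast
      have "inj_on (snd c) (fst c \<inter> U)" using chart_inj[OF c(1)] inj_on_subset by blast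
      then show "(snd d (chart_inv c p), snd t (X (chart_inv c p))) =
          (snd b \<circ> X \<circ> inv_into (fst c \<inter> U) (snd c)) p"
        using y c(1) b fibreD(2)[OF Xf[OF y(2)]] by simp
    qed
    then show "smooth_on (snd c' ` (fst c' \<inter> X -` fst b)) (snd b \<circ> X \<circ> chart_inv c')"
      unfolding V by (simp add: c(2))
  qed
qed

lemma section_iff:
  "X \<in> sections M E \<longleftrightarrow>
    (\<forall>x. X x \<in> fibre E x) \<and> (\<forall>t\<in>trivs E. msmooth M (fst t) (\<lambda>x. snd t (X x)))"
proof (cases "\<forall>x. X x \<in> fibre E x")
  case True
  then show ?thesis
    using smooth_map_bundle_iff[OF open_UNIV, of X] unfolding sections_def by (simp add: restrict_charts_UNIV)
next
  case False
  then show ?thesis unfolding sections_def by auto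
qed

lemma section_fibre: "X \<in> sections M E \<Longrightarrow> X x \<in> fibre E x"
  by (simp add: section_iff)

lemma section_add:
  assumes "X \<in> sections M E" "Y \<in> sections M E"
  shows "(\<lambda>x. fadd E (X x) (Y x)) \<in> sections M E"
  unfolding section_iff
proof (intro conjI allI ballI)
  show "fadd E (X x) (Y x) \<in> fibre E x" for x by (intro fadd_fibre section_fibre assms)
  fix t assume t: "t \<in> trivs E"
  then have "msmooth M (fst t) (\<lambda>x. snd t (X x) + snd t (Y x))"
    using assms by (intro msmooth_add) (simp_all add: section_iff)
  then show "msmooth M (fst t) (\<lambda>x. snd t (fadd E (X x) (Y x)))"
    by (rule iffD1[OF msmooth_cong, rotated])
      (simp add: triv_add[OF triv_fibrewise[OF t] _ section_fibre[OF assms(1)] section_fibre[OF assms(2)]])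
qed

lemma section_scale:
  assumes "X \<in> sections M E" "msmooth M UNIV h"
  shows "(\<lambda>x. fscale E (h x) (X x)) \<in> sections M E"
  unfolding section_iff
proof (intro conjI allI ballI)
  show "fscale E (h x) (X x) \<in> fibre E x" for x by (intro fscale_fibre section_fibre assms)
  fix t assume t: "t \<in> trivs E"
  then have "msmooth M (fst t) (\<lambda>x. h x *\<^sub>R snd t (X x))"
    using assms msmooth_subset[OF assms(2) subset_UNIV triv_open[OF t]]
    by (intro msmooth_scaleR) (simp_all add: section_iff)
  then show "msmooth M (fst t) (\<lambda>x. snd t (fscale E (h x) (X x)))"
    by (rule iffD1[OF msmooth_cong, rotated])
      (simp add: triv_scale[OF triv_fibrewise[OF t] _ section_fibre[OF assms(1)]])
qed

text \<open>The record of a bundle has no zero vector, so \<open>fscale E 0 e\<close> with an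
  arbitrary \<open>e\<close> of the fibre plays that part outside \<open>U\<close>. The explicit
  description there is needed later to see that the anchor vanishes off \<open>U\<close>.\<close>

lemma cutoff_section:
  assumes t: "t \<in> trivs E" and U: "U \<subseteq> fst t" and V: "msmooth M U V" and b: "bump_at U x\<^sub>0 \<beta>"
  obtains X where "X \<in> sections M E" "\<And>x. x \<in> U \<Longrightarrow> X x = frame E t x (\<beta> x *\<^sub>R V x)"
    "\<And>x. x \<notin> U \<Longrightarrow> \<exists>e\<in>fibre E x. X x = fscale E 0 e"
proof
  define z where "z x = fscale E 0 (SOME e. e \<in> fibre E x)" for x
  have some: "(SOME e. e \<in> fibre E x) \<in> fibre E x" for x
  proof -
    obtain t where t: "t \<in> trivs E" "x \<in> fst t" using triv_around by blast
    from frame_in_fibre[OF triv_fibrewise[OF t(1)] t(2)] show ?thesis by (rule someI)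
  qed
  have z: "z x \<in> fibre E x" for x unfolding z_def by (intro fscale_fibre some)
  have sz: "snd s (z x) = 0" if "s \<in> trivs E" "x \<in> fst s" for s x
    unfolding z_def using triv_scale[OF triv_fibrewise[OF that(1)] that(2) some, of 0] by simp
  define X where "X x = (if x \<in> U then frame E t x (\<beta> x *\<^sub>R V x) else z x)" for x
  obtain K where K: "closed K" "K \<subseteq> U" "\<And>y. y \<notin> K \<Longrightarrow> \<beta> y = 0"
    using b unfolding bump_at_def by blast
  note oU = msmooth_open[OF V]
  show "X x = frame E t x (\<beta> x *\<^sub>R V x)" if "x \<in> U" for x using that by (simp add: X_def)
  show "\<exists>e\<in>fibre E x. X x = fscale E 0 e" if "x \<notin> U" for x
    using that some[of x] by (auto simp: X_def z_def)
  show "X \<in> sections M E"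
    unfolding section_iff
  proof (intro conjI allI ballI)
    show "X x \<in> fibre E x" for x
      using z U frame_in_fibre[OF triv_fibrewise[OF t]] by (auto simp: X_def)
    fix s assume s: "s \<in> trivs E"
    show "msmooth M (fst s) (\<lambda>x. snd s (X x))"
    proof (rule msmooth_local)
      fix y assume y: "y \<in> fst s"
      show "\<exists>W. y \<in> W \<and> W \<subseteq> fst s \<and> msmooth M W (\<lambda>x. snd s (X x))"
      proof (cases "y \<in> U")
        case True
        let ?W = "U \<inter> fst s"
        have oW: "open ?W" by (rule open_Int[OF oU triv_open[OF s]])
        have "msmooth M ?W \<beta>"
          using b msmooth_subset[OF _ subset_UNIV oW] unfolding bump_at_def by blast
        then have "msmooth M ?W (\<lambda>x. \<beta> x *\<^sub>R V x)"
          by (rule msmooth_scaleR) (rule msmooth_subset[OF V _ oW], simp)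
        then have "msmooth M ?W (\<lambda>x. snd s (frame E t x (\<beta> x *\<^sub>R V x)))"
        proof (rule msmooth_frame_apply[OF t, rotated -1])
          show "msmooth M ?W (\<lambda>x. snd s (frame E t x v))" for v
            by (rule msmooth_subset[OF triv_transition[OF t s] _ oW]) (use U in auto)
        qed (use U linear_transition[OF t _ s] in auto)
        then have "msmooth M ?W (\<lambda>x. snd s (X x))"
          by (rule iffD1[OF msmooth_cong, rotated]) (simp add: X_def)
        then show ?thesis using True y by (intro exI[of _ ?W]) auto
      next
        case False
        let ?W = "fst s \<inter> -K"
        have oW: "open ?W" using K(1) triv_open[OF s] by (simp add: open_Int open_Compl)
        have "msmooth M ?W (\<lambda>x. 0 :: real^'k)" by (rule msmooth_const[OF oW])
        then have "msmooth M ?W (\<lambda>x. snd s (X x))"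
        proof (rule iffD1[OF msmooth_cong, rotated])
          fix x assume x: "x \<in> ?W"
          show "0 = snd s (X x)"
          proof (cases "x \<in> U")
            case True
            have "linear (\<lambda>v. snd s (frame E t x v))"
              using linear_transition[OF t _ s] True U x by auto
            from linear_0[OF this] show ?thesis using K(3)[of x] x True by (simp add: X_def)
          qed (use sz s x in \<open>auto simp: X_def\<close>)
        qed
        then show ?thesis using False y K(2) by (intro exI[of _ ?W]) auto
      qed
    qed
  qed
qed

lemma section_through:
  assumes "a \<in> fibre E x"
  obtains X where "X \<in> sections M E" "X x = a"
proof -
  obtain t where t: "t \<in> trivs E" "x \<in> fst t" using triv_around by blast
  obtain \<beta> where b: "bump_at (fst t) x \<beta>" using ex_bump[OF triv_open[OF t(1)] t(2)] by blast
  obtain X where X: "X \<in> sections M E" "\<And>y. y \<in> fst t \<Longrightarrow> X y = frame E t y (\<beta> y *\<^sub>R snd t a)"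
    using cutoff_section[OF t(1) subset_refl msmooth_const[OF triv_open[OF t(1)]] b] by metis
  have "X x = a"
    using X(2)[OF t(2)] b frame_triv[OF triv_fibrewise[OF t(1)] t(2) assms] by (simp add: bump_at_def)
  with X(1) show ?thesis by (rule that)
qed

lemma frame_smooth:
  assumes t: "t \<in> trivs E"
  shows "smooth_map (restrict_charts (fst t) M) (bundle_charts M E) (\<lambda>x. frame E t x v)"
  using smooth_map_bundle_iff[OF triv_open[OF t] frame_in_fibre[OF triv_fibrewise[OF t]], of "\<lambda>_. v"]
    triv_transition[OF t] by simp

end

text \<open>Joint smoothness in base point and fibre coordinate follows from linearity: the
  coordinate expression is a finite sum of fibre coordinates times the values on constant frames,
  which depend on the base point alone.\<close>

lemma smooth_fibrewise_linear:
  fixes M :: "('a::{t2_space,second_countable_topology}, real^'n) chart set"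
    and E :: "('a, 'b, 'k::finite, 'z) vbundle_scheme" and F :: "('a, 'c, 'l::finite, 'y) vbundle_scheme"
  assumes "vector_bundle_over M E" "vector_bundle_over M F"
    and fib: "\<And>x e. e \<in> fibre E x \<Longrightarrow> \<Phi> e \<in> fibre F x"
    and add: "\<And>x e e'. e \<in> fibre E x \<Longrightarrow> e' \<in> fibre E x \<Longrightarrow> \<Phi> (fadd E e e') = fadd F (\<Phi> e) (\<Phi> e')"
    and scale: "\<And>x e r. e \<in> fibre E x \<Longrightarrow> \<Phi> (fscale E r e) = fscale F r (\<Phi> e)"
    and sm: "\<And>t s v. t \<in> trivs E \<Longrightarrow> s \<in> trivs F \<Longrightarrow>
      msmooth M (fst t \<inter> fst s) (\<lambda>x. snd s (\<Phi> (frame E t x v)))"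
  shows "smooth_map (bundle_charts M E) (bundle_charts M F) \<Phi>"
proof -
  interpret E: vector_bundle_over M E by fact
  interpret F: vector_bundle_over M F by fact
  show ?thesis
    unfolding smooth_map_def
  proof (intro conjI ballI)
    show "\<Phi> ` (\<Union>c\<in>bundle_charts M E. fst c) \<subseteq> (\<Union>d\<in>bundle_charts M F. fst d)"
    proof
      fix e assume "e \<in> \<Phi> ` (\<Union>c\<in>bundle_charts M E. fst c)"
      then obtain e' where "e' \<in> tot_space E" "e = \<Phi> e'" unfolding bundle_charts_def by auto
      then have "e \<in> fibre F (proj E e')" using fib[of e' "proj E e'"] by (simp add: fibre_def)
      then show "e \<in> (\<Union>d\<in>bundle_charts M F. fst d)" by (rule F.bundle_chart_dom)
    qed
    fix b b' assume "b \<in> bundle_charts M E" "b' \<in> bundle_charts M F"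
    then obtain c t d s where c: "c \<in> M" and t: "t \<in> trivs E" and d: "d \<in> M" and s: "s \<in> trivs F"
      and b: "b = ({e \<in> tot_space E. proj E e \<in> fst c \<inter> fst t}, \<lambda>e. (snd c (proj E e), snd t e))"
      and b': "b' = ({e \<in> tot_space F. proj F e \<in> fst d \<inter> fst s}, \<lambda>e. (snd d (proj F e), snd s e))"
      unfolding bundle_charts_def by blast
    have b_inj: "inj_on (snd b) (fst b)"
      using E.bundle_charts_inj[OF E.triv_fibrewise \<open>b \<in> bundle_charts M E\<close>] .
    let ?V = "fst t \<inter> fst d \<inter> fst s"
    let ?W = "snd c ` (fst c \<inter> ?V)"
    have V: "open ?V" using E.triv_open[OF t] F.triv_open[OF s] E.chart_open[OF d] by auto
    have W: "open ?W" using E.chart_image_open[OF c V] .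
    have chart_frame: "snd b (frame E t x v) = (snd c x, v)" "frame E t x v \<in> fst b"
      "\<Phi> (frame E t x v) \<in> fibre F x"
      if "x \<in> fst c" "x \<in> fst t" for x v
    proof -
      have f: "frame E t x v \<in> fibre E x"
        using frame_in_fibre[OF E.triv_fibrewise[OF t]] that by blast
      then show "snd b (frame E t x v) = (snd c x, v)" "frame E t x v \<in> fst b"
        using b that triv_frame[OF E.triv_fibrewise[OF t] that(2)] by (auto simp: fibreD)
      show "\<Phi> (frame E t x v) \<in> fibre F x" using fib[OF f] .
    qed
    \<comment> \<open>Because \<open>\<Phi>\<close> covers the identity, membership of the image in
      a bundle chart is a condition on the base point only, and the coordinate domain is a
      product.\<close>
    have dom: "snd b ` (fst b \<inter> \<Phi> -` fst b') = ?W \<times> (UNIV :: (real^'k) set)"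
    proof (intro equalityI subsetI)
      fix q assume "q \<in> snd b ` (fst b \<inter> \<Phi> -` fst b')"
      then obtain e where e: "e \<in> fst b" "\<Phi> e \<in> fst b'" "q = snd b e" by blast
      have "e \<in> fibre E (proj E e)" using e(1) b by (simp add: fibre_def)
      then have "proj F (\<Phi> e) = proj E e" using fib fibreD(2) by fast
      then show "q \<in> ?W \<times> (UNIV :: (real^'k) set)" using e b b' by auto
    next
      fix q assume "q \<in> ?W \<times> (UNIV :: (real^'k) set)"
      then obtain x v where x: "x \<in> fst c" "x \<in> ?V" "q = (snd c x, v)" by auto
      have "\<Phi> (frame E t x v) \<in> fst b'"
        using chart_frame(3)[of x v] x b' by (auto simp: fibre_def)
      then show "q \<in> snd b ` (fst b \<inter> \<Phi> -` fst b')"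
        using chart_frame(1,2)[of x v] x by (intro image_eqI[of _ _ "frame E t x v"]) auto
    qed
    have oW: "open (?W \<times> (UNIV :: (real^'k) set))" using W by (simp add: open_Times)
    have f: "smooth_on (?W \<times> (UNIV :: (real^'k) set)) (\<lambda>q. fst q)" "smooth_on (?W \<times> (UNIV :: (real^'k) set)) (\<lambda>q. snd q)"
      using smooth_on_bounded_linear[OF bounded_linear_fst smooth_on_ident[OF oW]]
        smooth_on_bounded_linear[OF bounded_linear_snd smooth_on_ident[OF oW]] by auto
    have "smooth_on ?W (\<lambda>p. snd d (chart_inv c p))"
      by (rule smooth_on_subset[OF E.chart_transition[OF c d] _ W]) auto
    then have 1: "smooth_on (?W \<times> (UNIV :: (real^'k) set)) (\<lambda>q. snd d (chart_inv c (fst q)))"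
      by (rule smooth_on_compose[OF f(1)]) auto
    have "smooth_on ?W (\<lambda>p. snd s (\<Phi> (frame E t (chart_inv c p) v)))" for v
      by (rule smooth_on_subset[OF E.msmoothD[OF sm[OF t s] c] _ W]) auto
    then have "smooth_on (?W \<times> (UNIV :: (real^'k) set)) (\<lambda>q. snd s (\<Phi> (frame E t (chart_inv c (fst q)) v)))" for v
      by (rule smooth_on_compose[OF f(1)]) auto
    then have 2: "smooth_on (?W \<times> (UNIV :: (real^'k) set))
        (\<lambda>q. \<Sum>v\<in>Basis. (snd q \<bullet> v) *\<^sub>R snd s (\<Phi> (frame E t (chart_inv c (fst q)) v)))"
      by (intro smooth_on_sum oW smooth_on_bounded_bilinear[OF bounded_bilinear_scaleR]
          smooth_on_bounded_linear[OF bounded_linear_inner_left f(2)])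
    from smooth_on_Pair[OF 1 2]
    have "smooth_on (?W \<times> (UNIV :: (real^'k) set)) (snd b' \<circ> \<Phi> \<circ> chart_inv b)"
    proof (rule iffD1[OF smooth_on_cong, rotated])
      fix q assume "q \<in> ?W \<times> (UNIV :: (real^'k) set)"
      then obtain x v where x: "x \<in> fst c" "x \<in> ?V" "q = (snd c x, v)" by auto
      have inv: "chart_inv b q = frame E t x v"
        using inv_into_f_f[OF b_inj chart_frame(2)[of x v]] chart_frame(1)[of x v] x by simp
      have lin: "linear (\<lambda>v. snd s (\<Phi> (frame E t x v)))"
      proof (rule E.linear_triv_frame[OF t])
        show "x \<in> fst t" using x by simp
        show "snd s (\<Phi> (fadd E e e')) = snd s (\<Phi> e) + snd s (\<Phi> e')"
          if "e \<in> fibre E x" "e' \<in> fibre E x" for e e'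
          using triv_add[OF F.triv_fibrewise[OF s], of x "\<Phi> e" "\<Phi> e'"] fib that x add by simp
        show "snd s (\<Phi> (fscale E r e)) = r *\<^sub>R snd s (\<Phi> e)" if "e \<in> fibre E x" for e r
          using triv_scale[OF F.triv_fibrewise[OF s], of x "\<Phi> e"] fib that x scale by simp
      qed
      have "snd s (\<Phi> (frame E t x v)) = snd s (\<Phi> (frame E t x (\<Sum>b\<in>Basis. (v \<bullet> b) *\<^sub>R b)))"
        by (simp add: euclidean_representation)
      also have "\<dots> = (\<Sum>b\<in>Basis. (v \<bullet> b) *\<^sub>R snd s (\<Phi> (frame E t x b)))"
        by (simp add: linear_sum[OF lin] linear_cmul[OF lin])
      finally show "(snd d (chart_inv c (fst q)),
          \<Sum>v\<in>Basis. (snd q \<bullet> v) *\<^sub>R snd s (\<Phi> (frame E t (chart_inv c (fst q)) v))) =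
          (snd b' \<circ> \<Phi> \<circ> chart_inv b) q"
        using x c b' inv fibreD(2)[OF chart_frame(3)[of x v]] by simp
    qed
    then show "smooth_on (snd b ` (fst b \<inter> \<Phi> -` fst b')) (snd b' \<circ> \<Phi> \<circ> chart_inv b)"
      unfolding dom .
  qed
qed

section \<open>Lie algebroids\<close>

lemma (in manifold) fibre_tangent_bundle: "fibre (tangent_bundle M) x = tangent_space M x"
  unfolding fibre_def tangent_bundle_def using tangent_fst by fastforce

lemma (in manifold) tangent_bundle_trivs: "trivs (tangent_bundle M) = (\<lambda>c. (fst c, \<lambda>s. snd s c)) ` M"
  unfolding tangent_bundle_def by simp

text \<open>A linear coordinate function, cut off. It is normalised to vanish at
  \<open>x\<^sub>0\<close>, so the derivative of the cut-off factor drops out of the product rule.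
  Such functions detect whether a tangent vector is zero.\<close>

lemma (in manifold) ex_test_function:
  assumes c: "c \<in> M" "x\<^sub>0 \<in> fst c"
  obtains h :: "'a \<Rightarrow> real" where "msmooth M UNIV h"
    "\<And>t. t \<in> tangent_space M x\<^sub>0 \<Longrightarrow> mdiff M h t = snd t c \<bullet> b"
proof -
  obtain \<beta> where \<beta>: "bump_at (fst c) x\<^sub>0 \<beta>" using ex_bump[OF chart_open[OF c(1)] c(2)] by auto
  define F where "F y = (snd c y + - snd c x\<^sub>0) \<bullet> b" for y
  have F: "msmooth M (fst c) F"
    unfolding F_def
    by (intro msmooth_bounded_linear[OF bounded_linear_inner_left] msmooth_add msmooth_chart c
        msmooth_const chart_open)
  define h where "h y = (if y \<in> fst c then \<beta> y *\<^sub>R F y else 0)" for y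
  have h: "msmooth M UNIV h" unfolding h_def by (rule msmooth_cutoff[OF \<beta> F])
  have b: "msmooth M (fst c) \<beta>" "\<beta> x\<^sub>0 = 1"
    using \<beta> msmooth_subset[OF _ subset_UNIV chart_open[OF c(1)]] unfolding bump_at_def by auto
  have "mdiff M h t = snd t c \<bullet> b" if t: "t \<in> tangent_space M x\<^sub>0" for t
  proof -
    have "mdiff M h t = mdiff M (\<lambda>y. \<beta> y *\<^sub>R F y) t"
      by (rule mdiff_cong[OF t msmooth_scaleR[OF b(1) F] c(2)]) (simp add: h_def)
    also have "\<dots> = \<beta> x\<^sub>0 *\<^sub>R mdiff M F t + mdiff M \<beta> t *\<^sub>R F x\<^sub>0"
      by (rule mdiff_bounded_bilinear[OF t bounded_bilinear_scaleR b(1) c(2) F])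
    also have "\<dots> = mdiff M F t" using b by (simp add: F_def)
    also have "\<dots> = snd t c \<bullet> b"
    proof (rule mdiff_eqI[OF t c F c(2)])
      have "((\<lambda>p. (p + - snd c x\<^sub>0) \<bullet> b) has_derivative (\<lambda>v. v \<bullet> b)) (at (snd c x\<^sub>0))"
        by (auto intro!: derivative_eq_intros)
      then show "((\<lambda>p. F (chart_inv c p)) has_derivative (\<lambda>v. v \<bullet> b)) (at (snd c x\<^sub>0))"
        by (rule has_derivative_transform_within_open[of _ _ _ _ "snd c ` fst c"])
          (use c chart_image_open[OF c(1) open_UNIV] in \<open>auto simp: F_def\<close>)
    qed
    finally show ?thesis .
  qed
  with h show ?thesis by (rule that)
qed

locale algebroid_over = manifold M
  for M :: "('a::{t2_space,second_countable_topology}, real^'n) chart set" +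
  fixes A :: "('a, 'b, 'k::finite, 'n::finite) algebroid"
  assumes lie_algebroid: "lie_algebroid M A"
begin

sublocale vector_bundle_over M A
  by unfold_locales (use lie_algebroid in \<open>simp add: lie_algebroid_def\<close>)

lemmas
      anchor_morphism = lie_algebroid[unfolded lie_algebroid_def, THEN conjunct2, THEN conjunct1,
        unfolded vb_morphism_def fibre_tangent_bundle]
  and bracket_section = lie_algebroid[unfolded lie_algebroid_def, THEN conjunct2, THEN conjunct2,
        THEN conjunct1, rule_format]
  and bracket_add = lie_algebroid[unfolded lie_algebroid_def, THEN conjunct2, THEN conjunct2,
        THEN conjunct2, THEN conjunct1, rule_format]
  and bracket_scale = lie_algebroid[unfolded lie_algebroid_def, THEN conjunct2, THEN conjunct2,
        THEN conjunct2, THEN conjunct2, THEN conjunct1, rule_format]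
  and bracket_antisym = lie_algebroid[unfolded lie_algebroid_def, THEN conjunct2, THEN conjunct2,
        THEN conjunct2, THEN conjunct2, THEN conjunct2, THEN conjunct1, rule_format]
  and bracket_jacobi = lie_algebroid[unfolded lie_algebroid_def, THEN conjunct2, THEN conjunct2,
        THEN conjunct2, THEN conjunct2, THEN conjunct2, THEN conjunct2, THEN conjunct1, rule_format]
  and bracket_leibniz = lie_algebroid[unfolded lie_algebroid_def smooth_map_iff, THEN conjunct2, THEN conjunct2,
        THEN conjunct2, THEN conjunct2, THEN conjunct2, THEN conjunct2, THEN conjunct2, rule_format]

lemma anchor_tangent: "a \<in> fibre A x \<Longrightarrow> anchor A a \<in> tangent_space M x"
  using anchor_morphism by blast

lemma anchor_add:
  assumes "a \<in> fibre A x" "b \<in> fibre A x"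
  shows "snd (anchor A (fadd A a b)) c = snd (anchor A a) c + snd (anchor A b) c"
proof -
  have "anchor A (fadd A a b) = fadd (tangent_bundle M) (anchor A a) (anchor A b)"
    using anchor_morphism assms by blast
  then show ?thesis by (simp add: tangent_bundle_def)
qed

lemma anchor_scale:
  assumes "a \<in> fibre A x"
  shows "snd (anchor A (fscale A r a)) c = r *\<^sub>R snd (anchor A a) c"
proof -
  have "anchor A (fscale A r a) = fscale (tangent_bundle M) r (anchor A a)"
    using anchor_morphism assms by blast
  then show ?thesis by (simp add: tangent_bundle_def)
qed

lemma anchor_smooth: "smooth_map (bundle_charts M A) (bundle_charts M (tangent_bundle M)) (anchor A)"
  using anchor_morphism by blast

lemma A_charts_inj: "b \<in> bundle_charts M A \<Longrightarrow> inj_on (snd b) (fst b)"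
  using bundle_charts_inj[of A b] triv_fibrewise by simp

lemma anchor_coord_smooth:
  assumes X: "smooth_map (restrict_charts U M) (bundle_charts M A) X" and U: "open U"
    and Xf: "\<And>x. x \<in> U \<Longrightarrow> X x \<in> fibre A x" and c: "c \<in> M"
  shows "msmooth M (U \<inter> fst c) (\<lambda>x. snd (anchor A (X x)) c)"
proof -
  have s: "smooth_map (restrict_charts U M) (bundle_charts M (tangent_bundle M)) (\<lambda>x. anchor A (X x))"
    by (rule smooth_map_comp[OF X anchor_smooth]) (use restrict_charts_inj A_charts_inj in auto)
  have "(fst c, \<lambda>s. snd s c) \<in> trivs (tangent_bundle M)"
    unfolding tangent_bundle_trivs using c by blast
  from smooth_map_bundleD[OF s U _ this] show ?thesis
    using Xf anchor_tangent chart_open[OF c] by (simp add: fibre_tangent_bundle)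
qed

lemma anchor_frame_smooth:
  assumes "t \<in> trivs A" "c \<in> M"
  shows "msmooth M (fst t \<inter> fst c) (\<lambda>x. snd (anchor A (frame A t x v)) c)"
  by (rule anchor_coord_smooth[OF frame_smooth[OF assms(1)] triv_open[OF assms(1)] _ assms(2)])
    (rule frame_in_fibre[OF triv_fibrewise[OF assms(1)]])

lemma linear_anchor_frame:
  assumes "t \<in> trivs A" "x \<in> fst t"
  shows "linear (\<lambda>v. snd (anchor A (frame A t x v)) c)"
  by (rule linear_triv_frame[OF assms]) (simp_all add: anchor_add[of _ x] anchor_scale[of _ x])

lemma section_mdiff_smooth:
  assumes X: "X \<in> sections M A" and h: "msmooth M UNIV h"
  shows "msmooth M UNIV (\<lambda>x. mdiff M h (anchor A (X x)))"
proof (rule msmooth_mdiff[OF _ _ h])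
  show "anchor A (X x) \<in> tangent_space M x" for x by (rule anchor_tangent[OF section_fibre[OF X]])
  fix c assume c: "c \<in> M"
  have "smooth_map (restrict_charts UNIV M) (bundle_charts M A) X"
    using X unfolding sections_def restrict_charts_UNIV by blast
  from anchor_coord_smooth[OF this open_UNIV section_fibre[OF X] c]
  show "msmooth M (UNIV \<inter> fst c) (\<lambda>x. snd (anchor A (X x)) c)" .
qed

definition kernel_section :: "('a \<Rightarrow> 'b) \<Rightarrow> bool" where
  "kernel_section Y \<longleftrightarrow> Y \<in> sections M A \<and> (\<forall>x. anchor A (Y x) = (x, \<lambda>_. 0))"

text \<open>With \<open>#Y = 0\<close>, expanding the Jacobi identity for \<open>X, Y, h Z\<close> by the Leibniz rule leaves
  \<open>(#[X, Y] h) Z = 0\<close>.\<close>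

lemma bracket_kernel_section:
  assumes X: "X \<in> sections M A" and Yk: "kernel_section Y"
  shows "kernel_section (bracket A X Y)"
proof -
  have Y: "Y \<in> sections M A" and Y0: "\<And>x. anchor A (Y x) = (x, \<lambda>_. 0)"
    using Yk unfolding kernel_section_def by auto
  define W where "W = bracket A X Y"
  have W: "W \<in> sections M A" unfolding W_def by (rule bracket_section[OF X Y])
  have "anchor A (W x) = (x, \<lambda>_. 0)" for x
  proof -
    obtain c where c: "c \<in> M" "x \<in> fst c" using chart_around by blast
    obtain t where t: "t \<in> trivs A" "x \<in> fst t" using triv_around by blast
    note ft = triv_fibrewise[OF t(1)]
    \<comment> \<open>Any nonzero vector of the fibre will do; it lets \<open>Z x\<close> be
      cancelled at the end of the computation.\<close>
    define e where "e = frame A t x (axis undefined 1)"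
    obtain Z where Z: "Z \<in> sections M A" "Z x = e"
      using section_through[OF frame_in_fibre[OF ft t(2)]] unfolding e_def by metis
    have tZ: "snd t (Z x) \<noteq> 0" unfolding Z(2) e_def triv_frame[OF ft t(2)] by (simp add: axis_eq_0_iff)
    note fs = section_fibre
    have main: "mdiff M h (anchor A (W x)) = 0" if h: "msmooth M UNIV h" for h :: "'a \<Rightarrow> real"
    proof -
      define g where "g x = mdiff M h (anchor A (X x))" for x
      have g: "msmooth M UNIV g" unfolding g_def by (rule section_mdiff_smooth[OF X h])
      define hZ where "hZ = (\<lambda>x. fscale A (h x) (Z x))"
      have hZ: "hZ \<in> sections M A" unfolding hZ_def by (rule section_scale[OF Z(1) h])
      have Yh: "mdiff M k (anchor A (Y y)) = 0" if "msmooth M UNIV k" for k :: "'a \<Rightarrow> real" and y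
        using mdiff_zero[OF that UNIV_I, of y] Y0 by simp
      have fadd0: "fadd A a (fscale A 0 b) = a" if "a \<in> fibre A y" "b \<in> fibre A y" for a b y
      proof -
        obtain s where s: "s \<in> trivs A" "y \<in> fst s" using triv_around by blast
        note fs = triv_fibrewise[OF s(1)]
        show ?thesis
          by (rule triv_eqI[OF fs s(2)])
            (simp_all add: that fadd_fibre fscale_fibre triv_add[OF fs s(2)] triv_scale[OF fs s(2)])
      qed
      \<comment> \<open>Since the anchor of \<open>Y\<close> vanishes, the derivative term of the
        Leibniz rule is absent and the bracket with \<open>Y\<close> is linear over
        functions.\<close>
      have Y_tensor: "bracket A Y (\<lambda>x. fscale A (k x) (V x)) = (\<lambda>x. fscale A (k x) (bracket A Y V x))"
        if k: "msmooth M UNIV k" and V: "V \<in> sections M A" for k V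
        unfolding bracket_leibniz[OF Y V k]
        by (rule ext, simp only: Yh[OF k])
          (rule fadd0[OF fscale_fibre[OF fs[OF bracket_section[OF Y V]]] fs[OF V]])
      have XZ: "bracket A X Z \<in> sections M A" and YZ: "bracket A Y Z \<in> sections M A"
        by (intro bracket_section X Y Z)+
      have XhZ: "bracket A X hZ = (\<lambda>x. fadd A (fscale A (h x) (bracket A X Z x)) (fscale A (g x) (Z x)))"
        unfolding hZ_def g_def by (rule bracket_leibniz[OF X Z(1) h])
      have YhZ: "bracket A Y hZ = (\<lambda>x. fscale A (h x) (bracket A Y Z x))"
        unfolding hZ_def by (rule Y_tensor[OF h Z(1)])
      have 1: "bracket A X (bracket A Y hZ) =
          (\<lambda>x. fadd A (fscale A (h x) (bracket A X (bracket A Y Z) x)) (fscale A (g x) (bracket A Y Z x)))"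
        unfolding YhZ g_def by (rule bracket_leibniz[OF X YZ h])
      have "bracket A Y (bracket A X hZ) =
          (\<lambda>x. fadd A (bracket A Y (\<lambda>x. fscale A (h x) (bracket A X Z x)) x) (bracket A Y (\<lambda>x. fscale A (g x) (Z x)) x))"
        unfolding XhZ by (rule bracket_add[OF Y section_scale[OF XZ h] section_scale[OF Z(1) g]])
      then have 2: "bracket A Y (bracket A X hZ) =
          (\<lambda>x. fadd A (fscale A (h x) (bracket A Y (bracket A X Z) x)) (fscale A (g x) (bracket A Y Z x)))"
        unfolding Y_tensor[OF h XZ] Y_tensor[OF g Z(1)] .
      have 3: "bracket A W hZ = (\<lambda>x. fadd A (fscale A (h x) (bracket A W Z x))
          (fscale A (mdiff M h (anchor A (W x))) (Z x)))"
        unfolding hZ_def by (rule bracket_leibniz[OF W Z(1) h])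
      \<comment> \<open>The Jacobi identity in the form [X, [Y, V]] = [Y, [X, V]] + [[X, Y], V],
        read in fibre coordinates. It is applied to \<open>hZ\<close> and to \<open>Z\<close>; the
        two instances differ by the wanted derivative term.\<close>
      have jac: "snd t (bracket A X (bracket A Y V) x) - snd t (bracket A Y (bracket A X V) x)
          - snd t (bracket A W V x) = 0" if V: "V \<in> sections M A" for V
      proof -
        have XV: "bracket A X V \<in> sections M A" by (rule bracket_section[OF X V])
        have a: "bracket A Y (bracket A V X) = (\<lambda>x. fscale A (- 1) (bracket A Y (bracket A X V) x))"
          unfolding bracket_antisym[OF X V] by (rule bracket_scale[OF Y XV])
        have b: "bracket A V (bracket A X Y) = (\<lambda>x. fscale A (- 1) (bracket A W V x))"
          unfolding W_def[symmetric] by (rule bracket_antisym[OF W V])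
        have 1: "bracket A X (bracket A Y V) x \<in> fibre A x" "bracket A Y (bracket A X V) x \<in> fibre A x"
          "bracket A W V x \<in> fibre A x"
          by (intro fs bracket_section X Y V W)+
        have "snd t (fadd A (fadd A (bracket A X (bracket A Y V) x)
            (fscale A (- 1) (bracket A Y (bracket A X V) x))) (fscale A (- 1) (bracket A W V x)))
            = snd t (fscale A 0 (X x))"
          using fun_cong[OF bracket_jacobi[OF X Y V], of x] unfolding a b by simp
        then show ?thesis
          by (simp add: 1 triv_add[OF ft t(2)] triv_scale[OF ft t(2)] fadd_fibre fscale_fibre fs[OF X])
      qed
      have mem: "bracket A X (bracket A Y Z) x \<in> fibre A x" "bracket A Y (bracket A X Z) x \<in> fibre A x"
          "bracket A W Z x \<in> fibre A x" "bracket A Y Z x \<in> fibre A x" "Z x \<in> fibre A x"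
        by (intro fs bracket_section X Y Z W)+
      have "mdiff M h (anchor A (W x)) *\<^sub>R snd t (Z x) =
          h x *\<^sub>R (snd t (bracket A X (bracket A Y Z) x) - snd t (bracket A Y (bracket A X Z) x)
          - snd t (bracket A W Z x))"
        using jac[OF hZ] unfolding 1 2 3
        by (simp add: mem triv_add[OF ft t(2)] triv_scale[OF ft t(2)] fscale_fibre algebra_simps)
      then have "mdiff M h (anchor A (W x)) *\<^sub>R snd t (Z x) = 0"
        unfolding jac[OF Z(1)] by simp
      then show ?thesis using tZ by simp
    qed
    have Wx: "anchor A (W x) \<in> tangent_space M x" by (rule anchor_tangent[OF fs[OF W]])
    \<comment> \<open>Test functions with prescribed differential recover each coordinate of the
      anchor from the vanishing derivatives.\<close>
    have "snd (anchor A (W x)) c = 0"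
    proof (rule euclidean_eqI)
      fix b :: "real^'n" assume "b \<in> Basis"
      obtain h :: "'a \<Rightarrow> real" where h: "msmooth M UNIV h"
        "\<And>t. t \<in> tangent_space M x \<Longrightarrow> mdiff M h t = snd t c \<bullet> b"
        using ex_test_function[OF c, of b] by auto
      show "snd (anchor A (W x)) c \<bullet> b = 0 \<bullet> b" using main[OF h(1)] h(2)[OF Wx] by simp
    qed
    then show ?thesis by (intro tangent_eqI[OF Wx tangent_zero c]) simp
  qed
  then show ?thesis using W unfolding kernel_section_def W_def by simp
qed

end

section \<open>Lifting tangent vectors through a surjective anchor\<close>

locale transitive_algebroid = algebroid_over M A
  for M :: "('a::{t2_space,second_countable_topology}, real^'n) chart set"
    and A :: "('a, 'b, 'k::finite, 'n::finite) algebroid" +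
  assumes anchor_surj: "anchor A ` fibre A x = tangent_space M x"
begin

text \<open>A coordinate vector \<open>w\<close> in one chart is spread to all charts by the
  differentials of the transitions; the chain rule gives the transformation law. The tangent vector
  so built has a preimage under the anchor by transitivity.\<close>

lemma anchor_frame_surj:
  assumes t: "t \<in> trivs A" "x \<in> fst t" and c: "c \<in> M" "x \<in> fst c"
  shows "surj (\<lambda>v. snd (anchor A (frame A t x v)) c)"
proof (rule surjI[where f="\<lambda>w. snd t (SOME a. a \<in> fibre A x \<and> snd (anchor A a) c = w)"])
  fix w
  define v where "v d = (if d \<in> M \<and> x \<in> fst d
    then frechet_derivative (\<lambda>p. snd d (chart_inv c p)) (at (snd c x)) w else 0)" for d
  have vc: "v c = w"
  proof -
    have "((\<lambda>p. snd c (chart_inv c p)) has_derivative (\<lambda>w. w)) (at (snd c x))"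
      by (rule has_derivative_transform_within_open[OF has_derivative_ident, of "snd c ` fst c"])
        (use c chart_image_open[OF c(1) open_UNIV] in auto)
    from frechet_derivative_at[OF this, symmetric] show ?thesis using c by (simp add: v_def)
  qed
  have tr: "v d' = frechet_derivative (\<lambda>p. snd d' (chart_inv d p)) (at (snd d x)) (v d)"
    if d: "d \<in> M" "x \<in> fst d" "d' \<in> M" "x \<in> fst d'" for d d'
  proof -
    have 1: "((\<lambda>p. snd d (chart_inv c p)) has_derivative
        frechet_derivative (\<lambda>p. snd d (chart_inv c p)) (at (snd c x))) (at (snd c x))"
      using smooth_on_has_derivative[OF chart_transition[OF c(1) d(1)]] c d by blast
    have 2: "((\<lambda>p. snd d' (chart_inv d p)) has_derivative
        frechet_derivative (\<lambda>p. snd d' (chart_inv d p)) (at (snd d x))) (at (snd d (chart_inv c (snd c x))))"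
      using smooth_on_has_derivative[OF chart_transition[OF d(1,3)]] c d by simp
    have "((\<lambda>p. snd d' (chart_inv d (snd d (chart_inv c p)))) has_derivative
        (\<lambda>w. frechet_derivative (\<lambda>p. snd d' (chart_inv d p)) (at (snd d x))
          (frechet_derivative (\<lambda>p. snd d (chart_inv c p)) (at (snd c x)) w))) (at (snd c x))"
      using diff_chain_at[OF 1 2] by (simp add: o_def)
    then have "((\<lambda>p. snd d' (chart_inv c p)) has_derivative
        (\<lambda>w. frechet_derivative (\<lambda>p. snd d' (chart_inv d p)) (at (snd d x))
          (frechet_derivative (\<lambda>p. snd d (chart_inv c p)) (at (snd c x)) w))) (at (snd c x))"
      by (rule has_derivative_transform_within_open[of _ _ _ _ "snd c ` (fst c \<inter> fst d)"])
        (use c d chart_image_open[OF c(1) chart_open[OF d(1)]] in auto)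
    from frechet_derivative_at[OF this, symmetric] show ?thesis using d by (simp add: v_def)
  qed
  have v0: "v d = 0" if "\<not> (d \<in> M \<and> x \<in> fst d)" for d using that unfolding v_def by (rule if_not_P)
  have "(x, v) \<in> tangent_space M x"
    unfolding tangent_space_iff fst_conv snd_conv
    by (intro conjI ballI allI impI refl) (erule conjE, rule tr, assumption+, rule v0)
  then have "(x, v) \<in> anchor A ` fibre A x" by (simp only: anchor_surj)
  then obtain a where a: "a \<in> fibre A x" "(x, v) = anchor A a" by (elim imageE)
  from a(2)[symmetric] have "snd (anchor A a) c = w" using vc by simp
  with a(1) have "\<exists>a. a \<in> fibre A x \<and> snd (anchor A a) c = w" by blast
  from someI_ex[OF this]
  show "snd (anchor A (frame A t x (snd t (SOME a. a \<in> fibre A x \<and> snd (anchor A a) c = w)))) c = w"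
    using frame_triv[OF triv_fibrewise[OF t(1)] t(2)] by simp
qed

text \<open>A right inverse \<open>R\<close> of the anchor matrix at \<open>x\<^sub>0\<close> is
  kept fixed. Nearby, \<open>\<alpha> x ** R\<close> is still invertible, and composing its inverse
  with \<open>R\<close> gives a right inverse depending smoothly on \<open>x\<close>. The lift is
  linear in \<open>W\<close> at each point, which gives the clause about zeros that
  \<open>kernel_section_through\<close> relies on.\<close>

lemma local_anchor_lift:
  assumes t: "t \<in> trivs A" "x\<^sub>0 \<in> fst t" and c: "c \<in> M" "x\<^sub>0 \<in> fst c"
  obtains U where "open U" "x\<^sub>0 \<in> U" "U \<subseteq> fst t \<inter> fst c"
    "\<And>W. msmooth M U W \<Longrightarrow> \<exists>V. msmooth M U V \<and>
      (\<forall>x\<in>U. snd (anchor A (frame A t x (V x))) c = W x \<and> (W x = 0 \<longrightarrow> V x = 0))"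
proof -
  define \<alpha> where "\<alpha> x = matrix (\<lambda>v. snd (anchor A (frame A t x v)) c)" for x
  have \<alpha>: "\<alpha> x *v v = snd (anchor A (frame A t x v)) c" if "x \<in> fst t" for x v
    unfolding \<alpha>_def using matrix_works linear_anchor_frame[OF t(1) that]
    by (simp add: linear_matrix_vector_mul_eq)
  have "surj ((*v) (\<alpha> x\<^sub>0))"
    using anchor_frame_surj[OF t c] by (simp add: \<alpha>[OF t(2)])
  then obtain R where R: "\<alpha> x\<^sub>0 ** R = mat 1"
    unfolding matrix_right_invertible_surjective[symmetric] by blast
  define N where "N x = \<alpha> x ** R" for x
  let ?O = "fst t \<inter> fst c"
  have oO: "open ?O" using triv_open[OF t(1)] chart_open[OF c(1)] by (rule open_Int)
  have sm_col: "msmooth M ?O (\<lambda>x. N x *v w)" for w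
    by (rule iffD1[OF msmooth_cong anchor_frame_smooth[OF t(1) c(1), of "R *v w"]])
      (simp add: N_def \<alpha> matrix_vector_mul_assoc[symmetric])
  have "msmooth M ?O (\<lambda>x. \<chi> i j. (N x *v axis j 1) $ i)"
    by (intro msmooth_vec_lambda oO msmooth_bounded_linear[OF bounded_linear_vec_nth sm_col])
  moreover have "(\<chi> i j. (B *v axis j 1) $ i) = B" for B :: "real^'n^'n"
    by (simp add: vec_eq_iff matrix_vector_mult_basis column_def)
  ultimately have N: "msmooth M ?O N" by simp
  define U where "U = ?O \<inter> (\<lambda>x. det (N x)) -` (-{0})"
  have U: "open U"
    unfolding U_def
    by (rule continuous_open_preimage[OF msmooth_continuous[OF msmooth_det[OF N]] oO]) auto
  have "x\<^sub>0 \<in> U" using t c R by (simp add: U_def N_def)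
  moreover have UO: "U \<subseteq> ?O" unfolding U_def by blast
  moreover have "\<exists>V. msmooth M U V \<and>
      (\<forall>x\<in>U. snd (anchor A (frame A t x (V x))) c = W x \<and> (W x = 0 \<longrightarrow> V x = 0))"
    if W: "msmooth M U W" for W
  proof (intro exI conjI ballI impI)
    define u where "u x = matrix_inv (N x) *v W x" for x
    have inv: "N x ** matrix_inv (N x) = mat 1" if "x \<in> U" for x
    proof -
      have "invertible (N x)" using that by (simp add: U_def invertible_det_nz)
      then show ?thesis unfolding invertible_def matrix_inv_def by (rule someI_ex[THEN conjunct1])
    qed
    have u: "msmooth M U u"
    proof (rule msmooth_solve[OF msmooth_subset[OF N UO U] W])
      show "N x *v u x = W x" if "x \<in> U" for x
        unfolding u_def matrix_vector_mul_assoc inv[OF that] by simp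
    qed (simp add: U_def)
    then show "msmooth M U (\<lambda>x. R *v u x)"
      by (rule msmooth_linear[OF matrix_vector_mul_linear])
    show "snd (anchor A (frame A t x (R *v u x))) c = W x" if "x \<in> U" for x
    proof -
      have "snd (anchor A (frame A t x (R *v u x))) c = \<alpha> x *v (R *v u x)"
        using that UO by (subst \<alpha>) auto
      also have "\<dots> = N x *v u x" by (simp add: N_def matrix_vector_mul_assoc)
      also have "\<dots> = W x" unfolding u_def matrix_vector_mul_assoc inv[OF that] by simp
      finally show ?thesis .
    qed
    show "R *v u x = 0" if "W x = 0" for x using that by (simp add: u_def)
  qed
  ultimately show ?thesis by (intro that[OF U]) 
qed

text \<open>Extend \<open>a\<close> with constant coordinates and subtract a lift of the anchor of
  this extension. At \<open>x\<^sub>0\<close> that anchor is zero, so the lift is zero there and the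
  value \<open>a\<close> survives.\<close>

lemma kernel_section_through:
  assumes a: "a \<in> anchor_kernel A x\<^sub>0"
  obtains Y where "kernel_section Y" "Y x\<^sub>0 = a"
proof -
  have af: "a \<in> fibre A x\<^sub>0" and a0: "anchor A a = (x\<^sub>0, \<lambda>_. 0)"
    using a unfolding anchor_kernel_def by auto
  obtain c where c: "c \<in> M" "x\<^sub>0 \<in> fst c" using chart_around by blast
  obtain t where t: "t \<in> trivs A" "x\<^sub>0 \<in> fst t" using triv_around by blast
  note ft = triv_fibrewise[OF t(1)]
  obtain U where U: "open U" "x\<^sub>0 \<in> U" "U \<subseteq> fst t \<inter> fst c"
    and lift: "\<And>W. msmooth M U W \<Longrightarrow> \<exists>V. msmooth M U V \<and>
      (\<forall>x\<in>U. snd (anchor A (frame A t x (V x))) c = W x \<and> (W x = 0 \<longrightarrow> V x = 0))"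
    using local_anchor_lift[OF t c] by metis
  define v where "v = snd t a"
  have fv: "frame A t x\<^sub>0 v = a" unfolding v_def by (rule frame_triv[OF ft t(2) af])
  have "msmooth M U (\<lambda>x. snd (anchor A (frame A t x v)) c)"
    by (rule msmooth_subset[OF anchor_frame_smooth[OF t(1) c(1)] U(3,1)])
  from lift[OF this] obtain V where V: "msmooth M U V"
    and V1: "\<And>x. x \<in> U \<Longrightarrow> snd (anchor A (frame A t x (V x))) c = snd (anchor A (frame A t x v)) c"
    and V0: "V x\<^sub>0 = 0"
    using U(2) fv a0 by auto
  have vV: "msmooth M U (\<lambda>x. v - V x)" by (intro msmooth_diff msmooth_const U V)
  obtain \<beta> where \<beta>: "bump_at U x\<^sub>0 \<beta>" using ex_bump[OF U(1,2)] by auto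
  have Ut: "U \<subseteq> fst t" using U(3) by blast
  obtain Y where Y: "Y \<in> sections M A" "\<And>x. x \<in> U \<Longrightarrow> Y x = frame A t x (\<beta> x *\<^sub>R (v - V x))"
    and Y0: "\<And>x. x \<notin> U \<Longrightarrow> \<exists>e\<in>fibre A x. Y x = fscale A 0 e"
    using cutoff_section[OF t(1) Ut vV \<beta>] by metis
  have "anchor A (Y x) = (x, \<lambda>_. 0)" for x
  proof (cases "x \<in> U")
    case True
    then have x: "x \<in> fst t" "x \<in> fst c" using U(3) by auto
    note lin = linear_anchor_frame[OF t(1) x(1), of c]
    have "snd (anchor A (Y x)) c = 0"
      unfolding Y(2)[OF True] linear_cmul[OF lin] linear_diff[OF lin] V1[OF True] by simp
    then show ?thesis
      by (intro tangent_eqI[OF anchor_tangent[OF section_fibre[OF Y(1)]] tangent_zero c(1) x(2)]) simp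
  next
    case False
    obtain e where e: "e \<in> fibre A x" "Y x = fscale A 0 e" using Y0[OF False] by blast
    obtain d where d: "d \<in> M" "x \<in> fst d" using chart_around by blast
    show ?thesis
      by (rule tangent_eqI[OF anchor_tangent[OF section_fibre[OF Y(1)]] tangent_zero d])
        (simp add: e(2) anchor_scale[OF e(1)])
  qed
  then have "kernel_section Y" using Y(1) unfolding kernel_section_def by simp
  moreover have "Y x\<^sub>0 = a" using Y(2)[OF U(2)] V0 \<beta> fv by (simp add: bump_at_def)
  ultimately show ?thesis by (rule that)
qed

end

section \<open>Killing fields\<close>

definition skew :: "(real^'m^'m) set" where
  "skew = {S. transpose S = - S}"

text \<open>The Lie algebra of the Euclidean group, with (S, b) standing for the field y -> S y +
  b.\<close>

definition kspace :: "((real^'m^'m) \<times> (real^'m)) set" where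
  "kspace = skew \<times> UNIV"

definition kfield :: "(real^'m^'m) \<times> (real^'m) \<Rightarrow> real^'m \<Rightarrow> real^'m" where
  "kfield P = (\<lambda>y. fst P *v y + snd P)"

text \<open>A left inverse of \<open>kfield\<close>. It is total on functions, but its value is
  meaningful only on affine fields.\<close>

definition kpar :: "(real^'m \<Rightarrow> real^'m) \<Rightarrow> (real^'m^'m) \<times> (real^'m)" where
  "kpar X = (matrix (\<lambda>y. X y - X 0), X 0)"

text \<open>On linear fields the Jacobi-Lie bracket is the negative of the matrix commutator, hence
  the order of the factors.\<close>

definition kbracket ::
    "(real^'m^'m) \<times> (real^'m) \<Rightarrow> (real^'m^'m) \<times> (real^'m) \<Rightarrow> (real^'m^'m) \<times> (real^'m)" where
  "kbracket P Q = (fst Q ** fst P - fst P ** fst Q, fst Q *v snd P - fst P *v snd Q)"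

lemma kpar_kfield [simp]: "kpar (kfield P) = P"
  by (simp add: kpar_def kfield_def)

lemma kfield_add: "kfield (P + Q) = (\<lambda>y. kfield P y + kfield Q y)"
  by (rule ext) (simp add: kfield_def algebra_simps matrix_vector_mult_add_rdistrib)

lemma kfield_scaleR: "kfield (r *\<^sub>R P) = (\<lambda>y. r *\<^sub>R kfield P y)"
  by (rule ext) (simp add: kfield_def algebra_simps scaleR_matrix_vector_assoc)

lemma skew_nth: "S \<in> skew \<longleftrightarrow> (\<forall>i j. S $ j $ i = - S $ i $ j)"
  by (simp add: skew_def transpose_def vec_eq_iff)

lemma subspace_skew: "subspace (skew :: (real^'m^'m) set)"
proof (rule subspaceI)
  show "0 \<in> (skew :: (real^'m^'m) set)" by (simp add: skew_nth)
  fix S T :: "real^'m^'m" and r :: real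
  assume S: "S \<in> skew"
  show "r *\<^sub>R S \<in> skew"
    unfolding skew_nth
  proof (intro allI)
    fix i j
    have "S $ j $ i = - S $ i $ j" using S unfolding skew_nth by blast
    then show "(r *\<^sub>R S) $ j $ i = - (r *\<^sub>R S) $ i $ j" by simp
  qed
  assume T: "T \<in> skew"
  show "S + T \<in> skew"
    unfolding skew_nth
  proof (intro allI)
    fix i j
    have "S $ j $ i = - S $ i $ j" "T $ j $ i = - T $ i $ j" using S T unfolding skew_nth by blast+
    then show "(S + T) $ j $ i = - (S + T) $ i $ j" by simp
  qed
qed

lemma subspace_kspace: "subspace (kspace :: ((real^'m^'m) \<times> (real^'m)) set)"
  unfolding kspace_def by (intro subspace_Times subspace_skew subspace_UNIV)

lemma span_kspace: "span kspace = (kspace :: ((real^'m^'m) \<times> (real^'m)) set)"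
  using span_eq_iff subspace_kspace by blast

lemma skew_quadratic:
  assumes "S \<in> skew"
  shows "v \<bullet> (S *v v) = 0"
proof -
  have "v \<bullet> (S *v v) = (transpose S *v v) \<bullet> v"
    by (simp add: dot_lmul_matrix)
  also have "transpose S *v v = - (S *v v)"
    using assms by (simp add: skew_def matrix_vector_mult_def sum_negf vec_eq_iff del: transpose_matrix_vector)
  finally show ?thesis by (simp add: inner_commute)
qed

lemma jl_bracket_kfield: "jl_bracket (kfield P) (kfield Q) = kfield (kbracket P Q)"
proof -
  have fd: "frechet_derivative (kfield P) (at y) = (\<lambda>v. fst P *v v)" for P :: "(real^'m^'m) \<times> (real^'m)" and y
  proof -
    have "(kfield P has_derivative (\<lambda>v. fst P *v v + 0)) (at y)"
      unfolding kfield_def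
      by (intro has_derivative_add bounded_linear_imp_has_derivative has_derivative_const
          linear_conv_bounded_linear[THEN iffD1] matrix_vector_mul_linear)
    from frechet_derivative_at[OF this, symmetric] show ?thesis by simp
  qed
  then show ?thesis
    unfolding jl_bracket_def fd
    by (intro ext) (simp add: kfield_def kbracket_def algebra_simps matrix_vector_mul_assoc
        matrix_vector_mult_diff_rdistrib)
qed

subsection \<open>Skew affine fields are Killing\<close>

text \<open>A distance-preserving map on an open set maps a small orthogonal frame at a point to an
  orthogonal frame, and the coordinates with respect to it extend the map to all of space.\<close>

lemma local_isometry_extends:
  fixes h :: "real^'m \<Rightarrow> real^'m"
  assumes U: "open U" and h: "\<And>x y. x \<in> U \<Longrightarrow> y \<in> U \<Longrightarrow> dist (h x) (h y) = dist x y"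
  shows "\<exists>g. rigid_motion g \<and> (\<forall>x\<in>U. h x = g x)"
proof (cases "U = {}")
  case True
  then show ?thesis by (intro exI[of _ id]) (simp add: rigid_motion_def)
next
  case False
  then obtain a where a: "a \<in> U" by blast
  obtain r where r: "r > 0" "cball a r \<subseteq> U" using U a open_contains_cball by blast
  define D where "D x = h x - h a" for x
  have inner: "D x \<bullet> D y = (x - a) \<bullet> (y - a)" if "x \<in> U" "y \<in> U" for x y
  proof -
    have n: "norm (D z) = norm (z - a)" if "z \<in> U" for z
      using h[OF that a] by (simp add: D_def dist_norm)
    have "norm (D x - D y) = norm ((x - a) - (y - a))"
      using h[OF \<open>x \<in> U\<close> \<open>y \<in> U\<close>] by (simp add: D_def dist_norm)
    then have "D x \<bullet> D x + D y \<bullet> D y - 2 * (D x \<bullet> D y) =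
        (x - a) \<bullet> (x - a) + (y - a) \<bullet> (y - a) - 2 * ((x - a) \<bullet> (y - a))"
      unfolding norm_eq by (simp add: inner_diff inner_commute algebra_simps)
    then show ?thesis using n[OF that(1)] n[OF that(2)] unfolding norm_eq by simp
  qed
  \<comment> \<open>The step \<open>r\<close> keeps \<open>a + r e_i\<close> inside
    \<open>U\<close>; division by \<open>r\<close> makes the images orthonormal rather than merely
    orthogonal.\<close>
  define w where "w i = (1 / r) *\<^sub>R D (a + r *\<^sub>R axis i 1)" for i :: 'm
  have in_U: "a + r *\<^sub>R axis i 1 \<in> U" for i :: 'm
    using r by (intro subsetD[OF r(2)]) (simp add: dist_norm)
  have w: "D x \<bullet> w i = (x - a) $ i" if "x \<in> U" for x i
    using inner[OF that in_U[of i]] r(1) by (simp add: w_def inner_axis)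
  have ww: "w i \<bullet> w j = (if i = j then 1 else 0)" for i j
    using w[OF in_U[of i], of j] r(1) by (simp add: w_def axis_def)
  define L where "L v = (\<Sum>i\<in>UNIV. v $ i *\<^sub>R w i)" for v :: "real^'m"
  have Lw: "L v \<bullet> w j = v $ j" for v j
  proof -
    have "L v \<bullet> w j = (\<Sum>i\<in>UNIV. if i = j then v $ i else 0)"
      unfolding L_def inner_sum_left by (intro sum.cong refl) (simp add: ww)
    then show ?thesis by simp
  qed
  have LL: "L u \<bullet> v = (\<Sum>i\<in>UNIV. u $ i * (v \<bullet> w i))" for u v
    unfolding L_def inner_sum_left by (intro sum.cong refl) (simp add: inner_commute)
  have L_norm: "norm (L v) = norm v" for v
    unfolding norm_eq LL[of v "L v"] Lw by (simp add: inner_vec_def)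
  have L_diff: "L u - L v = L (u - v)" for u v
    unfolding L_def by (simp add: algebra_simps sum_subtractf)
  define g where "g x = h a + L (x - a)" for x
  have "rigid_motion g"
    unfolding rigid_motion_def g_def dist_norm by (simp add: L_diff L_norm)
  moreover have "h x = g x" if x: "x \<in> U" for x
  proof -
    have DL: "D x \<bullet> L (x - a) = (x - a) \<bullet> (x - a)"
      unfolding inner_commute[of "D x" "L (x - a)"] LL w[OF x] by (simp add: inner_vec_def)
    \<comment> \<open>The distance between \<open>D x\<close> and \<open>L (x - a)\<close> is
      computed from inner products, all of which equal the squared length of
      \<open>x - a\<close>.\<close>
    have "(D x - L (x - a)) \<bullet> (D x - L (x - a)) =
        D x \<bullet> D x - 2 * (D x \<bullet> L (x - a)) + L (x - a) \<bullet> L (x - a)"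
      by (simp add: inner_diff inner_commute algebra_simps)
    also have "\<dots> = 0"
      using L_norm[of "x - a"] inner[OF x x] unfolding norm_eq DL by simp
    finally have "D x = L (x - a)" by simp
    then show ?thesis by (simp add: g_def D_def algebra_simps)
  qed
  ultimately show ?thesis by blast
qed

text \<open>The difference q of two integral curves satisfies q' = S q with S skew, so its length is
  constant. Each time-t map of a local flow therefore preserves distances on \<open>U\<close> and is
  the restriction of a rigid motion.\<close>

lemma kfield_killing:
  assumes P: "P \<in> kspace"
  shows "kfield P \<in> killing_fields"
  unfolding killing_fields_def
proof (intro CollectI conjI allI impI ballI)
  show "smooth_on UNIV (kfield P)"
    unfolding kfield_def
    by (intro smooth_on_add smooth_on_const smooth_on_linear[OF matrix_vector_mul_linear] smooth_on_ident open_UNIV)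
  fix \<epsilon> U \<phi> t
  assume fl: "local_flow (kfield P) \<epsilon> U \<phi>" and t: "t \<in> {- \<epsilon><..<\<epsilon>}"
  have S: "fst P \<in> skew" using P by (auto simp: kspace_def)
  have "dist (\<phi> t x) (\<phi> t y) = dist x y" if xy: "x \<in> U" "y \<in> U" for x y
  proof -
    define q where "q s = \<phi> s x - \<phi> s y" for s
    have "((\<lambda>s. q s \<bullet> q s) has_real_derivative 0) (at s)" if s: "s \<in> {- \<epsilon><..<\<epsilon>}" for s
    proof -
      have "(q has_vector_derivative kfield P (\<phi> s x) - kfield P (\<phi> s y)) (at s)"
        unfolding q_def using fl xy s unfolding local_flow_def by (intro has_vector_derivative_diff) auto
      moreover have "kfield P (\<phi> s x) - kfield P (\<phi> s y) = fst P *v q s"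
        by (simp add: kfield_def q_def matrix_vector_mult_diff_distrib)
      ultimately have d: "(q has_derivative (\<lambda>u. u *\<^sub>R (fst P *v q s))) (at s)"
        by (simp add: has_vector_derivative_def)
      have "((\<lambda>s. q s \<bullet> q s) has_derivative
          (\<lambda>u. q s \<bullet> (u *\<^sub>R (fst P *v q s)) + (u *\<^sub>R (fst P *v q s)) \<bullet> q s)) (at s)"
        by (rule has_derivative_inner[OF d d])
      then show ?thesis
        unfolding has_field_derivative_def
        by (rule has_derivative_eq_rhs) (simp add: fun_eq_iff inner_commute skew_quadratic[OF S])
    qed
    moreover have "\<epsilon> > 0" using fl unfolding local_flow_def by blast
    ultimately have "q t \<bullet> q t = q 0 \<bullet> q 0"
      using t by (intro DERIV_isconst3[of "-\<epsilon>" \<epsilon>]) auto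
    then have "norm (q t) = norm (q 0)" unfolding norm_eq .
    then show ?thesis
      using fl xy unfolding local_flow_def q_def dist_norm by simp
  qed
  moreover have "open U" using fl unfolding local_flow_def by blast
  ultimately show "\<exists>g. rigid_motion g \<and> (\<forall>x\<in>U. \<phi> t x = g x)"
    by (intro local_isometry_extends)
qed

lemma constant_fields_eq: "constant_fields = range (\<lambda>v :: real^'m. (\<lambda>y. v))"
proof -
  have "(\<lambda>y. v) \<in> killing_fields" for v :: "real^'m"
  proof -
    have "(0, v) \<in> kspace" by (simp add: kspace_def skew_nth)
    from kfield_killing[OF this] show ?thesis by (simp add: kfield_def)
  qed
  then show ?thesis unfolding constant_fields_def by auto
qed

subsection \<open>Dimensions\<close>

definition skew_unit :: "'m \<Rightarrow> 'm \<Rightarrow> real^'m^'m" where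
  "skew_unit i j = (\<chi> a b. (if a = i \<and> b = j then 1 else 0) - (if a = j \<and> b = i then 1 else 0))"

lemma skew_unit_nth:
  "skew_unit i j $ a $ b = (if a = i then if b = j then 1 else 0 else 0) - (if a = j then if b = i then 1 else 0 else 0)"
  by (simp add: skew_unit_def)

lemma skew_unit_skew: "skew_unit i j \<in> skew"
  by (auto simp: skew_nth skew_unit_nth)

lemma skew_unit_inner: "S \<bullet> skew_unit i j = S $ i $ j - S $ j $ i"
proof -
  have "S \<bullet> skew_unit i j = (\<Sum>a\<in>UNIV. \<Sum>b\<in>UNIV. (if b = j then if a = i then S $ a $ b else 0 else 0)
      - (if b = i then if a = j then S $ a $ b else 0 else 0))"
    unfolding inner_vec_def skew_unit_nth by (intro sum.cong refl) (simp add: inner_real_def)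
  also have "\<dots> = S $ i $ j - S $ j $ i"
    by (simp add: sum_subtractf sum.delta cong: if_cong)
  finally show ?thesis .
qed

lemma sum_skew_unit:
  "(\<Sum>i\<in>UNIV. \<Sum>j\<in>UNIV. C $ i $ j *\<^sub>R skew_unit i j) = C - transpose C"
proof -
  have "(\<Sum>i\<in>UNIV. \<Sum>j\<in>UNIV. C $ i $ j *\<^sub>R skew_unit i j) $ a $ b = (C - transpose C) $ a $ b" for a b
  proof -
    have "(\<Sum>i\<in>UNIV. \<Sum>j\<in>UNIV. C $ i $ j *\<^sub>R skew_unit i j) $ a $ b =
        (\<Sum>i\<in>UNIV. \<Sum>j\<in>UNIV. (if j = b then if i = a then C $ i $ j else 0 else 0)
          - (if j = a then if i = b then C $ i $ j else 0 else 0))"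
      unfolding sum_component vector_scaleR_component skew_unit_nth
      by (intro sum.cong refl) auto
    also have "\<dots> = C $ a $ b - C $ b $ a"
      by (simp add: sum_subtractf sum.delta cong: if_cong)
    finally show ?thesis by (simp add: transpose_def)
  qed
  then show ?thesis by (simp add: vec_eq_iff)
qed

text \<open>An injection of the index type into the naturals supplies an order, and the units with
  \<open>h i < h j\<close> form an orthogonal basis of vectors of squared length 2. Splitting all
  ordered pairs into \<open>P\<close>, its mirror image and the diagonal counts
  \<open>P\<close>.\<close>

lemma dim_skew: "dim (skew :: (real^'m^'m) set) = CARD('m) * (CARD('m) - 1) div 2"
proof -
  obtain h :: "'m \<Rightarrow> nat" where h: "inj h"
    using finite_imp_inj_to_nat_seg[OF finite] by blast
  define P where "P = {(i, j). h i < h j}"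
  define B where "B = (\<lambda>(i, j). skew_unit i j) ` P"
  have uu: "skew_unit i j \<bullet> skew_unit k l = (if i = k \<and> j = l then 2 else 0)"
    if "h i < h j" "h k < h l" for i j k l
    using that unfolding skew_unit_inner skew_unit_nth by auto
  have inj: "inj_on (\<lambda>(i, j). skew_unit i j) P"
  proof (rule inj_onI, clarify)
    fix i j k l assume *: "(i, j) \<in> P" "(k, l) \<in> P" "skew_unit i j = skew_unit k l"
    then have "skew_unit i j \<bullet> skew_unit k l = (2::real)"
      using uu[of i j i j] by (simp add: P_def)
    then show "i = k \<and> j = l" using uu[of i j k l] * by (simp add: P_def split: if_splits)
  qed
  have ind: "independent B"
  proof (rule pairwise_orthogonal_independent)
    show "pairwise orthogonal B"
      unfolding pairwise_def orthogonal_def B_def using uu by (auto simp: P_def)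
    show "0 \<notin> B"
    proof
      assume "0 \<in> B"
      then obtain i j where "(i, j) \<in> P" "skew_unit i j = 0" by (auto simp: B_def)
      with uu[of i j i j] show False by (simp add: P_def)
    qed
  qed
  have span: "skew \<subseteq> span B"
  proof
    fix S :: "real^'m^'m" assume S: "S \<in> skew"
    define R where "R = (\<Sum>(i, j)\<in>P. S $ i $ j *\<^sub>R skew_unit i j)"
    have "R $ a $ b = S $ a $ b" for a b
    proof -
      have "R $ a $ b = (\<Sum>(i, j)\<in>P. (if (i, j) = (a, b) then S $ a $ b else 0) - (if (i, j) = (b, a) then S $ b $ a else 0))"
        unfolding R_def sum_component
      proof (intro sum.cong refl, clarify)
        fix i j
        show "(S $ i $ j *\<^sub>R skew_unit i j) $ a $ b =
            (if (i, j) = (a, b) then S $ a $ b else 0) - (if (i, j) = (b, a) then S $ b $ a else 0)"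
          by (cases "i = a"; cases "j = b"; cases "i = b"; cases "j = a"; simp add: skew_unit_nth)
      qed
      also have "\<dots> = (\<Sum>p\<in>P. (if p = (a, b) then S $ a $ b else 0) - (if p = (b, a) then S $ b $ a else 0))"
        by (intro sum.cong refl) (simp only: split_beta prod.collapse)
      also have "\<dots> = (if (a, b) \<in> P then S $ a $ b else 0) - (if (b, a) \<in> P then S $ b $ a else 0)"
        by (simp add: sum_subtractf sum.delta')
      also have "\<dots> = S $ a $ b"
      proof (cases "a = b")
        case True
        moreover have "S $ b $ b = - S $ b $ b" using S unfolding skew_nth by blast
        ultimately show ?thesis by (simp add: P_def)
      next
        case False
        then have "h a \<noteq> h b" using h by (simp add: inj_eq)
        moreover have "S $ b $ a = - S $ a $ b" using S unfolding skew_nth by blast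
        ultimately show ?thesis by (simp add: P_def)
      qed
      finally show ?thesis .
    qed
    then have "S = R" by (simp add: vec_eq_iff)
    also have "R \<in> span B"
      unfolding R_def
    proof (rule span_sum)
      fix p assume "p \<in> P"
      then have "(case p of (i, j) \<Rightarrow> skew_unit i j) \<in> B" unfolding B_def by (rule imageI)
      then show "(case p of (i, j) \<Rightarrow> S $ i $ j *\<^sub>R skew_unit i j) \<in> span B"
        by (cases p) (simp add: span_base span_scale)
    qed
    finally show "S \<in> span B" .
  qed
  have "B \<subseteq> skew" unfolding B_def using skew_unit_skew by auto
  then have "dim (skew :: (real^'m^'m) set) = card B"
    using dim_unique[OF _ span ind] by blast
  also have "\<dots> = card P" unfolding B_def by (rule card_image[OF inj])
  finally have 1: "dim (skew :: (real^'m^'m) set) = card P" .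
  have U: "UNIV = P \<union> (prod.swap ` P \<union> range (\<lambda>i. (i, i)))"
  proof -
    have "p \<in> P \<union> (prod.swap ` P \<union> range (\<lambda>i. (i, i)))" for p
    proof -
      obtain i j where p: "p = (i, j)" by fastforce
      consider "h i < h j" | "h j < h i" | "h i = h j" by linarith
      then show ?thesis
      proof cases
        case 1 then show ?thesis by (simp add: P_def p)
      next
        case 2
        then have "(j, i) \<in> P" by (simp add: P_def)
        then have "prod.swap (j, i) \<in> prod.swap ` P" by (rule imageI)
        then show ?thesis by (simp add: p)
      next
        case 3 then show ?thesis using h by (simp add: p inj_eq)
      qed
    qed
    then show ?thesis by blast
  qed
  have "card (P \<union> (prod.swap ` P \<union> range (\<lambda>i. (i, i)))) =
      card P + (card (prod.swap ` P) + card (range (\<lambda>i::'m. (i, i))))"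
  proof -
    have f: "finite X" for X :: "('m \<times> 'm) set" by (rule finite)
    have "P \<inter> (prod.swap ` P \<union> range (\<lambda>i. (i, i))) = {}" "prod.swap ` P \<inter> range (\<lambda>i. (i, i)) = {}"
      by (auto simp: P_def)
    then show ?thesis by (simp add: card_Un_disjoint[OF f f])
  qed
  moreover have "card (prod.swap ` P) = card P" by (intro card_image) simp
  moreover have "card (range (\<lambda>i::'m. (i, i))) = CARD('m)" by (intro card_image) (simp add: inj_on_def)
  moreover have "card (UNIV :: ('m \<times> 'm) set) = CARD('m) * CARD('m)" by simp
  ultimately have "CARD('m) * CARD('m) = 2 * card P + CARD('m)"
    unfolding U[symmetric] by linarith
  then have "2 * card P = CARD('m) * (CARD('m) - 1)" by (simp add: algebra_simps diff_mult_distrib2)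
  then show ?thesis unfolding 1 by simp
qed

lemma dim_kspace: "dim (kspace :: ((real^'m^'m) \<times> (real^'m)) set) = dim (skew :: (real^'m^'m) set) + CARD('m)"
  unfolding kspace_def by (simp add: dim_Times[OF subspace_skew subspace_UNIV])

text \<open>A linear right inverse \<open>g\<close> splits the source into the kernel of
  \<open>f\<close> and the range of \<open>g\<close>, a copy of the target.\<close>

lemma dim_kernel_of_surj:
  fixes f :: "'a::euclidean_space \<Rightarrow> 'b::euclidean_space"
  assumes f: "linear f" "surj f"
  shows "dim {x. f x = 0} + DIM('b) = DIM('a)"
proof -
  obtain g where g: "linear g" "f \<circ> g = id" using linear_surjective_right_inverse[OF f] by blast
  have fg: "f (g y) = y" for y using g(2) by (simp add: fun_eq_iff)
  have K: "subspace {x. f x = 0}" by (rule linear_subspace_kernel[OF f(1)])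
  have R: "subspace (range g)" by (rule linear_subspace_image[OF g(1) subspace_UNIV])
  have "{x + y |x y. x \<in> {x. f x = 0} \<and> y \<in> range g} = UNIV"
  proof -
    have "\<exists>x y. z = x + y \<and> f x = 0 \<and> y \<in> range g" for z
      by (intro exI[of _ "z - g (f z)"] exI[of _ "g (f z)"]) (simp add: linear_diff[OF f(1)] fg)
    then show ?thesis by auto
  qed
  moreover have "{x. f x = 0} \<inter> range g = {0}"
    using fg linear_0[OF g(1)] linear_0[OF f(1)] by (auto simp: image_iff)
  ultimately have "DIM('a) = dim {x. f x = 0} + dim (range g)"
    using dim_sums_Int[OF K R] by simp
  moreover have "dim (range g) = DIM('b)"
  proof -
    have "inj g" using fg by (metis injI)
    then show ?thesis using dim_image_eq[OF g(1), of UNIV] by (simp add: inj_on_subset)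
  qed
  ultimately show ?thesis by simp
qed

text \<open>Every skew affine field is a combination \<open>\<theta> v + const\<close> with \<open>v \<in> N\<close>, and there are no more of
  these than skew affine fields, by the bound on the dimension of \<open>N\<close>. This identifies all Killing
  fields without solving a differential equation.\<close>

lemma killing_fields_eq:
  fixes \<theta> :: "real^'k \<Rightarrow> real^'m \<Rightarrow> real^'m"
  assumes add: "\<And>v w. \<theta> (v + w) = (\<lambda>y. \<theta> v y + \<theta> w y)"
    and scale: "\<And>r v. \<theta> (r *\<^sub>R v) = (\<lambda>y. r *\<^sub>R \<theta> v y)"
    and N: "subspace N" "dim N \<le> dim (skew :: (real^'m^'m) set)"
    and tr: "transverse_in_killing (\<theta> ` N) constant_fields"
  shows "killing_fields = kfield ` (kspace :: ((real^'m^'m) \<times> (real^'m)) set)"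
proof -
  define D where "D = N \<times> (UNIV :: (real^'m) set)"
  define \<Psi> where "\<Psi> d = (\<lambda>y. \<theta> (fst d) y + snd d)" for d :: "(real^'k) \<times> (real^'m)"
  have \<Psi>_add: "\<Psi> (d + e) = (\<lambda>y. \<Psi> d y + \<Psi> e y)" for d e
    by (simp add: \<Psi>_def add algebra_simps)
  have \<Psi>_scale: "\<Psi> (r *\<^sub>R d) = (\<lambda>y. r *\<^sub>R \<Psi> d y)" for r d
    by (simp add: \<Psi>_def scale algebra_simps)
  have D: "subspace D" unfolding D_def by (intro subspace_Times N subspace_UNIV)
  have dimD: "dim D \<le> dim (kspace :: ((real^'m^'m) \<times> (real^'m)) set)"
    unfolding D_def dim_kspace using N by (simp add: dim_Times[OF N(1) subspace_UNIV])
  have kill: "killing_fields = \<Psi> ` D"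
  proof -
    have "killing_fields = {\<lambda>y. X y + Y y |X Y. X \<in> \<theta> ` N \<and> Y \<in> range (\<lambda>v :: real^'m. (\<lambda>y. v))}"
      using tr unfolding transverse_in_killing_def constant_fields_eq by simp
    also have "\<dots> = \<Psi> ` D"
    proof (intro equalityI subsetI)
      fix Z assume "Z \<in> {\<lambda>y. X y + Y y |X Y. X \<in> \<theta> ` N \<and> Y \<in> range (\<lambda>v :: real^'m. (\<lambda>y. v))}"
      then obtain v c where "v \<in> N" "Z = \<Psi> (v, c)" by (auto simp: \<Psi>_def)
      then show "Z \<in> \<Psi> ` D" by (simp add: D_def)
    next
      fix Z assume "Z \<in> \<Psi> ` D"
      then obtain d where d: "d \<in> D" "Z = \<Psi> d" by (rule imageE)
      then show "Z \<in> {\<lambda>y. X y + Y y |X Y. X \<in> \<theta> ` N \<and> Y \<in> range (\<lambda>v :: real^'m. (\<lambda>y. v))}"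
        by (intro CollectI exI[of _ "\<theta> (fst d)"] exI[of _ "\<lambda>y. snd d"]) (auto simp: \<Psi>_def D_def)
    qed
    finally show ?thesis .
  qed
  obtain B :: "((real^'m^'m) \<times> (real^'m)) set" where B: "B \<subseteq> kspace" "independent B" "kspace \<subseteq> span B"
      "card B = dim (kspace :: ((real^'m^'m) \<times> (real^'m)) set)"
    by (rule basis_exists[of kspace])
  have "\<exists>d. d \<in> D \<and> kfield b = \<Psi> d" if "b \<in> B" for b
  proof -
    have "kfield b \<in> \<Psi> ` D" using kfield_killing B(1) that kill by blast
    then show ?thesis by blast
  qed
  then obtain d where d: "\<And>b. b \<in> B \<Longrightarrow> d b \<in> D" "\<And>b. b \<in> B \<Longrightarrow> kfield b = \<Psi> (d b)"
    by metis
  \<comment> \<open>The preimages \<open>d b\<close> are chosen only on a basis; extending linearly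
    makes \<open>\<Psi>\<close> after \<open>g\<close> equal to \<open>kfield\<close> on all of
    \<open>kspace\<close>, without any injectivity of \<open>\<Psi>\<close>.\<close>
  obtain g where g: "linear g" "\<forall>b\<in>B. g b = d b"
    using linear_independent_extend[OF B(2)] by blast
  have key: "g P \<in> D \<and> kfield P = \<Psi> (g P)" if "P \<in> span B" for P
    using that
  proof (induction rule: span_induct_alt)
    case base
    have "\<Psi> 0 = (\<lambda>y. 0)" using \<Psi>_scale[of 0 0] by simp
    then show ?case using linear_0[OF g(1)] subspace_0[OF D] by (simp add: kfield_def)
  next
    case (step c x y)
    have "g (c *\<^sub>R x + y) = c *\<^sub>R g x + g y" by (simp add: linear_add[OF g(1)] linear_cmul[OF g(1)])
    moreover have "c *\<^sub>R g x + g y \<in> D"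
      using step d(1) g(2) by (intro subspace_add[OF D] subspace_scale[OF D]) auto
    moreover have "kfield (c *\<^sub>R x + y) = \<Psi> (c *\<^sub>R g x + g y)"
      using step d(2) g(2) by (simp add: kfield_add kfield_scaleR \<Psi>_add \<Psi>_scale)
    ultimately show ?case by simp
  qed
  have gD: "g ` kspace \<subseteq> D" using key B(3) by blast
  have "inj_on g kspace"
  proof (rule inj_onI)
    fix P Q :: "(real^'m^'m) \<times> (real^'m)" assume PQ: "P \<in> kspace" "Q \<in> kspace" "g P = g Q"
    then have "P \<in> span B" "Q \<in> span B" using subsetD[OF B(3)] by simp_all
    then have "kfield P = kfield Q" using key[of P] key[of Q] PQ(3) by simp
    then have "kpar (kfield P) = kpar (kfield Q)" by simp
    then show "P = Q" by simp
  qed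
  then have "dim (g ` kspace) = dim (kspace :: ((real^'m^'m) \<times> (real^'m)) set)"
    using dim_image_eq[OF g(1), of "kspace :: ((real^'m^'m) \<times> (real^'m)) set", unfolded span_kspace]
    by simp
  \<comment> \<open>\<open>g\<close> is injective because \<open>kfield\<close> is, so its image has
    the full dimension of \<open>kspace\<close>; the bound on \<open>dim N\<close> leaves no room
    for more in \<open>D\<close>.\<close>
  then have "g ` kspace = D"
    using subspace_dim_equal[OF linear_subspace_image[OF g(1) subspace_kspace] D gD] dimD by simp
  then have "\<Psi> ` D = (\<lambda>P. \<Psi> (g P)) ` kspace" by auto
  also have "\<dots> = kfield ` kspace" using key B(3) by (intro image_cong refl) auto
  finally show ?thesis using kill by simp
qed

subsection \<open>Complements of the constant fields are isotropy algebras\<close>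

lemma skew_unit_mult: "skew_unit i j *v w = w $ j *\<^sub>R axis i 1 - w $ i *\<^sub>R axis j (1::real)"
proof -
  have "(skew_unit i j *v w) $ a = (w $ j *\<^sub>R axis i 1 - w $ i *\<^sub>R axis j (1::real)) $ a" for a
  proof -
    have "(skew_unit i j *v w) $ a = (\<Sum>b\<in>UNIV. (if b = j then if a = i then w $ b else 0 else 0)
        - (if b = i then if a = j then w $ b else 0 else 0))"
      unfolding matrix_vector_mult_def skew_unit_nth vec_lambda_beta
      by (intro sum.cong refl) auto
    also have "\<dots> = (w $ j *\<^sub>R axis i 1 - w $ i *\<^sub>R axis j (1::real)) $ a"
      by (simp add: sum_subtractf sum.delta axis_def)
    finally show ?thesis .
  qed
  then show ?thesis by (simp add: vec_eq_iff)
qed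

text \<open>The unit with indices i, j behaves like the wedge of e_i and e_j, on which commutation
  with \<open>B\<close> acts as a derivation: apply \<open>B\<close> to one factor at a
  time.\<close>

lemma skew_commutator_unit:
  assumes B: "B \<in> skew"
  shows "B ** skew_unit i j - skew_unit i j ** B =
    (\<Sum>k\<in>UNIV. B $ k $ i *\<^sub>R skew_unit k j + B $ k $ j *\<^sub>R skew_unit i k)"
proof -
  have sk: "B $ b $ a = - B $ a $ b" for a b using B unfolding skew_nth by blast
  have "(B ** skew_unit i j - skew_unit i j ** B) $ a $ b =
    (\<Sum>k\<in>UNIV. B $ k $ i *\<^sub>R skew_unit k j + B $ k $ j *\<^sub>R skew_unit i k) $ a $ b" for a b
  proof -
    have "(B ** skew_unit i j) $ a $ b = (\<Sum>c\<in>UNIV. (if c = i then if b = j then B $ a $ c else 0 else 0)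
        - (if c = j then if b = i then B $ a $ c else 0 else 0))"
      unfolding matrix_matrix_mult_def skew_unit_nth vec_lambda_beta
      by (intro sum.cong refl) auto
    moreover have "(skew_unit i j ** B) $ a $ b = (\<Sum>c\<in>UNIV. (if c = j then if a = i then B $ c $ b else 0 else 0)
        - (if c = i then if a = j then B $ c $ b else 0 else 0))"
      unfolding matrix_matrix_mult_def skew_unit_nth vec_lambda_beta
      by (intro sum.cong refl) auto
    moreover have "(\<Sum>k\<in>UNIV. B $ k $ i *\<^sub>R skew_unit k j + B $ k $ j *\<^sub>R skew_unit i k) $ a $ b =
        (\<Sum>k\<in>UNIV. (if k = a then if b = j then B $ k $ i else 0 else 0)
          - (if k = b then if a = j then B $ k $ i else 0 else 0)
          + ((if k = b then if a = i then B $ k $ j else 0 else 0)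
          - (if k = a then if b = i then B $ k $ j else 0 else 0)))"
      unfolding sum_component vector_add_component vector_scaleR_component skew_unit_nth
      by (intro sum.cong refl) auto
    ultimately show ?thesis
      by (simp add: sum_subtractf sum.distrib sum.delta sk[of i b] sk[of j b])
  qed
  then show ?thesis by (simp add: vec_eq_iff)
qed

text \<open>For i different from j the square of a unit is minus the orthogonal projection to the
  plane of e_i and e_j. Each coordinate direction lies in 2(m-1) of these planes, counted over
  ordered pairs.\<close>

lemma skew_casimir:
  "(\<Sum>i\<in>UNIV. \<Sum>j\<in>UNIV. skew_unit i j *v (skew_unit i j *v w)) = (- 2 * (real CARD('m) - 1)) *\<^sub>R (w :: real^'m)"
proof -
  have "(\<Sum>i\<in>UNIV. \<Sum>j\<in>UNIV. skew_unit i j *v (skew_unit i j *v w)) $ a =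
      ((- 2 * (real CARD('m) - 1)) *\<^sub>R w) $ a" for a
  proof -
    have "(\<Sum>i\<in>UNIV. \<Sum>j\<in>UNIV. skew_unit i j *v (skew_unit i j *v w)) $ a =
      (\<Sum>i\<in>UNIV. \<Sum>j\<in>UNIV. ((if j = i then if i = a then w $ j else 0 else 0) - (if i = a then w $ i else 0))
        - ((if j = a then w $ j else 0) - (if j = a then if i = j then w $ i else 0 else 0)))"
      unfolding sum_component skew_unit_mult
      by (intro sum.cong refl) (auto simp: axis_def)
    also have "\<dots> = w $ a - real CARD('m) * w $ a - (real CARD('m) * w $ a - w $ a)"
      by (simp add: sum_subtractf sum.delta sum.distrib sum_negf flip: sum_distrib_left)
    finally show ?thesis by (simp add: algebra_simps)
  qed
  then show ?thesis by (simp add: vec_eq_iff)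
qed

text \<open>Whitehead's lemma for \<open>so(m)\<close> acting on \<open>\<real>\<^sup>m\<close>: the cocycle whose graph is \<open>H\<close> is the coboundary
  of the vector obtained by contracting it with the Casimir element. No simplicity is needed, so
  \<open>m = 2\<close> is included.\<close>

lemma isotropy_point:
  fixes H :: "((real^'m^'m) \<times> (real^'m)) set"
  assumes m: "CARD('m) \<ge> 2" and H: "subspace H" "H \<subseteq> kspace" and full: "skew \<subseteq> fst ` H"
    and inj: "\<And>b. (0, b) \<in> H \<Longrightarrow> b = 0"
    and br: "\<And>P Q. P \<in> H \<Longrightarrow> Q \<in> H \<Longrightarrow> kbracket P Q \<in> H"
  shows "\<exists>p. \<forall>P\<in>H. kfield P p = 0"
proof -
  \<comment> \<open>By the assumption on elements (0, b), the subspace \<open>H\<close> is the graph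
    of a map from \<open>skew\<close> to vectors; \<open>s\<close> is this map.\<close>
  define s where "s S = (THE b. (S, b) \<in> H)" for S
  have s_eq: "s S = b" if "(S, b) \<in> H" for S b
    unfolding s_def
  proof (rule the_equality[where P="\<lambda>b. (S, b) \<in> H", OF that])
    fix b' assume "(S, b') \<in> H"
    from subspace_diff[OF H(1) this that] have "(0, b' - b) \<in> H" by simp
    from inj[OF this] show "b' = b" by simp
  qed
  have s_in: "(S, s S) \<in> H" if "S \<in> skew" for S
  proof -
    have "S \<in> fst ` H" using full that by (rule subsetD)
    then obtain P where "P \<in> H" "S = fst P" by blast
    then have "(S, snd P) \<in> H" by simp
    then show ?thesis using s_eq[of S "snd P"] by simp
  qed
  have s_add: "s (S + T) = s S + s T" if "S \<in> skew" "T \<in> skew" for S T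
    by (rule s_eq) (use subspace_add[OF H(1) s_in[OF that(1)] s_in[OF that(2)]] in simp)
  have s_scale: "s (r *\<^sub>R S) = r *\<^sub>R s S" if "S \<in> skew" for r S
    by (rule s_eq) (use subspace_scale[OF H(1) s_in[OF that]] in simp)
  \<comment> \<open>Closure of \<open>H\<close> under the bracket says that \<open>s\<close> is a
    1-cocycle. The two arguments are exchanged to absorb the sign in
    \<open>kbracket\<close>.\<close>
  have s_br: "s (S ** T - T ** S) = S *v s T - T *v s S" if "S \<in> skew" "T \<in> skew" for S T
    by (rule s_eq) (use br[OF s_in[OF that(2)] s_in[OF that(1)]] in \<open>simp add: kbracket_def\<close>)
  have s_sum: "s (\<Sum>k\<in>I. f k) = (\<Sum>k\<in>I. s (f k))" if "finite I" "\<And>k. f k \<in> skew" for f :: "'m \<Rightarrow> _" and I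
    using that(1)
  proof (induction I rule: finite_induct)
    case empty
    show ?case by (simp add: s_eq subspace_0[OF H(1), unfolded zero_prod_def])
  next
    case (insert k I)
    then show ?case
      using s_add[OF that(2)[of k] subspace_sum[OF subspace_skew, of I f]] that(2) by simp
  qed
  let ?E = "skew_unit :: 'm \<Rightarrow> 'm \<Rightarrow> _"
  define q where "q = (\<Sum>i\<in>UNIV. \<Sum>j\<in>UNIV. ?E i j *v s (?E i j))"
  have Bq: "B *v q = (- 2 * (real CARD('m) - 1)) *\<^sub>R s B" if B: "B \<in> skew" for B
  proof -
    have sk: "B $ b $ a = - B $ a $ b" for a b using B unfolding skew_nth by blast
    \<comment> \<open>\<open>B\<close> is moved past the unit by the cocycle identity. Summed over
      all pairs, the first two terms cancel because the Casimir element is invariant under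
      \<open>B\<close>, and the last one is the Casimir operator applied to
      \<open>s B\<close>.\<close>
    have split: "B *v (?E i j *v s (?E i j)) =
        ((B ** ?E i j - ?E i j ** B) *v s (?E i j) + ?E i j *v s (B ** ?E i j - ?E i j ** B))
        + ?E i j *v (?E i j *v s B)" for i j
      unfolding s_br[OF B skew_unit_skew]
      by (simp add: matrix_vector_mult_diff_rdistrib matrix_vector_mul_assoc matrix_vector_mult_diff_distrib)
    have s_comm: "s (B ** ?E i j - ?E i j ** B) =
        (\<Sum>k\<in>UNIV. B $ k $ i *\<^sub>R s (?E k j) + B $ k $ j *\<^sub>R s (?E i k))" for i j
    proof -
      have mem: "B $ k $ i *\<^sub>R ?E k j \<in> skew" "B $ k $ j *\<^sub>R ?E i k \<in> skew" for k
        by (intro subspace_scale[OF subspace_skew] skew_unit_skew)+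
      have "s (B ** ?E i j - ?E i j ** B) =
          (\<Sum>k\<in>UNIV. s (B $ k $ i *\<^sub>R ?E k j + B $ k $ j *\<^sub>R ?E i k))"
        unfolding skew_commutator_unit[OF B]
        by (rule s_sum[OF finite]) (intro subspace_add[OF subspace_skew] mem)
      then show ?thesis by (simp add: s_add[OF mem] s_scale skew_unit_skew)
    qed
    \<comment> \<open>Skewness of \<open>B\<close> expresses all four families of terms through
      \<open>u\<close> and \<open>v\<close> alone. They occur with opposite signs and with two
      indices exchanged, so renaming summation indices makes them cancel.\<close>
    define u where "u k i j = B $ k $ i *\<^sub>R (?E k j *v s (?E i j))" for k i j
    define v where "v k i j = B $ k $ j *\<^sub>R (?E i k *v s (?E i j))" for k i j
    have mv: "(\<Sum>k\<in>UNIV. X k) *v w = (\<Sum>k\<in>UNIV. X k *v w)" for X :: "'m \<Rightarrow> real^'m^'m" and w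
      by (rule linear_sum[where f="\<lambda>X. X *v w"])
        (rule bounded_linear.linear[OF bounded_bilinear.bounded_linear_left[OF bounded_bilinear_matrix_vector_mult]])
    have "(B ** ?E i j - ?E i j ** B) *v s (?E i j) + ?E i j *v s (B ** ?E i j - ?E i j ** B) =
        (\<Sum>k\<in>UNIV. u k i j + v k i j - u i k j - v j i k)" for i j
    proof -
      have "(B ** ?E i j - ?E i j ** B) *v s (?E i j) = (\<Sum>k\<in>UNIV. u k i j + v k i j)"
        unfolding skew_commutator_unit[OF B] mv u_def v_def
        by (simp add: matrix_vector_mult_add_rdistrib scaleR_matrix_vector_assoc)
      moreover have "?E i j *v s (B ** ?E i j - ?E i j ** B) = (\<Sum>k\<in>UNIV. - u i k j - v j i k)"
        unfolding s_comm u_def v_def linear_sum[OF matrix_vector_mul_linear]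
      proof (intro sum.cong refl)
        fix k
        show "?E i j *v (B $ k $ i *\<^sub>R s (?E k j) + B $ k $ j *\<^sub>R s (?E i k)) =
          - (B $ i $ k *\<^sub>R (?E i j *v s (?E k j))) - B $ j $ k *\<^sub>R (?E i j *v s (?E i k))"
          unfolding matrix_vector_right_distrib matrix_vector_mult_scaleR
          by (simp add: sk[of k i] sk[of k j])
      qed
      ultimately show ?thesis by (simp add: sum.distrib sum_subtractf sum_negf)
    qed
    then have "(\<Sum>i\<in>UNIV. \<Sum>j\<in>UNIV. (B ** ?E i j - ?E i j ** B) *v s (?E i j) + ?E i j *v s (B ** ?E i j - ?E i j ** B))
        = (\<Sum>i\<in>UNIV. \<Sum>j\<in>UNIV. \<Sum>k\<in>UNIV. u k i j) - (\<Sum>i\<in>UNIV. \<Sum>j\<in>UNIV. \<Sum>k\<in>UNIV. u i k j)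
        + ((\<Sum>i\<in>UNIV. \<Sum>j\<in>UNIV. \<Sum>k\<in>UNIV. v k i j) - (\<Sum>i\<in>UNIV. \<Sum>j\<in>UNIV. \<Sum>k\<in>UNIV. v j i k))"
      by (simp add: sum.distrib sum_subtractf)
    also have "(\<Sum>i\<in>UNIV. \<Sum>j\<in>UNIV. \<Sum>k\<in>UNIV. v j i k) = (\<Sum>i\<in>UNIV. \<Sum>j\<in>UNIV. \<Sum>k\<in>UNIV. v k i j)"
      by (rule sum.cong[OF refl], rule sum.swap)
    also have "(\<Sum>i\<in>UNIV. \<Sum>j\<in>UNIV. \<Sum>k\<in>UNIV. u i k j) = (\<Sum>i\<in>UNIV. \<Sum>j\<in>UNIV. \<Sum>k\<in>UNIV. u k i j)"
    proof -
      have "(\<Sum>i\<in>UNIV. \<Sum>j\<in>UNIV. \<Sum>k\<in>UNIV. u i k j) = (\<Sum>j\<in>UNIV. \<Sum>i\<in>UNIV. \<Sum>k\<in>UNIV. u i k j)"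
        by (rule sum.swap)
      also have "\<dots> = (\<Sum>j\<in>UNIV. \<Sum>i\<in>UNIV. \<Sum>k\<in>UNIV. u k i j)"
        by (rule sum.cong[OF refl], rule sum.swap)
      also have "\<dots> = (\<Sum>i\<in>UNIV. \<Sum>j\<in>UNIV. \<Sum>k\<in>UNIV. u k i j)"
        by (rule sum.swap)
      finally show ?thesis .
    qed
    finally have zero: "(\<Sum>i\<in>UNIV. \<Sum>j\<in>UNIV. (B ** ?E i j - ?E i j ** B) *v s (?E i j)
        + ?E i j *v s (B ** ?E i j - ?E i j ** B)) = 0" by simp
    have "B *v q = (\<Sum>i\<in>UNIV. \<Sum>j\<in>UNIV. B *v (?E i j *v s (?E i j)))"
      unfolding q_def by (simp add: linear_sum[OF matrix_vector_mul_linear])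
    also have "\<dots> = (- 2 * (real CARD('m) - 1)) *\<^sub>R s B"
      unfolding split using zero skew_casimir[of "s B"] by (simp add: sum.distrib)
    finally show ?thesis .
  qed
  \<comment> \<open>\<open>Bq\<close> now reads B q = - c s(B), so q / c is annihilated by each y ->
    B y + s(B). The bound on the dimension enters here, through \<open>c \<noteq> 0\<close>.\<close>
  define c where "c = 2 * (real CARD('m) - 1)"
  have c: "c \<noteq> 0" using m by (simp add: c_def)
  have "kfield P ((1 / c) *\<^sub>R q) = 0" if P: "P \<in> H" for P
  proof -
    have "fst P \<in> skew" using H(2) P by (auto simp: kspace_def)
    from Bq[OF this] have "fst P *v q = - (c *\<^sub>R s (fst P))" by (simp add: c_def algebra_simps)
    then have "fst P *v ((1 / c) *\<^sub>R q) = - s (fst P)" using c by (simp add: matrix_vector_mult_scaleR)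
    moreover have "s (fst P) = snd P" using s_eq P by simp
    ultimately show ?thesis by (simp add: kfield_def)
  qed
  then show ?thesis by blast
qed

text \<open>\<open>C \<mapsto> \<Sum> C\<^sub>i\<^sub>j S\<^sub>i\<^sub>j + (C + C\<^sup>T)\<close> is a small perturbation of \<open>C \<mapsto> 2 C\<close>.\<close>

lemma skew_span_perturbation:
  fixes S :: "'m \<Rightarrow> 'm \<Rightarrow> real^'m^'m"
  assumes S: "\<And>i j. S i j \<in> skew"
    and near: "\<And>i j. norm (S i j - skew_unit i j) < 1 / (real CARD('m) * real CARD('m))"
    and B: "B \<in> skew"
  shows "\<exists>C :: real^'m^'m. B = (\<Sum>i\<in>UNIV. \<Sum>j\<in>UNIV. C $ i $ j *\<^sub>R S i j)"
proof -
  define L where "L C = (\<Sum>i\<in>UNIV. \<Sum>j\<in>UNIV. C $ i $ j *\<^sub>R S i j) + (C + transpose C)" for C :: "real^'m^'m"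
  have tr: "transpose (C + D) = transpose C + transpose D" "transpose (r *\<^sub>R C) = r *\<^sub>R transpose C"
    for C D :: "real^'m^'m" and r
    by (simp_all add: transpose_def vec_eq_iff)
  have lin: "linear L"
    by (rule linearI) (simp_all add: L_def tr algebra_simps sum.distrib scaleR_sum_right)
  let ?n = "real CARD('m)"
  have n: "?n > 0" by simp
  \<comment> \<open>With the exact units in place of \<open>S i j\<close> the first sum would be the
    skew combination C - C^T and \<open>L C\<close> would equal 2 C. There are m^2 summands, each
    off by at most |C| / m^2, which is the origin of the threshold.\<close>
  have small: "norm (L C - 2 *\<^sub>R C) \<le> norm C" for C
  proof -
    have "L C - 2 *\<^sub>R C = (\<Sum>i\<in>UNIV. \<Sum>j\<in>UNIV. C $ i $ j *\<^sub>R S i j) - (C - transpose C)"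
      by (simp add: L_def scaleR_2)
    also have "\<dots> = (\<Sum>i\<in>UNIV. \<Sum>j\<in>UNIV. C $ i $ j *\<^sub>R (S i j - skew_unit i j))"
      unfolding sum_skew_unit[symmetric] by (simp add: scaleR_diff_right sum_subtractf)
    also have "norm \<dots> \<le> (\<Sum>i\<in>(UNIV::'m set). \<Sum>j\<in>(UNIV::'m set). norm C * (1 / (?n * ?n)))"
    proof (intro order_trans[OF norm_sum] sum_mono)
      fix i j
      have "\<bar>C $ i $ j\<bar> \<le> norm C"
        using component_le_norm_cart[of "C $ i" j] Finite_Cartesian_Product.norm_nth_le[of C i] by linarith
      then show "norm (C $ i $ j *\<^sub>R (S i j - skew_unit i j)) \<le> norm C * (1 / (?n * ?n))"
        unfolding norm_scaleR using near[of i j] by (intro mult_mono) auto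
    qed
    also have "\<dots> = norm C" using n by simp
    finally show ?thesis .
  qed
  have "inj L"
  proof (subst linear_injective_0[OF lin], intro allI impI)
    fix C assume "L C = 0"
    with small[of C] have "2 * norm C \<le> norm C" by simp
    then show "C = 0" by simp
  qed
  then have "surj L" using linear_injective_imp_surjective lin by blast
  then obtain C where C: "B = L C" by (metis surjD)
  have "(\<Sum>i\<in>UNIV. \<Sum>j\<in>UNIV. C $ i $ j *\<^sub>R S i j) \<in> skew"
    by (intro subspace_sum[OF subspace_skew] subspace_scale[OF subspace_skew] S)
  \<comment> \<open>\<open>B\<close> and the combination of the \<open>S i j\<close> are skew, so
    the symmetric remainder is also skew and therefore zero.\<close>
  from subspace_diff[OF subspace_skew B this] have "C + transpose C \<in> skew" by (simp add: C L_def)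
  then have "C + transpose C = 0"
    by (simp add: skew_nth vec_eq_iff transpose_def) (smt (verit, best))
  then show ?thesis using C by (intro exI[of _ C]) (simp add: L_def)
qed

section \<open>The immersion\<close>

lemma bounded_bilinear_matrix_matrix_mult:
  "bounded_bilinear ((**) :: real^'n^'m \<Rightarrow> real^'p^'n \<Rightarrow> real^'p^'m)"
proof (rule bilinear_conv_bounded_bilinear[THEN iffD1])
  show "bilinear ((**) :: real^'n^'m \<Rightarrow> real^'p^'n \<Rightarrow> real^'p^'m)"
    unfolding bilinear_def linear_iff
    by (simp add: matrix_add_ldistrib vec_eq_iff matrix_matrix_mult_def algebra_simps
        sum.distrib sum_distrib_left)
qed

lemma linear_kfield_at: "linear (\<lambda>P. kfield P y)"
  by (rule linearI) (simp_all add: kfield_add kfield_scaleR)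

lemma kfield_kbracket:
  "kfield (kbracket U V) p = fst V *v kfield U p - fst U *v kfield V p"
  by (simp add: kfield_def kbracket_def algebra_simps matrix_vector_mul_assoc
      matrix_vector_mult_diff_rdistrib)

text \<open>In dimension at least 2 every coordinate \<open>j\<close> has a partner
  \<open>i\<close>, and the rotation in that plane brings \<open>w $ j\<close> to position
  \<open>i\<close>. Consequently a vector is known once all its images under skew matrices
  are.\<close>

lemma skew_annihilates:
  fixes w :: "real^'m"
  assumes m: "CARD('m) \<ge> 2" and w: "\<And>S. S \<in> skew \<Longrightarrow> S *v w = 0"
  shows "w = 0"
proof -
  have "w $ j = 0" for j
  proof -
    have "\<not> (UNIV :: 'm set) \<subseteq> {j}"
      using m card_mono[of "{j}" "UNIV :: 'm set"] by auto
    then obtain i where i: "i \<noteq> j" by blast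
    have "w $ j *\<^sub>R axis i 1 - w $ i *\<^sub>R axis j (1::real) = 0"
      using w[OF skew_unit_skew[of i j]] by (simp add: skew_unit_mult)
    then have "(w $ j *\<^sub>R axis i 1 - w $ i *\<^sub>R axis j (1::real)) $ i = 0" by simp
    then show ?thesis using i by (simp add: axis_def)
  qed
  then show ?thesis by (simp add: vec_eq_iff)
qed

definition isotropy :: "real^'m \<Rightarrow> ((real^'m^'m) \<times> (real^'m)) set" where
  "isotropy p = {P \<in> kspace. kfield P p = 0}"

lemma subspace_isotropy: "subspace (isotropy p)"
proof -
  have "isotropy p = kspace \<inter> {P. kfield P p = 0}" unfolding isotropy_def by blast
  then show ?thesis
    using subspace_inter[OF subspace_kspace linear_subspace_kernel[OF linear_kfield_at[of p]]] by simp
qed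

text \<open>The isotropy algebra of \<open>p\<close> is the graph of S -> - S p over the skew
  matrices.\<close>

lemma dim_isotropy: "dim (isotropy (p :: real^'m)) = dim (skew :: (real^'m^'m) set)"
proof -
  let ?g = "\<lambda>S :: real^'m^'m. (S, - (S *v p))"
  have lin: "linear ?g"
    by (rule linearI) (simp_all add: matrix_vector_mult_add_rdistrib scaleR_matrix_vector_assoc)
  have "isotropy p = ?g ` skew"
    unfolding isotropy_def kspace_def kfield_def by (auto simp: image_iff eq_neg_iff_add_eq_0 add.commute)
  moreover have "inj_on ?g (span skew)" by (rule inj_onI) simp
  ultimately show ?thesis using dim_image_eq[OF lin] by simp
qed

section \<open>The morphism in coordinates (S, b), and the image of the anchor kernel\<close>

locale killing_algebroid = transitive_algebroid M A
  for M :: "('a::{t2_space,second_countable_topology}, real^'n) chart set"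
    and A :: "('a, 'b, 'k::finite, 'n::finite) algebroid" +
  fixes \<omega> :: "'b \<Rightarrow> (real^'m \<Rightarrow> real^'m)" and x\<^sub>0 :: 'a
  assumes card_m: "CARD('m) = CARD('n) + 1"
    and conn: "connected (UNIV :: 'a set)"
    and killing_morphism: "killing_morphism M A \<omega>"
    and rank: "CARD('k) = CARD('n) * (CARD('n) + 3) div 2"
    and \<omega>_inj: "inj_on \<omega> (fibre A x)"
    and transverse: "transverse_in_killing (\<omega> ` anchor_kernel A x\<^sub>0) constant_fields"
begin

lemma m2: "CARD('m) \<ge> 2"
  using card_m zero_less_card_finite[where 'a='n] by linarith

lemmas \<omega>_smooth = killing_morphism[unfolded killing_morphism_def, THEN conjunct1]
  and \<omega>_add = killing_morphism[unfolded killing_morphism_def, THEN conjunct2, THEN conjunct1, rule_format]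
  and \<omega>_scale = killing_morphism[unfolded killing_morphism_def, THEN conjunct2, THEN conjunct2,
        THEN conjunct1, rule_format]
  and \<omega>_bracket = killing_morphism[unfolded killing_morphism_def, THEN conjunct2, THEN conjunct2,
        THEN conjunct2, rule_format]

lemma \<omega>_killing: "a \<in> fibre A x \<Longrightarrow> \<omega> a \<in> killing_fields"
  using \<omega>_smooth bundle_chart_dom unfolding smooth_into_killing_def by fastforce

lemma anchor_kernel_frame:
  assumes t: "t \<in> trivs A" "x \<in> fst t" and c: "c \<in> M" "x \<in> fst c"
  shows "anchor_kernel A x = frame A t x ` {v. snd (anchor A (frame A t x v)) c = 0}" (is "_ = _ ` ?N")
proof (intro equalityI subsetI)
  note ft = triv_fibrewise[OF t(1)]
  fix a assume "a \<in> anchor_kernel A x"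
  then have a: "a \<in> fibre A x" "anchor A a = (x, \<lambda>_. 0)" unfolding anchor_kernel_def by auto
  then show "a \<in> frame A t x ` ?N"
    using frame_triv[OF ft t(2) a(1)] by (intro image_eqI[of _ _ "snd t a"]) simp_all
next
  note ft = triv_fibrewise[OF t(1)]
  fix a assume "a \<in> frame A t x ` ?N"
  then obtain v where v: "a = frame A t x v" "snd (anchor A (frame A t x v)) c = 0" by auto
  have f: "frame A t x v \<in> fibre A x" by (rule frame_in_fibre[OF ft t(2)])
  have "anchor A (frame A t x v) = (x, \<lambda>_. 0)"
    by (rule tangent_eqI[OF anchor_tangent[OF f] tangent_zero c]) (simp add: v)
  then show "a \<in> anchor_kernel A x" using f v unfolding anchor_kernel_def by simp
qed

text \<open>Rank and nullity of the anchor: n(n+3)/2 - n = n(n+1)/2, the dimension of so(n+1). This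
  is where the hypothesis on the rank acts.\<close>

lemma dim_anchor_kernel:
  assumes t: "t \<in> trivs A" "x \<in> fst t" and c: "c \<in> M" "x \<in> fst c"
  shows "subspace {v. snd (anchor A (frame A t x v)) c = 0}"
    "dim {v. snd (anchor A (frame A t x v)) c = 0} = dim (skew :: (real^'m^'m) set)"
proof -
  note lin = linear_anchor_frame[OF t, of c]
  show "subspace {v. snd (anchor A (frame A t x v)) c = 0}" by (rule linear_subspace_kernel[OF lin])
  have "dim {v. snd (anchor A (frame A t x v)) c = 0} + CARD('n) = CARD('k)"
    using dim_kernel_of_surj[OF lin anchor_frame_surj[OF t c]] by simp
  moreover have "CARD('k) = CARD('n) * (CARD('n) + 1) div 2 + CARD('n)"
  proof -
    have "CARD('n) * (CARD('n) + 3) = CARD('n) * (CARD('n) + 1) + CARD('n) * 2"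
      by (simp add: algebra_simps)
    then show ?thesis unfolding rank by simp
  qed
  moreover have "dim (skew :: (real^'m^'m) set) = CARD('n) * (CARD('n) + 1) div 2"
    unfolding dim_skew card_m by (simp add: mult.commute)
  ultimately show "dim {v. snd (anchor A (frame A t x v)) c = 0} = dim (skew :: (real^'m^'m) set)"
    by linarith
qed

text \<open>Applies the dimension argument in a frame at \<open>x\<^sub>0\<close>, the point where
  transversality is assumed.\<close>

lemma killing_eq: "killing_fields = kfield ` (kspace :: ((real^'m^'m) \<times> (real^'m)) set)"
proof -
  obtain c where c: "c \<in> M" "x\<^sub>0 \<in> fst c" using chart_around by blast
  obtain t where t: "t \<in> trivs A" "x\<^sub>0 \<in> fst t" using triv_around by blast
  note ft = frame_in_fibre[OF triv_fibrewise[OF t(1)] t(2)]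
  show ?thesis
  proof (rule killing_fields_eq[where \<theta>="\<lambda>v. \<omega> (frame A t x\<^sub>0 v)"])
    show "\<omega> (frame A t x\<^sub>0 (v + w)) = (\<lambda>y. \<omega> (frame A t x\<^sub>0 v) y + \<omega> (frame A t x\<^sub>0 w) y)" for v w
      unfolding frame_add[OF t] by (rule \<omega>_add[OF ft ft])
    show "\<omega> (frame A t x\<^sub>0 (r *\<^sub>R v)) = (\<lambda>y. r *\<^sub>R \<omega> (frame A t x\<^sub>0 v) y)" for r v
      unfolding frame_scale[OF t] by (rule \<omega>_scale[OF ft])
    show "transverse_in_killing ((\<lambda>v. \<omega> (frame A t x\<^sub>0 v)) ` {v. snd (anchor A (frame A t x\<^sub>0 v)) c = 0})
        constant_fields"
      using transverse unfolding anchor_kernel_frame[OF t c] by (simp add: image_image)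
  qed (use dim_anchor_kernel[OF t c] in auto)
qed

definition par :: "'b \<Rightarrow> (real^'m^'m) \<times> (real^'m)" where
  "par a = kpar (\<omega> a)"

lemma
  assumes "a \<in> fibre A x"
  shows par_kspace: "par a \<in> kspace" and kfield_par: "kfield (par a) = \<omega> a"
proof -
  have "\<omega> a \<in> kfield ` kspace" using \<omega>_killing[OF assms] by (simp only: killing_eq)
  then obtain P where "P \<in> kspace" "\<omega> a = kfield P" by blast
  then show "par a \<in> kspace" "kfield (par a) = \<omega> a" unfolding par_def by simp_all
qed

lemma par_add:
  assumes "a \<in> fibre A x" "b \<in> fibre A x"
  shows "par (fadd A a b) = par a + par b"
proof -
  have "\<omega> (fadd A a b) = kfield (par a + par b)"
    unfolding \<omega>_add[OF assms] kfield_add kfield_par[OF assms(1)] kfield_par[OF assms(2)] ..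
  then show ?thesis by (simp add: par_def)
qed

lemma par_scale:
  assumes "a \<in> fibre A x"
  shows "par (fscale A r a) = r *\<^sub>R par a"
proof -
  have "\<omega> (fscale A r a) = kfield (r *\<^sub>R par a)"
    unfolding \<omega>_scale[OF assms] kfield_scaleR kfield_par[OF assms] ..
  then show ?thesis by (simp add: par_def)
qed

lemma par_inj: "inj_on par (fibre A x)"
proof (rule inj_onI)
  fix a b assume "a \<in> fibre A x" "b \<in> fibre A x" "par a = par b"
  then show "a = b" using kfield_par[of a x] kfield_par[of b x] inj_onD[OF \<omega>_inj] by metis
qed

text \<open>The components of \<open>kpar\<close> are linear functionals on the Killing fields, so
  smoothness tested on functionals becomes smoothness of the coordinates (S, b).\<close>

lemma kpar_functional: "killing_functional (\<lambda>X. kpar (X :: real^'m \<Rightarrow> real^'m) \<bullet> b)"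
  unfolding killing_functional_def killing_eq
  by (auto simp: kfield_add[symmetric] kfield_scaleR[symmetric] inner_add_left)

lemma par_smooth:
  assumes X: "smooth_map (restrict_charts U M) (bundle_charts M A) X" and U: "open U"
  shows "msmooth M U (\<lambda>x. par (X x))"
proof (rule msmooth_componentwise[OF U])
  fix b :: "(real^'m^'m) \<times> (real^'m)"
  have "smooth_map (bundle_charts M A) euclidean_charts (\<lambda>a. par a \<bullet> b)"
    unfolding par_def
    using kpar_functional by (rule \<omega>_smooth[unfolded smooth_into_killing_def, THEN conjunct2, THEN spec, THEN mp])
  from smooth_map_comp[OF X this] restrict_charts_inj A_charts_inj
  show "msmooth M U (\<lambda>x. par (X x) \<bullet> b)" unfolding smooth_map_restrict_iff[OF U] by blast
qed

lemma par_section_smooth: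
  assumes "X \<in> sections M A"
  shows "msmooth M UNIV (\<lambda>x. par (X x))"
  by (rule par_smooth[OF _ open_UNIV]) (use assms in \<open>simp add: sections_def restrict_charts_UNIV\<close>)

text \<open>The flat connection is defined by differentiating at each point \<open>y\<close> of
  space separately. Evaluation at \<open>y\<close> is linear in the coordinates and commutes with
  the derivative, so differentiating the coordinates gives the same field.\<close>

lemma flat_conn_section:
  assumes t: "t \<in> tangent_space M x" and X: "X \<in> sections M A"
  shows "flat_conn M t (\<lambda>x. \<omega> (X x)) = kfield (mdiff M (\<lambda>x. par (X x)) t)"
proof
  fix y
  have "flat_conn M t (\<lambda>x. \<omega> (X x)) y = mdiff M (\<lambda>x. kfield (par (X x)) y) t"
    unfolding flat_conn_def by (simp add: kfield_par[OF section_fibre[OF X]])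
  also have "\<dots> = kfield (mdiff M (\<lambda>x. par (X x)) t) y"
    by (rule mdiff_bounded_linear[OF t linear_conv_bounded_linear[THEN iffD1, OF linear_kfield_at]
          par_section_smooth[OF X] UNIV_I])
  finally show "flat_conn M t (\<lambda>x. \<omega> (X x)) y = kfield (mdiff M (\<lambda>x. par (X x)) t) y" .
qed

lemma par_bracket:
  assumes X: "X \<in> sections M A" and Y: "Y \<in> sections M A"
  shows "par (bracket A X Y x) = mdiff M (\<lambda>x. par (Y x)) (anchor A (X x))
    - mdiff M (\<lambda>x. par (X x)) (anchor A (Y x)) + kbracket (par (X x)) (par (Y x))"
    (is "_ = ?U - ?V + ?W")
proof -
  note tX = anchor_tangent[OF section_fibre[OF X]] and tY = anchor_tangent[OF section_fibre[OF Y]]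
  have "\<omega> (bracket A X Y x) = (\<lambda>y. kfield ?U y - kfield ?V y + kfield ?W y)"
    unfolding \<omega>_bracket[OF X Y] flat_conn_section[OF tX Y] flat_conn_section[OF tY X]
    by (simp only: kfield_par[OF section_fibre[OF X], symmetric] kfield_par[OF section_fibre[OF Y], symmetric]
        jl_bracket_kfield)
  also have "\<dots> = kfield (?U - ?V + ?W)"
    by (rule ext) (simp only: linear_add[OF linear_kfield_at] linear_diff[OF linear_kfield_at])
  finally show ?thesis unfolding par_def by (simp only: kpar_kfield)
qed

lemma linear_par_frame:
  assumes "t \<in> trivs A" "x \<in> fst t"
  shows "linear (\<lambda>v. par (frame A t x v))"
  by (rule linear_triv_frame[OF assms par_add par_scale])

lemma
  shows subspace_par_kernel: "subspace (par ` anchor_kernel A x)"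
    and dim_par_kernel: "dim (par ` anchor_kernel A x) = dim (skew :: (real^'m^'m) set)"
    and par_kernel_kspace: "par ` anchor_kernel A x \<subseteq> kspace"
proof -
  obtain c where c: "c \<in> M" "x \<in> fst c" using chart_around by blast
  obtain t where t: "t \<in> trivs A" "x \<in> fst t" using triv_around by blast
  note ft = triv_fibrewise[OF t(1)]
  let ?N = "{v. snd (anchor A (frame A t x v)) c = 0}"
  let ?g = "\<lambda>v. par (frame A t x v)"
  have eq: "par ` anchor_kernel A x = ?g ` ?N"
    unfolding anchor_kernel_frame[OF t c] by (simp add: image_image)
  note lin = linear_par_frame[OF t]
  show "subspace (par ` anchor_kernel A x)"
    unfolding eq by (rule linear_subspace_image[OF lin dim_anchor_kernel(1)[OF t c]])
  have "inj ?g"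
  proof (rule injI)
    fix v w assume "?g v = ?g w"
    then have "frame A t x v = frame A t x w"
      using inj_onD[OF par_inj] frame_in_fibre[OF ft t(2)] by metis
    then have "snd t (frame A t x v) = snd t (frame A t x w)" by simp
    then show "v = w" using triv_frame[OF ft t(2)] by simp
  qed
  then have "inj_on ?g (span ?N)" by (rule inj_on_subset) simp
  from dim_image_eq[OF lin this]
  show "dim (par ` anchor_kernel A x) = dim (skew :: (real^'m^'m) set)"
    unfolding eq dim_anchor_kernel(2)[OF t c] .
  show "par ` anchor_kernel A x \<subseteq> kspace"
    unfolding anchor_kernel_def using par_kspace by blast
qed

lemma kernel_section_anchor_kernel: "kernel_section Y \<Longrightarrow> Y x \<in> anchor_kernel A x"
  unfolding kernel_section_def anchor_kernel_def using section_fibre by blast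

text \<open>Both elements are extended to sections whose anchor vanishes identically. The two
  derivative terms of the morphism condition then disappear, and the bracket of the sections, again
  in the kernel, maps to the pointwise bracket.\<close>

lemma par_kernel_bracket:
  assumes "P \<in> par ` anchor_kernel A x" "Q \<in> par ` anchor_kernel A x"
  shows "kbracket P Q \<in> par ` anchor_kernel A x"
proof -
  obtain a b where ab: "a \<in> anchor_kernel A x" "P = par a" "b \<in> anchor_kernel A x" "Q = par b"
    using assms by auto
  obtain X where X: "kernel_section X" "X x = a" using kernel_section_through[OF ab(1)] by metis
  obtain Y where Y: "kernel_section Y" "Y x = b" using kernel_section_through[OF ab(3)] by metis
  have XY: "X \<in> sections M A" "Y \<in> sections M A" "anchor A (X x) = (x, \<lambda>_. 0)" "anchor A (Y x) = (x, \<lambda>_. 0)"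
    using X(1) Y(1) unfolding kernel_section_def by auto
  have "par (bracket A X Y x) = kbracket P Q"
    unfolding par_bracket[OF XY(1,2)] XY(3,4)
    by (simp add: mdiff_zero[OF par_section_smooth UNIV_I] XY X(2) Y(2) ab)
  moreover have "bracket A X Y x \<in> anchor_kernel A x"
    by (rule kernel_section_anchor_kernel[OF bracket_kernel_section[OF XY(1) Y(1)]])
  ultimately show ?thesis by (metis imageI)
qed

section \<open>The fixed point of the isotropy and its dependence on the base point\<close>

definition fixes_pt :: "'a \<Rightarrow> real^'m \<Rightarrow> bool" where
  "fixes_pt x p \<longleftrightarrow> (\<forall>a\<in>anchor_kernel A x. \<omega> a p = 0)"

lemma fixes_pt_par: "fixes_pt x p \<longleftrightarrow> (\<forall>P\<in>par ` anchor_kernel A x. kfield P p = 0)"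
proof -
  have "kfield (par a) = \<omega> a" if "a \<in> anchor_kernel A x" for a
    using that kfield_par unfolding anchor_kernel_def by blast
  then show ?thesis unfolding fixes_pt_def by simp
qed

text \<open>One inclusion is the definition of a fixed point; the equality of dimensions makes it an
  equality.\<close>

lemma fixes_pt_isotropy:
  assumes "fixes_pt x p"
  shows "par ` anchor_kernel A x = isotropy p"
proof (rule subspace_dim_equal[OF subspace_par_kernel subspace_isotropy])
  show "par ` anchor_kernel A x \<subseteq> isotropy p"
    using assms par_kernel_kspace unfolding fixes_pt_par isotropy_def by blast
  show "dim (isotropy p) \<le> dim (par ` anchor_kernel A x)"
    unfolding dim_isotropy dim_par_kernel by simp
qed

lemma isotropy_skew: "S \<in> skew \<Longrightarrow> (S, - (S *v p)) \<in> isotropy p"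
  by (simp add: isotropy_def kspace_def kfield_def)

text \<open>If all rotation parts occur, the image of the kernel together with the constant fields
  spans \<open>kspace\<close>. The dimensions then add up exactly, so the intersection is zero, the
  image is a graph over \<open>skew\<close>, and \<open>isotropy_point\<close> applies.\<close>

lemma ex_fixes_pt:
  assumes full: "skew \<subseteq> fst ` par ` anchor_kernel A x"
  shows "\<exists>p. fixes_pt x p"
proof -
  let ?H = "par ` anchor_kernel A x"
  let ?Z = "{0} \<times> UNIV :: ((real^'m^'m) \<times> (real^'m)) set"
  have Z: "subspace ?Z" by (intro subspace_Times subspace_UNIV) (simp add: subspace_def)
  have "{P + Q |P Q. P \<in> ?H \<and> Q \<in> ?Z} = kspace"
  proof (intro equalityI subsetI)
    fix R assume "R \<in> {P + Q |P Q. P \<in> ?H \<and> Q \<in> ?Z}"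
    then obtain P Q where "P \<in> ?H" "Q \<in> ?Z" "R = P + Q" by blast
    then show "R \<in> kspace" using par_kernel_kspace[of x] by (auto simp: kspace_def)
  next
    fix R :: "(real^'m^'m) \<times> (real^'m)" assume "R \<in> kspace"
    then have "fst R \<in> fst ` ?H" using full by (auto simp: kspace_def)
    then obtain P where P: "P \<in> ?H" "fst R = fst P" by blast
    then have "R = P + (0, snd R - snd P)" by (simp add: prod_eq_iff)
    then show "R \<in> {P + Q |P Q. P \<in> ?H \<and> Q \<in> ?Z}" using P(1) by blast
  qed
  then have "dim (kspace :: ((real^'m^'m) \<times> (real^'m)) set) + dim (?H \<inter> ?Z) = dim ?H + dim ?Z"
    using dim_sums_Int[OF subspace_par_kernel[of x] Z] by simp
  moreover have "dim ?Z = CARD('m)"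
    using dim_Times[of "{0} :: (real^'m^'m) set" "UNIV :: (real^'m) set"] by (simp add: subspace_def)
  ultimately have "dim (?H \<inter> ?Z) = 0" unfolding dim_kspace dim_par_kernel by simp
  then have 0: "?H \<inter> ?Z \<subseteq> {0}" by simp
  have "b = 0" if "(0, b) \<in> ?H" for b
  proof -
    have "(0, b) \<in> ?H \<inter> ?Z" using that by simp
    from subsetD[OF 0 this] show ?thesis by (simp add: zero_prod_def)
  qed
  from isotropy_point[OF m2 subspace_par_kernel par_kernel_kspace full this par_kernel_bracket]
  show ?thesis unfolding fixes_pt_par by blast
qed

text \<open>Phrased by existence of a fixed point because this passes to limits. By
  \<open>ex_fixes_pt\<close> and \<open>fixes_pt_isotropy\<close> it is equivalent to the rotation
  parts filling \<open>skew\<close>, the form in which openness is proved.\<close>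

definition good :: "'a set" where "good = {x. \<exists>p. fixes_pt x p}"

text \<open>The choice is not arbitrary on \<open>good\<close>: two fixed points differ by a vector
  annihilated by every skew matrix, hence coincide.\<close>

definition dev :: "'a \<Rightarrow> real^'m" where "dev x = (SOME p. fixes_pt x p)"

lemma dev_fixes: "x \<in> good \<Longrightarrow> fixes_pt x (dev x)"
  unfolding good_def dev_def by (rule someI_ex) simp

text \<open>Transversality writes the rotation field of \<open>S\<close> about the origin as an
  image of the kernel plus a constant field; comparing linear parts shows that \<open>S\<close> is a
  rotation part.\<close>

lemma base_good: "x\<^sub>0 \<in> good"
proof -
  have "S \<in> fst ` par ` anchor_kernel A x\<^sub>0" if S: "S \<in> skew" for S
  proof -
    have "(S, 0) \<in> kspace" using S by (simp add: kspace_def)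
    then have "kfield (S, 0) \<in> killing_fields" by (rule kfield_killing)
    then have "kfield (S, 0) \<in> {\<lambda>y. X y + Y y |X Y. X \<in> \<omega> ` anchor_kernel A x\<^sub>0 \<and> Y \<in> constant_fields}"
      using transverse unfolding transverse_in_killing_def by simp
    then obtain a c where a: "a \<in> anchor_kernel A x\<^sub>0" and c: "kfield (S, 0) = (\<lambda>y. \<omega> a y + c)"
      unfolding constant_fields_eq by auto
    have "a \<in> fibre A x\<^sub>0" using a unfolding anchor_kernel_def by blast
    from kfield_par[OF this] have "\<omega> a = kfield (par a)" by simp
    then have "kfield (S, 0) = kfield (par a + (0, c))" unfolding c kfield_add by (simp add: kfield_def)
    then have "kpar (kfield (S, 0)) = kpar (kfield (par a + (0, c)))" by simp
    then have "S = fst (par a)" by (simp add: prod_eq_iff)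
    then show ?thesis using a by blast
  qed
  then show ?thesis using ex_fixes_pt[of x\<^sub>0] unfolding good_def by blast
qed

text \<open>Kernel sections are chosen whose rotation parts at \<open>x\<close> are exactly the
  units. By continuity these stay close to the units nearby, and matrices close to the units still
  span \<open>skew\<close>.\<close>

lemma local_rotations:
  assumes x: "x \<in> good"
  obtains Y W where "\<And>i j. kernel_section (Y i j)" "open W" "x \<in> W" "W \<subseteq> good"
    "\<And>i j. fst (par (Y i j x)) = skew_unit i j"
proof -
  have "\<exists>Y. kernel_section Y \<and> fst (par (Y x)) = skew_unit i j" for i j
  proof -
    have "(skew_unit i j, - (skew_unit i j *v dev x)) \<in> par ` anchor_kernel A x"
      unfolding fixes_pt_isotropy[OF dev_fixes[OF x]] by (rule isotropy_skew[OF skew_unit_skew])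
    then obtain a where a: "a \<in> anchor_kernel A x" "(skew_unit i j, - (skew_unit i j *v dev x)) = par a"
      by (elim imageE)
    obtain Y where "kernel_section Y" "Y x = a" using kernel_section_through[OF a(1)] by metis
    then show ?thesis using a(2) by (metis fst_conv)
  qed
  then obtain Y where Y: "\<And>i j. kernel_section (Y i j)" "\<And>i j. fst (par (Y i j x)) = skew_unit i j"
    by metis
  \<comment> \<open>The threshold of \<open>skew_span_perturbation\<close>.\<close>
  define \<delta> where "\<delta> = 1 / (real CARD('m) * real CARD('m))"
  have \<delta>: "\<delta> > 0" by (simp add: \<delta>_def)
  define S where "S i j y = fst (par (Y i j y))" for i j y
  have S: "msmooth M UNIV (S i j)" for i j
    unfolding S_def using Y(1) unfolding kernel_section_def
    by (intro msmooth_bounded_linear[OF bounded_linear_fst] par_section_smooth) blast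
  define W where "W = (\<Inter>i\<in>UNIV. \<Inter>j\<in>UNIV. S i j -` ball (skew_unit i j) \<delta>)"
  have "open (S i j -` ball (skew_unit i j) \<delta>)" for i j
    using continuous_open_preimage[OF msmooth_continuous[OF S] open_UNIV open_ball] by simp
  then have W: "open W" unfolding W_def by (intro open_INT ballI finite) 
  have xW: "x \<in> W" using Y(2) \<delta> by (simp add: W_def S_def)
  have "W \<subseteq> good"
  proof
    fix y assume y: "y \<in> W"
    have mem: "par (Y i j y) \<in> par ` anchor_kernel A y" for i j
      using kernel_section_anchor_kernel[OF Y(1)] by blast
    have "B \<in> fst ` par ` anchor_kernel A y" if B: "B \<in> skew" for B
    proof -
      have "\<exists>C :: real^'m^'m. B = (\<Sum>i\<in>UNIV. \<Sum>j\<in>UNIV. C $ i $ j *\<^sub>R S i j y)"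
      proof (rule skew_span_perturbation[OF _ _ B])
        show "S i j y \<in> skew" for i j
          using mem[of i j] par_kernel_kspace[of y] by (auto simp: S_def kspace_def)
        show "norm (S i j y - skew_unit i j) < 1 / (real CARD('m) * real CARD('m))" for i j
        proof -
          have "S i j y \<in> ball (skew_unit i j) \<delta>" using y by (simp add: W_def)
          then show ?thesis by (simp add: dist_norm norm_minus_commute \<delta>_def)
        qed
      qed
      then obtain C :: "real^'m^'m" where C: "B = (\<Sum>i\<in>UNIV. \<Sum>j\<in>UNIV. C $ i $ j *\<^sub>R S i j y)" by blast
      have "(\<Sum>i\<in>UNIV. \<Sum>j\<in>UNIV. C $ i $ j *\<^sub>R par (Y i j y)) \<in> par ` anchor_kernel A y"
        by (intro subspace_sum[OF subspace_par_kernel] subspace_scale[OF subspace_par_kernel] mem)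
      from imageI[OF this, of fst] show ?thesis
        unfolding C S_def by (simp add: fst_sum)
    qed
    then show "y \<in> good" using ex_fixes_pt[of y] unfolding good_def by blast
  qed
  with Y W xW show ?thesis by (intro that) auto
qed

lemma open_good: "open good"
proof (subst open_subopen, intro ballI)
  fix x assume "x \<in> good"
  then obtain W where "open W" "x \<in> W" "W \<subseteq> good" by (rule local_rotations)
  then show "\<exists>T. open T \<and> x \<in> T \<and> T \<subseteq> good" by (intro exI[of _ W]) simp
qed

text \<open>The point satisfies S_ij f = - b_ij for the sections of \<open>local_rotations\<close>,
  an overdetermined system. Applying S_ij once more and summing gives a square system, whose matrix
  at \<open>x\<close> is the Casimir scalar -2(m-1) and hence is invertible nearby.\<close>

lemma dev_smooth: "msmooth M good dev"
proof (rule msmooth_local)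
  fix x assume x: "x \<in> good"
  obtain Y W where Y: "\<And>i j. kernel_section (Y i j)" and W: "open W" "x \<in> W" "W \<subseteq> good"
    and Yx: "\<And>i j. fst (par (Y i j x)) = skew_unit i j"
    using local_rotations[OF x] by metis
  define S where "S i j y = fst (par (Y i j y))" for i j y
  define b where "b i j y = snd (par (Y i j y))" for i j y
  have Ys: "Y i j \<in> sections M A" for i j using Y unfolding kernel_section_def by blast
  have S: "msmooth M UNIV (S i j)" and b: "msmooth M UNIV (b i j)" for i j
    unfolding S_def b_def
    by (intro msmooth_bounded_linear[OF bounded_linear_fst] msmooth_bounded_linear[OF bounded_linear_snd]
        par_section_smooth Ys)+
  define G where "G y = (\<Sum>i\<in>UNIV. \<Sum>j\<in>UNIV. S i j y ** S i j y)" for y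
  define h where "h y = (\<Sum>i\<in>UNIV. \<Sum>j\<in>UNIV. S i j y *v (- b i j y))" for y
  have G: "msmooth M UNIV G"
    unfolding G_def
    by (intro msmooth_sum open_UNIV msmooth_bounded_bilinear[OF bounded_bilinear_matrix_matrix_mult] S)
  have h: "msmooth M UNIV h"
    unfolding h_def
    by (intro msmooth_sum open_UNIV msmooth_matrix_vector_mult S
        msmooth_bounded_linear[OF bounded_linear_minus[OF bounded_linear_ident] b])
  have Gv: "G y *v w = (\<Sum>i\<in>UNIV. \<Sum>j\<in>UNIV. S i j y *v (S i j y *v w))" for y w
  proof -
    have l: "linear (\<lambda>X :: real^'m^'m. X *v w)"
      by (rule bounded_linear.linear[OF bounded_bilinear.bounded_linear_left[OF bounded_bilinear_matrix_vector_mult]])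
    show ?thesis unfolding G_def linear_sum[OF l] matrix_vector_mul_assoc ..
  qed
  define V where "V = W \<inter> (\<lambda>y. det (G y)) -` (-{0})"
  have "open ((\<lambda>y. det (G y)) -` (-{0}))"
    using continuous_open_preimage[OF msmooth_continuous[OF msmooth_det[OF G]] open_UNIV, of "-{0}"]
    by auto
  then have V: "open V" unfolding V_def by (rule open_Int[OF W(1)])
  have Gx: "G x *v w = (- 2 * (real CARD('m) - 1)) *\<^sub>R w" for w
    unfolding Gv S_def Yx by (rule skew_casimir)
  have "inj ((*v) (G x))"
    using m2 by (intro injI) (simp add: Gx)
  then have "invertible (G x)"
    unfolding invertible_left_inverse matrix_left_invertible_injective .
  then have "det (G x) \<noteq> 0" by (simp add: invertible_det_nz)
  then have xV: "x \<in> V" using W by (simp add: V_def)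
  have "msmooth M V dev"
  proof (rule msmooth_solve[OF msmooth_subset[OF G subset_UNIV V] msmooth_subset[OF h subset_UNIV V]])
    fix y assume y: "y \<in> V"
    then show "det (G y) \<noteq> 0" by (simp add: V_def)
    have "fixes_pt y (dev y)" using y W dev_fixes by (auto simp: V_def)
    then have "kfield (par (Y i j y)) (dev y) = 0" for i j
      using kernel_section_anchor_kernel[OF Y] unfolding fixes_pt_par by blast
    then have "S i j y *v dev y = - b i j y" for i j
      by (simp add: kfield_def S_def b_def eq_neg_iff_add_eq_0)
    then show "G y *v dev y = h y" unfolding Gv h_def by simp
  qed
  then show "\<exists>V. x \<in> V \<and> V \<subseteq> good \<and> msmooth M V dev"
    using xV W(3) by (intro exI[of _ V]) (auto simp: V_def)
qed

text \<open>Differentiate \<open>\<omega> Y (f) = 0\<close> for sections \<open>Y\<close> of the isotropy, and compare with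
  \<open>\<omega> [X, Y] (f) = 0\<close>.\<close>

lemma mdiff_dev:
  assumes x: "x \<in> good" and a: "a \<in> fibre A x"
  shows "mdiff M dev (anchor A a) = \<omega> a (dev x)"
proof -
  obtain X where X: "X \<in> sections M A" "X x = a" using section_through[OF a] by metis
  let ?t = "anchor A a" and ?d = "mdiff M dev (anchor A a)"
  have t: "?t \<in> tangent_space M x" by (rule anchor_tangent[OF a])
  \<comment> \<open>By \<open>skew_annihilates\<close>, it is enough to compare the two sides after
    applying an arbitrary rotation \<open>S\<close>, realised as the rotation part of some kernel
    section at \<open>x\<close>.\<close>
  have "S *v (?d - \<omega> a (dev x)) = 0" if S: "S \<in> skew" for S
  proof -
    have "(S, - (S *v dev x)) \<in> par ` anchor_kernel A x"
      unfolding fixes_pt_isotropy[OF dev_fixes[OF x]] by (rule isotropy_skew[OF S])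
    then obtain b where b: "b \<in> anchor_kernel A x" "(S, - (S *v dev x)) = par b" by (elim imageE)
    obtain Y where Y: "kernel_section Y" "Y x = b" using kernel_section_through[OF b(1)] by metis
    have Ys: "Y \<in> sections M A" and Y0: "\<And>y. anchor A (Y y) = (y, \<lambda>_. 0)"
      using Y(1) unfolding kernel_section_def by auto
    define Q where "Q y = par (Y y)" for y
    have Qs: "msmooth M UNIV Q" unfolding Q_def by (rule par_section_smooth[OF Ys])
    have Qx: "Q x = (S, - (S *v dev x))" unfolding Q_def Y(2) b(2) ..
    let ?D = "mdiff M Q ?t"
    have Qg: "msmooth M good Q" by (rule msmooth_subset[OF Qs subset_UNIV open_good])
    have Q1: "msmooth M good (\<lambda>y. fst (Q y))" and Q2: "msmooth M good (\<lambda>y. snd (Q y))"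
      by (intro msmooth_bounded_linear[OF bounded_linear_fst Qg] msmooth_bounded_linear[OF bounded_linear_snd Qg])+
    have Qd: "msmooth M good (\<lambda>y. fst (Q y) *v dev y)"
      by (rule msmooth_matrix_vector_mult[OF Q1 dev_smooth])
    have zero: "fst (Q y) *v dev y + snd (Q y) = 0" if "y \<in> good" for y
    proof -
      have "kfield (par (Y y)) (dev y) = 0"
        using dev_fixes[OF that] kernel_section_anchor_kernel[OF Y(1), of y]
        unfolding fixes_pt_par by blast
      then show ?thesis by (simp add: kfield_def Q_def)
    qed
    have "mdiff M (\<lambda>y. fst (Q y) *v dev y + snd (Q y)) ?t = mdiff M (\<lambda>y. 0) ?t"
      by (rule mdiff_cong[OF t msmooth_const[OF open_good] x zero])
    also have "\<dots> = 0" by (rule mdiff_const[OF t])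
    also have "mdiff M (\<lambda>y. fst (Q y) *v dev y + snd (Q y)) ?t =
        mdiff M (\<lambda>y. fst (Q y) *v dev y) ?t + mdiff M (\<lambda>y. snd (Q y)) ?t"
      by (rule mdiff_add[OF t Qd x Q2])
    also have "mdiff M (\<lambda>y. fst (Q y) *v dev y) ?t = fst (Q x) *v ?d + mdiff M (\<lambda>y. fst (Q y)) ?t *v dev x"
      by (rule mdiff_bounded_bilinear[OF t bounded_bilinear_matrix_vector_mult Q1 x dev_smooth])
    also have "mdiff M (\<lambda>y. fst (Q y)) ?t = fst ?D"
      by (rule mdiff_bounded_linear[OF t bounded_linear_fst Qg x])
    also have "mdiff M (\<lambda>y. snd (Q y)) ?t = snd ?D"
      by (rule mdiff_bounded_linear[OF t bounded_linear_snd Qg x])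
    \<comment> \<open>The product rule for Q(f) = 0: the derivative of the point is rotated by
      \<open>S\<close>, and the derivative of the field is evaluated at the point.\<close>
    finally have 1: "S *v ?d + kfield ?D (dev x) = 0"
      by (simp add: Qx kfield_def add.assoc)
    have "bracket A X Y x \<in> anchor_kernel A x"
      by (rule kernel_section_anchor_kernel[OF bracket_kernel_section[OF X(1) Y(1)]])
    then have "kfield (par (bracket A X Y x)) (dev x) = 0"
      using dev_fixes[OF x] unfolding fixes_pt_par by blast
    \<comment> \<open>Of the two derivative terms only the one along the anchor of \<open>X\<close>
      survives, because the anchor of \<open>Y\<close> is zero.\<close>
    moreover have "par (bracket A X Y x) = ?D + kbracket (par a) (Q x)"
      unfolding par_bracket[OF X(1) Ys] Y0 mdiff_zero[OF par_section_smooth[OF X(1)] UNIV_I] X(2) Q_def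
      by simp
    ultimately have "kfield ?D (dev x) + kfield (kbracket (par a) (Q x)) (dev x) = 0"
      by (simp add: linear_add[OF linear_kfield_at])
    moreover have "kfield (Q x) (dev x) = 0" by (simp add: Qx kfield_def)
    \<comment> \<open>Of the bracket evaluated at \<open>dev x\<close> only the term with
      \<open>S\<close> remains, since \<open>Q x\<close> vanishes there. Comparison with the
      differentiated equation gives the claim.\<close>
    ultimately have "kfield ?D (dev x) + S *v \<omega> a (dev x) = 0"
      unfolding kfield_kbracket kfield_par[OF a] by (simp add: Qx)
    then have "kfield ?D (dev x) = - (S *v \<omega> a (dev x))" by (rule eq_neg_iff_add_eq_0[THEN iffD2])
    with 1 show ?thesis unfolding matrix_vector_mult_diff_distrib by simp
  qed
  from skew_annihilates[OF m2 this] show ?thesis by simp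
qed

text \<open>Along a coordinate segment \<open>g = f \<circ> \<gamma>\<close> solves \<open>g' = S g + b\<close> with \<open>S\<close> skew, so it cannot
  blow up, and a limit point of it is fixed by the limit isotropy algebra.\<close>

lemma closed_good: "closed good"
proof -
  have "x \<in> good" if cl: "x \<in> closure good" for x
  proof -
    obtain c where c: "c \<in> M" "x \<in> fst c" using chart_around by blast
    obtain t where t: "t \<in> trivs A" "x \<in> fst t" using triv_around by blast
    note ft = triv_fibrewise[OF t(1)]
    obtain U where U: "open U" "x \<in> U" "U \<subseteq> fst t \<inter> fst c"
      and lift: "\<And>W. msmooth M U W \<Longrightarrow> \<exists>V. msmooth M U V \<and>
        (\<forall>x\<in>U. snd (anchor A (frame A t x (V x))) c = W x \<and> (W x = 0 \<longrightarrow> V x = 0))"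
      using local_anchor_lift[OF t c] by metis
    define q1 where "q1 = snd c x"
    have "q1 \<in> snd c ` (fst c \<inter> U)" using c U unfolding q1_def by blast
    then obtain r where r: "r > 0" "cball q1 r \<subseteq> snd c ` (fst c \<inter> U)"
      using chart_image_open[OF c(1) U(1), unfolded open_contains_cball] by blast
    \<comment> \<open>A ball in coordinates is convex, so the segment from a good point of
      \<open>N\<close> to \<open>x\<close> stays inside the image of \<open>U\<close>.\<close>
    define N where "N = fst c \<inter> snd c -` ball q1 r"
    have "open N" unfolding N_def
      by (rule continuous_open_preimage[OF chart_cont[OF c(1)] chart_open[OF c(1)] open_ball])
    moreover have "x \<in> N" using c r by (simp add: N_def q1_def)
    ultimately obtain y where y: "y \<in> good" "y \<in> N"
      using cl unfolding closure_iff_nhds_not_empty by blast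
    define q0 where "q0 = snd c y"
    define w where "w = q1 - q0"
    define pt where "pt s = q0 + s *\<^sub>R w" for s :: real
    define \<gamma> where "\<gamma> s = chart_inv c (pt s)" for s
    have pt_in: "pt s \<in> cball q1 r" if s: "s \<in> {0..1}" for s
    proof -
      have "pt s - q1 = (1 - s) *\<^sub>R (q0 - q1)" by (simp add: pt_def w_def algebra_simps)
      then have "norm (pt s - q1) = \<bar>1 - s\<bar> * norm (q0 - q1)" by simp
      also have "\<dots> \<le> 1 * r"
        using y(2) s by (intro mult_mono) (auto simp: N_def q0_def dist_norm norm_minus_commute)
      finally show ?thesis by (simp add: dist_norm norm_minus_commute)
    qed
    have \<gamma>: "\<gamma> s \<in> fst c" "\<gamma> s \<in> U" "snd c (\<gamma> s) = pt s" if s: "s \<in> {0..1}" for s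
    proof -
      obtain z where z: "z \<in> fst c" "z \<in> U" "pt s = snd c z" using pt_in[OF s] r(2) by blast
      then have "\<gamma> s = z" unfolding \<gamma>_def using c(1) by simp
      then show "\<gamma> s \<in> fst c" "\<gamma> s \<in> U" "snd c (\<gamma> s) = pt s" using z by simp_all
    qed
    have \<gamma>_cont: "continuous_on {0..1} \<gamma>"
      unfolding \<gamma>_def
    proof (rule continuous_on_compose2[OF chart_inv_cont[OF c(1)]])
      show "continuous_on {0..1} pt" unfolding pt_def by (intro continuous_intros)
      show "pt ` {0..1} \<subseteq> snd c ` fst c" using pt_in r(2) by blast
    qed
    have \<gamma>0: "\<gamma> 0 = y" using y(2) c(1) by (simp add: \<gamma>_def pt_def q0_def N_def)
    have \<gamma>1: "\<gamma> 1 = x" using c by (simp add: \<gamma>_def pt_def w_def q1_def)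
    \<comment> \<open>The constant velocity \<open>w\<close> of the segment is lifted through the
      anchor; by \<open>mdiff_dev\<close> the image of the lift under \<open>\<omega>\<close> is
      then the affine field that drives \<open>g\<close>.\<close>
    obtain V where V: "msmooth M U V"
      and V_anchor: "\<And>z. z \<in> U \<Longrightarrow> snd (anchor A (frame A t z (V z))) c = w"
      using lift[OF msmooth_const[OF U(1), of w]] by blast
    define Z where "Z z = par (frame A t z (V z))" for z
    have Ut: "U \<subseteq> fst t" using U(3) by blast
    have Z: "msmooth M U Z"
      unfolding Z_def
    proof (rule msmooth_frame_apply[OF t(1) Ut _ _ V])
      show "linear (\<lambda>v. par (frame A t z v))" if "z \<in> U" for z
        by (rule linear_par_frame[OF t(1)]) (use that Ut in blast)
      show "msmooth M U (\<lambda>z. par (frame A t z v))" for v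
        by (rule msmooth_subset[OF par_smooth[OF frame_smooth[OF t(1)] triv_open[OF t(1)]] Ut U(1)])
    qed
    have Z\<gamma>: "continuous_on {0..1} (\<lambda>s. Z (\<gamma> s))"
      by (rule continuous_on_compose2[OF msmooth_continuous[OF Z] \<gamma>_cont]) (use \<gamma>(2) in blast)
    define g where "g s = dev (\<gamma> s)" for s
    have deriv: "(g has_vector_derivative kfield (Z (\<gamma> s)) (g s)) (at s)"
      if s: "s \<in> {0..1}" and gd: "\<gamma> s \<in> good" for s
    proof -
      let ?a = "frame A t (\<gamma> s) (V (\<gamma> s))" and ?F = "\<lambda>p. dev (chart_inv c p)"
      let ?D = "frechet_derivative ?F (at (pt s))"
      have a: "?a \<in> fibre A (\<gamma> s)" by (rule frame_in_fibre[OF ft]) (use \<gamma>(2)[OF s] Ut in blast)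
      have F: "(?F has_derivative ?D) (at (pt s))"
        using msmooth_has_derivative[OF dev_smooth gd c(1) \<gamma>(1)[OF s]] unfolding \<gamma>(3)[OF s] .
      have "?D w = mdiff M dev (anchor A ?a)"
        using mdiff_chart[OF anchor_tangent[OF a] c(1) \<gamma>(1)[OF s] dev_smooth gd]
        unfolding \<gamma>(3)[OF s] V_anchor[OF \<gamma>(2)[OF s]] by simp
      also have "\<dots> = kfield (Z (\<gamma> s)) (g s)"
        unfolding mdiff_dev[OF gd a] Z_def g_def kfield_par[OF a] ..
      finally have Dw: "?D w = kfield (Z (\<gamma> s)) (g s)" .
      have "(pt has_derivative (\<lambda>h. h *\<^sub>R w)) (at s)"
        unfolding pt_def by (auto intro!: derivative_eq_intros)
      from diff_chain_at[OF this F] have "(g has_derivative (\<lambda>h. ?D (h *\<^sub>R w))) (at s)"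
        unfolding g_def \<gamma>_def by (simp add: o_def)
      then show ?thesis
        unfolding has_vector_derivative_def
        by (rule has_derivative_eq_rhs)
          (simp add: fun_eq_iff linear_cmul[OF has_derivative_linear[OF F]] Dw)
    qed
    have "bounded ((\<lambda>s. Z (\<gamma> s)) ` {0..1})"
      by (intro compact_imp_bounded compact_continuous_image Z\<gamma> compact_Icc)
    then obtain C where C: "\<And>s. s \<in> {0..1} \<Longrightarrow> norm (Z (\<gamma> s)) \<le> C"
      unfolding bounded_iff by blast
    have C0: "C \<ge> 0" by (rule order_trans[OF norm_ge_zero C[of 0]]) simp
    \<comment> \<open>The bad parameters on the segment. They form a compact set, so if there were
      any there would be a first one, with the differential equation valid strictly before
      it.\<close>
    define B where "B = {0..1} \<inter> \<gamma> -` (- good)"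
    have "closed B"
      unfolding B_def using open_good
      by (intro continuous_closed_preimage[OF \<gamma>_cont]) auto
    then have "compact B"
      using compact_Int_closed[OF compact_Icc[of "0::real" 1], of B] unfolding B_def by (simp add: Int_absorb1)
    have "B = {}"
    proof (rule ccontr)
      assume "B \<noteq> {}"
      then obtain s1 where s1: "s1 \<in> B" "\<And>s. s \<in> B \<Longrightarrow> s1 \<le> s"
        using compact_attains_inf[OF \<open>compact B\<close>] by blast
      have s1_01: "s1 \<in> {0..1}" and s1_bad: "\<gamma> s1 \<notin> good" using s1(1) unfolding B_def by auto
      have "s1 \<noteq> 0" using s1_bad \<gamma>0 y(1) by auto
      then have s1_pos: "s1 > 0" using s1_01 by simp
      have before: "\<gamma> s \<in> good" "s \<in> {0..1}" if "0 \<le> s" "s < s1" for s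
        using s1(2)[of s] that s1_01 unfolding B_def by force+
      define R where "R = sqrt (1 + g 0 \<bullet> g 0) + C"
      have bound: "norm (g s) \<le> R" if s: "0 \<le> s" "s < s1" for s
      proof -
        \<comment> \<open>sqrt(1 + |g|^2) replaces the norm because it is differentiable also where
          \<open>g\<close> vanishes. Skewness removes the linear part of the field from its
          derivative, which is therefore at most \<open>C\<close>, a bound on the translation
          parts.\<close>
        let ?\<rho> = "\<lambda>s. sqrt (1 + g s \<bullet> g s)"
        have "?\<rho> s - C * s \<le> ?\<rho> 0 - C * 0"
        proof (rule DERIV_nonpos_imp_nonincreasing[OF s(1)])
          fix u assume u: "0 \<le> u" "u \<le> s"
          then have u1: "\<gamma> u \<in> good" "u \<in> {0..1}" using before s by auto
          let ?k = "kfield (Z (\<gamma> u)) (g u)"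
          have pos: "1 + g u \<bullet> g u > 0" by (simp add: add_pos_nonneg)
          have gd: "(g has_derivative (\<lambda>h. h *\<^sub>R ?k)) (at u)"
            using deriv[OF u1(2,1)] unfolding has_vector_derivative_def .
          have "((\<lambda>s. g s \<bullet> g s) has_real_derivative 2 * (g u \<bullet> ?k)) (at u)"
            unfolding has_field_derivative_def
            by (rule has_derivative_eq_rhs[OF has_derivative_inner[OF gd gd]])
              (simp add: fun_eq_iff inner_commute)
          then have "((\<lambda>s. 1 + g s \<bullet> g s) has_real_derivative 2 * (g u \<bullet> ?k)) (at u)"
            by (auto intro!: derivative_eq_intros)
          from DERIV_chain2[OF DERIV_real_sqrt[OF pos] this]
          have "(?\<rho> has_real_derivative inverse (?\<rho> u) / 2 * (2 * (g u \<bullet> ?k))) (at u)" .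
          then have D: "((\<lambda>s. ?\<rho> s - C * s) has_real_derivative
              inverse (?\<rho> u) / 2 * (2 * (g u \<bullet> ?k)) - C * 1) (at u)"
            by (intro DERIV_diff DERIV_cmult DERIV_ident)
          have "fst (Z (\<gamma> u)) \<in> skew"
          proof -
            have "\<gamma> u \<in> fst t" using \<gamma>(2)[OF u1(2)] Ut by blast
            then have "Z (\<gamma> u) \<in> kspace" unfolding Z_def by (rule par_kspace[OF frame_in_fibre[OF ft]])
            then show ?thesis by (auto simp: kspace_def)
          qed
          then have "g u \<bullet> ?k = g u \<bullet> snd (Z (\<gamma> u))"
            by (simp add: kfield_def inner_add_right skew_quadratic)
          also have "\<dots> \<le> norm (g u) * norm (snd (Z (\<gamma> u)))" by (rule norm_cauchy_schwarz)
          also have "\<dots> \<le> ?\<rho> u * C"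
          proof (intro mult_mono)
            show "norm (g u) \<le> ?\<rho> u" unfolding norm_eq_sqrt_inner by simp
            show "norm (snd (Z (\<gamma> u))) \<le> C"
              using C[OF u1(2)] norm_snd_le[of "snd (Z (\<gamma> u))" "fst (Z (\<gamma> u))"] by simp
          qed (use pos in auto)
          finally have le: "g u \<bullet> ?k \<le> ?\<rho> u * C" .
          have "?\<rho> u > 0" using pos by simp
          then have "inverse (?\<rho> u) / 2 * (2 * (g u \<bullet> ?k)) - C * 1 \<le> 0"
            using le by (simp add: field_simps)
          then show "\<exists>y. ((\<lambda>s. ?\<rho> s - C * s) has_real_derivative y) (at u) \<and> y \<le> 0"
            using D by blast
        qed
        then have "?\<rho> s \<le> ?\<rho> 0 + C * s" by simp
        also have "\<dots> \<le> R"
          unfolding R_def using C0 mult_left_mono[of s 1 C] s s1_01 by simp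
        finally have "?\<rho> s \<le> R" .
        moreover have "norm (g s) \<le> ?\<rho> s" unfolding norm_eq_sqrt_inner by simp
        ultimately show ?thesis by linarith
      qed
      \<comment> \<open>Parameters approaching the first bad one from below, starting at 0 so that
        all of them lie in the interval where the bound holds.\<close>
      define \<sigma> where "\<sigma> n = s1 - s1 * inverse (real (Suc n))" for n
      have \<sigma>: "0 \<le> \<sigma> n" "\<sigma> n < s1" for n
      proof -
        have "inverse (real (Suc n)) \<le> 1" "inverse (real (Suc n)) > 0" by (auto simp: field_simps)
        then show "0 \<le> \<sigma> n" "\<sigma> n < s1"
          using s1_pos mult_left_mono[of "inverse (real (Suc n))" 1 s1] unfolding \<sigma>_def by auto
      qed
      have \<sigma>_lim: "\<sigma> \<longlonglongrightarrow> s1"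
      proof -
        have "\<sigma> \<longlonglongrightarrow> s1 - s1 * 0"
          unfolding \<sigma>_def by (intro tendsto_intros LIMSEQ_inverse_real_of_nat)
        then show ?thesis by simp
      qed
      have "\<forall>n. g (\<sigma> n) \<in> cball 0 R" using bound[OF \<sigma>] by simp
      then have "\<exists>l\<in>cball 0 R. \<exists>r. strict_mono r \<and> ((\<lambda>n. g (\<sigma> n)) \<circ> r) \<longlonglongrightarrow> l"
        by (rule compact_cball[of "0 :: real^'m" R, unfolded compact_def, THEN spec, THEN mp])
      then obtain p \<tau> where \<tau>: "strict_mono \<tau>" "((\<lambda>n. g (\<sigma> n)) \<circ> \<tau>) \<longlonglongrightarrow> p" by blast
      have \<sigma>\<tau>: "(\<lambda>n. \<sigma> (\<tau> n)) \<longlonglongrightarrow> s1"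
        using LIMSEQ_subseq_LIMSEQ[OF \<sigma>_lim \<tau>(1)] by (simp add: o_def)
      have "fixes_pt (\<gamma> s1) p"
        unfolding fixes_pt_par
      proof
        fix P assume "P \<in> par ` anchor_kernel A (\<gamma> s1)"
        then obtain a where a: "a \<in> anchor_kernel A (\<gamma> s1)" "P = par a" by blast
        obtain Y where Y: "kernel_section Y" "Y (\<gamma> s1) = a" using kernel_section_through[OF a(1)] by metis
        have Ys: "Y \<in> sections M A" using Y(1) unfolding kernel_section_def by blast
        define h where "h s = par (Y (\<gamma> s))" for s
        have "continuous_on {0..1} h"
          unfolding h_def
          by (rule continuous_on_compose2[OF msmooth_continuous[OF par_section_smooth[OF Ys]] \<gamma>_cont]) simp
        then have h_lim: "(\<lambda>n. h (\<sigma> (\<tau> n))) \<longlonglongrightarrow> h s1"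
          by (rule continuous_on_tendsto_compose[OF _ \<sigma>\<tau> s1_01])
            (use before(2)[OF \<sigma>] in simp)
        \<comment> \<open>The fixed point equation is continuous in both the field and the point.
          The field converges along the whole segment, the point along a subsequence by boundedness,
          so the limit point is fixed at \<open>s1\<close>.\<close>
        have "(\<lambda>n. fst (h (\<sigma> (\<tau> n))) *v g (\<sigma> (\<tau> n)) + snd (h (\<sigma> (\<tau> n)))) \<longlonglongrightarrow> fst (h s1) *v p + snd (h s1)"
          using \<tau>(2) by (intro tendsto_add bounded_bilinear.tendsto[OF bounded_bilinear_matrix_vector_mult]
              tendsto_fst tendsto_snd h_lim) (simp add: o_def)
        moreover have "fst (h (\<sigma> n)) *v g (\<sigma> n) + snd (h (\<sigma> n)) = 0" for n
        proof -
          have "kfield (par (Y (\<gamma> (\<sigma> n)))) (dev (\<gamma> (\<sigma> n))) = 0"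
            using dev_fixes[OF before(1)[OF \<sigma>]] kernel_section_anchor_kernel[OF Y(1)]
            unfolding fixes_pt_par by blast
          then show ?thesis by (simp add: kfield_def h_def g_def)
        qed
        ultimately have "(\<lambda>n. 0) \<longlonglongrightarrow> fst (h s1) *v p + snd (h s1)" by simp
        from LIMSEQ_unique[OF this tendsto_const] show "kfield P p = 0"
          by (simp add: kfield_def h_def Y(2) a(2))
      qed
      then show False using s1_bad unfolding good_def by blast
    qed
    then have "1 \<notin> B" by simp
    then show ?thesis using \<gamma>1 unfolding B_def by simp
  qed
  then have "closure good \<subseteq> good" by blast
  then show ?thesis by (simp add: closure_subset_eq)
qed

lemma good_UNIV: "good = UNIV"
  using conn[unfolded connected_clopen] open_good closed_good base_good by auto

end

section \<open>The isomorphism\<close>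

text \<open>The library has this only for subsets of normed spaces.\<close>

lemma connected_if_simply_connected:
  fixes S :: "'a::topological_space set"
  assumes "simply_connected S"
  shows "connected S"
proof (rule path_connected_imp_connected)
  have "path_component S x y" if xy: "x \<in> S" "y \<in> S" for x y
  proof -
    \<comment> \<open>Constant loops at \<open>x\<close> and \<open>y\<close> are freely homotopic,
      and the track of the base point under the homotopy is a path between them.\<close>
    have "homotopic_loops S (\<lambda>_. x) (\<lambda>_. y)"
      by (rule assms[unfolded simply_connected_def, THEN spec, THEN spec, THEN mp])
        (use xy in \<open>auto simp: path_def pathstart_def pathfinish_def path_image_def\<close>)
    from homotopic_loops_imp_path_component_value[OF this, of 0] show ?thesis by simp
  qed
  then show "path_connected S" by (simp add: path_connected_component)
qed

lemma smooth_map_cong: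
  assumes f: "smooth_map C D f" and inj: "\<And>c. c \<in> C \<Longrightarrow> inj_on (snd c) (fst c)"
    and eq: "\<And>c x. c \<in> C \<Longrightarrow> x \<in> fst c \<Longrightarrow> g x = f x"
  shows "smooth_map C D g"
  unfolding smooth_map_def
proof (intro conjI ballI)
  have "g ` (\<Union>c\<in>C. fst c) = f ` (\<Union>c\<in>C. fst c)" using eq by (intro image_cong refl) blast
  then show "g ` (\<Union>c\<in>C. fst c) \<subseteq> (\<Union>d\<in>D. fst d)"
    using conjunct1[OF f[unfolded smooth_map_def]] by simp
  fix c d assume c: "c \<in> C" and d: "d \<in> D"
  have "smooth_on (snd c ` (fst c \<inter> f -` fst d)) (snd d \<circ> f \<circ> chart_inv c)"
    using f c d unfolding smooth_map_def by simp
  moreover have "fst c \<inter> f -` fst d = fst c \<inter> g -` fst d" using eq[OF c] by auto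
  ultimately have "smooth_on (snd c ` (fst c \<inter> g -` fst d)) (snd d \<circ> f \<circ> chart_inv c)" by simp
  then show "smooth_on (snd c ` (fst c \<inter> g -` fst d)) (snd d \<circ> g \<circ> chart_inv c)"
  proof (rule iffD1[OF smooth_on_cong, rotated])
    fix p assume "p \<in> snd c ` (fst c \<inter> g -` fst d)"
    then obtain x where "x \<in> fst c" "p = snd c x" by blast
    then show "(snd d \<circ> f \<circ> chart_inv c) p = (snd d \<circ> g \<circ> chart_inv c) p"
      using eq[OF c] inj[OF c] by simp
  qed
qed

section \<open>The immersion property and the fibres of the hypersurface algebroid\<close>

context killing_algebroid
begin

lemma killing_map_smooth:
  assumes F: "smooth_into_killing (restrict_charts U M) F" and U: "open U"
  shows "msmooth M U (\<lambda>x. kpar (F x :: real^'m \<Rightarrow> real^'m))"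
proof (rule msmooth_componentwise[OF U])
  fix b :: "(real^'m^'m) \<times> (real^'m)"
  have "smooth_map (restrict_charts U M) euclidean_charts (\<lambda>x. kpar (F x) \<bullet> b)"
    using kpar_functional by (rule F[unfolded smooth_into_killing_def, THEN conjunct2, THEN spec, THEN mp])
  then show "msmooth M U (\<lambda>x. kpar (F x) \<bullet> b)" unfolding smooth_map_restrict_iff[OF U] .
qed

lemma dev_smooth_UNIV: "msmooth M UNIV dev"
  using dev_smooth unfolding good_UNIV .

lemma mdiff_anchor: "a \<in> fibre A x \<Longrightarrow> mdiff M dev (anchor A a) = \<omega> a (dev x)"
  by (rule mdiff_dev) (simp_all add: good_UNIV)

lemma par_kernel_isotropy: "par ` anchor_kernel A x = isotropy (dev x)"
  by (rule fixes_pt_isotropy[OF dev_fixes]) (simp add: good_UNIV)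

text \<open>The image of the kernel is the whole isotropy algebra of \<open>dev x\<close>, not
  merely a part of it. Injectivity of the differential and surjectivity onto the fibres of A_f both
  rest on this.\<close>

lemma killing_vanishing:
  assumes "Z \<in> killing_fields" "Z (dev x) = 0"
  obtains a where "a \<in> anchor_kernel A x" "Z = \<omega> a"
proof -
  have "Z \<in> kfield ` kspace" using assms(1) by (simp only: killing_eq)
  then obtain P where P: "P \<in> kspace" "Z = kfield P" by blast
  then have "P \<in> isotropy (dev x)" using assms(2) by (simp add: isotropy_def)
  then obtain a where a: "a \<in> anchor_kernel A x" "P = par a"
    unfolding par_kernel_isotropy[symmetric] by blast
  then have "a \<in> fibre A x" unfolding anchor_kernel_def by blast
  from kfield_par[OF this] a P show ?thesis by (intro that[OF a(1)]) simp
qed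

lemma \<omega>_diff:
  assumes "a \<in> fibre A x" "b \<in> fibre A x"
  shows "\<omega> (fadd A a (fscale A (-1) b)) = (\<lambda>y. \<omega> a y - \<omega> b y)"
  using \<omega>_add[OF assms(1) fscale_fibre[OF assms(2)]] \<omega>_scale[OF assms(2), of "-1"] by simp

text \<open>Lift two tangent vectors with equal image through the anchor and let \<open>d\<close> be
  the difference of the lifts. Its image under \<open>\<omega>\<close> vanishes at
  \<open>dev x\<close>, hence comes from the kernel; injectivity of \<open>\<omega>\<close> puts
  \<open>d\<close> itself in the kernel.\<close>

lemma mdiff_dev_inj: "inj_on (mdiff M dev) (tangent_space M x)"
proof (rule inj_onI)
  fix s t assume st: "s \<in> tangent_space M x" "t \<in> tangent_space M x" "mdiff M dev s = mdiff M dev t"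
  have "s \<in> anchor A ` fibre A x" "t \<in> anchor A ` fibre A x" using st by (simp_all only: anchor_surj)
  then obtain a b where a: "a \<in> fibre A x" "s = anchor A a" and b: "b \<in> fibre A x" "t = anchor A b"
    by blast
  define d where "d = fadd A a (fscale A (-1) b)"
  have d: "d \<in> fibre A x" unfolding d_def by (intro fadd_fibre fscale_fibre a b)
  have "\<omega> d (dev x) = 0"
    unfolding d_def \<omega>_diff[OF a(1) b(1)] using st(3) mdiff_anchor[OF a(1)] mdiff_anchor[OF b(1)]
    by (simp add: a(2) b(2))
  then obtain e where e: "e \<in> anchor_kernel A x" "\<omega> d = \<omega> e"
    using killing_vanishing[OF \<omega>_killing[OF d]] by metis
  then have "d = e" using inj_onD[OF \<omega>_inj e(2) d] unfolding anchor_kernel_def by blast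
  then have d0: "anchor A d = (x, \<lambda>_. 0)" using e(1) unfolding anchor_kernel_def by blast
  obtain c where c: "c \<in> M" "x \<in> fst c" using chart_around by blast
  have "snd (anchor A d) c = snd s c - snd t c"
    unfolding d_def anchor_add[OF a(1) fscale_fibre[OF b(1)]] anchor_scale[OF b(1)] by (simp add: a b)
  then have "snd s c = snd t c" using d0 by simp
  then show "s = t" by (rule tangent_eqI[OF st(1,2) c])
qed

lemma immersion_dev: "immersion M dev"
  unfolding immersion_def smooth_map_iff using dev_smooth_UNIV mdiff_dev_inj by blast

abbreviation B :: "('a, (real^'m \<Rightarrow> real^'m) \<times> 'a, 'k, 'n) algebroid" where
  "B \<equiv> hypersurface_algebroid M dev"

definition \<Phi> :: "'b \<Rightarrow> (real^'m \<Rightarrow> real^'m) \<times> 'a" where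
  "\<Phi> a = (\<omega> a, proj A a)"

lemma B_simps [simp]:
  "tot_space B = hyp_tot_space M dev" "proj B = snd"
  "fadd B = (\<lambda>a b. (\<lambda>y. fst a y + fst b y, snd a))"
  "fscale B = (\<lambda>r a. (\<lambda>y. r *\<^sub>R fst a y, snd a))"
  "trivs B = hyp_trivs M dev" "anchor B = hyp_anchor M dev"
  by (simp_all add: hypersurface_algebroid_def hyp_bundle_def vbundle.defs algebroid.defs)

lemma B_bracket:
  "bracket B S T x = (\<lambda>y. flat_conn M (hyp_anchor M dev (S x)) (\<lambda>x. fst (T x)) y
      - flat_conn M (hyp_anchor M dev (T x)) (\<lambda>x. fst (S x)) y
      + jl_bracket (fst (S x)) (fst (T x)) y, x)"
  by (simp add: hypersurface_algebroid_def hyp_bundle_def vbundle.defs algebroid.defs)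

lemma \<Phi>_fibre:
  assumes "a \<in> fibre A x"
  shows "\<Phi> a = (\<omega> a, x)"
  unfolding \<Phi>_def fibreD(2)[OF assms] ..

text \<open>A Killing field tangent to f at \<open>x\<close> has the same value at f(x) as some
  \<open>\<omega> a\<close>. The difference vanishes there and is supplied by the kernel of the
  anchor.\<close>

lemma fibre_B: "fibre B x = \<Phi> ` fibre A x"
proof (intro equalityI subsetI)
  fix e assume "e \<in> fibre B x"
  then obtain Z where e: "e = (Z, x)" "Z \<in> killing_fields" "Z (dev x) \<in> mdiff M dev ` tangent_space M x"
    unfolding fibre_def B_simps hyp_tot_space_def by auto
  then obtain t where t: "t \<in> tangent_space M x" "Z (dev x) = mdiff M dev t" by blast
  then have "t \<in> anchor A ` fibre A x" by (simp only: anchor_surj)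
  then obtain a where a: "a \<in> fibre A x" "t = anchor A a" by blast
  have "(\<lambda>y. Z y - \<omega> a y) \<in> killing_fields"
  proof -
    have "Z \<in> kfield ` kspace" using e(2) by (simp only: killing_eq)
    then obtain P where P: "P \<in> kspace" "Z = kfield P" by blast
    have "(\<lambda>y. Z y - \<omega> a y) = kfield (P - par a)"
      unfolding P(2) kfield_par[OF a(1), symmetric] by (rule ext) (simp add: linear_diff[OF linear_kfield_at])
    moreover have "P - par a \<in> kspace" by (rule subspace_diff[OF subspace_kspace P(1) par_kspace[OF a(1)]])
    ultimately show ?thesis by (simp add: kfield_killing)
  qed
  moreover have "Z (dev x) - \<omega> a (dev x) = 0" using t(2) mdiff_anchor[OF a(1)] a(2) by simp
  ultimately obtain b where b: "b \<in> anchor_kernel A x" "(\<lambda>y. Z y - \<omega> a y) = \<omega> b"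
    using killing_vanishing[of "\<lambda>y. Z y - \<omega> a y" x] by metis
  then have bf: "b \<in> fibre A x" unfolding anchor_kernel_def by blast
  have f: "fadd A a b \<in> fibre A x" by (rule fadd_fibre[OF a(1) bf])
  have "\<omega> (fadd A a b) = Z" unfolding \<omega>_add[OF a(1) bf] b(2)[symmetric] by simp
  then have "e = \<Phi> (fadd A a b)" unfolding \<Phi>_fibre[OF f] e(1) by simp
  then show "e \<in> \<Phi> ` fibre A x" using f by (rule image_eqI)
next
  fix e assume "e \<in> \<Phi> ` fibre A x"
  then obtain a where a: "a \<in> fibre A x" "e = \<Phi> a" by blast
  then have "\<omega> a (dev x) = mdiff M dev (anchor A a)" using mdiff_anchor by simp
  then show "e \<in> fibre B x"
    using \<omega>_killing[OF a(1)] anchor_tangent[OF a(1)]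
    unfolding fibre_def B_simps hyp_tot_space_def a(2) \<Phi>_fibre[OF a(1)] by auto
qed

lemma \<Phi>_in: "a \<in> fibre A x \<Longrightarrow> \<Phi> a \<in> fibre B x"
  unfolding fibre_B by (rule imageI)

lemma tot_fibre: "a \<in> tot_space E \<longleftrightarrow> (\<exists>x. a \<in> fibre E x)"
  unfolding fibre_def by blast

lemma \<Phi>_inj: "inj_on \<Phi> (tot_space A)"
proof (rule inj_onI)
  fix a b assume "a \<in> tot_space A" "b \<in> tot_space A" and eq: "\<Phi> a = \<Phi> b"
  then obtain x y where xy: "a \<in> fibre A x" "b \<in> fibre A y" unfolding tot_fibre by blast
  then have "\<omega> a = \<omega> b" "x = y" using eq \<Phi>_fibre[OF xy(1)] \<Phi>_fibre[OF xy(2)] by simp_all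
  then show "a = b" using inj_onD[OF \<omega>_inj] xy by blast
qed

lemma \<Phi>_bij: "bij_betw \<Phi> (tot_space A) (tot_space B)"
proof -
  have "tot_space B = (\<Union>x. fibre B x)" using tot_fibre[of _ B] by blast
  also have "\<dots> = \<Phi> ` (\<Union>x. fibre A x)" unfolding fibre_B by blast
  also have "(\<Union>x. fibre A x) = tot_space A" using tot_fibre[of _ A] by blast
  finally show ?thesis unfolding bij_betw_def using \<Phi>_inj by simp
qed

definition \<Psi> :: "(real^'m \<Rightarrow> real^'m) \<times> 'a \<Rightarrow> 'b" where
  "\<Psi> = inv_into (tot_space A) \<Phi>"

lemma \<Psi>_\<Phi> [simp]: "a \<in> fibre A x \<Longrightarrow> \<Psi> (\<Phi> a) = a"
  unfolding \<Psi>_def by (rule inv_into_f_f[OF \<Phi>_inj fibreD(1)])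

lemma
  assumes "e \<in> fibre B x"
  shows \<Psi>_in: "\<Psi> e \<in> fibre A x" and \<Phi>_\<Psi>: "\<Phi> (\<Psi> e) = e"
  using assms unfolding fibre_B by auto

lemma \<Phi>_add: "a \<in> fibre A x \<Longrightarrow> b \<in> fibre A x \<Longrightarrow> \<Phi> (fadd A a b) = fadd B (\<Phi> a) (\<Phi> b)"
  by (simp add: \<Phi>_fibre[of _ x] fadd_fibre \<omega>_add)

lemma \<Phi>_scale: "a \<in> fibre A x \<Longrightarrow> \<Phi> (fscale A r a) = fscale B r (\<Phi> a)"
  by (simp add: \<Phi>_fibre[of _ x] fscale_fibre \<omega>_scale)

lemma B_fadd_fibre:
  assumes "e \<in> fibre B x" "e' \<in> fibre B x"
  shows "fadd B e e' \<in> fibre B x"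
  using \<Phi>_in[OF fadd_fibre[OF \<Psi>_in[OF assms(1)] \<Psi>_in[OF assms(2)]]]
  unfolding \<Phi>_add[OF \<Psi>_in[OF assms(1)] \<Psi>_in[OF assms(2)]] \<Phi>_\<Psi>[OF assms(1)] \<Phi>_\<Psi>[OF assms(2)] .

lemma B_fscale_fibre:
  assumes "e \<in> fibre B x"
  shows "fscale B r e \<in> fibre B x"
  using \<Phi>_in[OF fscale_fibre[OF \<Psi>_in[OF assms]]]
  unfolding \<Phi>_scale[OF \<Psi>_in[OF assms]] \<Phi>_\<Psi>[OF assms] .

lemma \<Psi>_add:
  assumes "e \<in> fibre B x" "e' \<in> fibre B x"
  shows "\<Psi> (fadd B e e') = fadd A (\<Psi> e) (\<Psi> e')"
proof -
  note p = \<Psi>_in[OF assms(1)] \<Psi>_in[OF assms(2)]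
  have "fadd B e e' = \<Phi> (fadd A (\<Psi> e) (\<Psi> e'))"
    unfolding \<Phi>_add[OF p] \<Phi>_\<Psi>[OF assms(1)] \<Phi>_\<Psi>[OF assms(2)] ..
  then show ?thesis using \<Psi>_\<Phi>[OF fadd_fibre[OF p]] by simp
qed

lemma \<Psi>_scale:
  assumes "e \<in> fibre B x"
  shows "\<Psi> (fscale B r e) = fscale A r (\<Psi> e)"
proof -
  have "fscale B r e = \<Phi> (fscale A r (\<Psi> e))"
    unfolding \<Phi>_scale[OF \<Psi>_in[OF assms]] \<Phi>_\<Psi>[OF assms] ..
  then show ?thesis using \<Psi>_\<Phi>[OF fscale_fibre[OF \<Psi>_in[OF assms]]] by simp
qed

section \<open>Trivialisations of the hypersurface bundle\<close>

lemma fibre_hyp_bundle: "fibre (hyp_bundle M dev {} :: ('a, _, 'k) vbundle) x = fibre B x"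
  by (simp add: fibre_def hyp_bundle_def)

lemma fibrewise_triv_hyp: "fibrewise_triv (hyp_bundle M dev {}) t \<longleftrightarrow> fibrewise_triv B t"
  unfolding fibrewise_triv_def fibre_hyp_bundle by (simp add: hyp_bundle_def)

text \<open>The definition of \<open>hyp_trivs\<close> refers to the bundle with an empty set of
  trivialisations, to avoid circularity. Fibres and operations do not depend on that set, so the
  condition can be read in \<open>B\<close> itself.\<close>

lemma hyp_trivs_iff:
  "t \<in> trivs B \<longleftrightarrow> open (fst t) \<and> fibrewise_triv B t \<and>
    (\<forall>v. smooth_into_killing (restrict_charts (fst t) M) (\<lambda>x. fst (frame B t x v)))"
  unfolding B_simps hyp_trivs_def frame_def fibre_hyp_bundle fibrewise_triv_hyp by simp

definition push :: "'a set \<times> ('b \<Rightarrow> real^'k) \<Rightarrow> 'a set \<times> ((real^'m \<Rightarrow> real^'m) \<times> 'a \<Rightarrow> real^'k)" where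
  "push t = (fst t, \<lambda>e. snd t (\<Psi> e))"

lemma push_fibrewise:
  assumes t: "t \<in> trivs A"
  shows "fibrewise_triv B (push t)"
  unfolding fibrewise_triv_def
proof (intro ballI conjI allI)
  fix x assume "x \<in> fst (push t)"
  then have x: "x \<in> fst t" by (simp add: push_def)
  note ft = triv_fibrewise[OF t]
  show "bij_betw (snd (push t)) (fibre B x) UNIV"
  proof (rule bij_betwI[where g="\<lambda>v. \<Phi> (frame A t x v)"])
    show "(\<lambda>v. \<Phi> (frame A t x v)) \<in> UNIV \<rightarrow> fibre B x"
      using \<Phi>_in[OF frame_in_fibre[OF ft x]] by simp
    show "\<Phi> (frame A t x (snd (push t) e)) = e" if "e \<in> fibre B x" for e
      using frame_triv[OF ft x \<Psi>_in[OF that]] \<Phi>_\<Psi>[OF that] by (simp add: push_def)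
    show "snd (push t) (\<Phi> (frame A t x v)) = v" for v
      using \<Psi>_\<Phi>[OF frame_in_fibre[OF ft x]] triv_frame[OF ft x] by (simp add: push_def)
  qed simp
  fix e assume e: "e \<in> fibre B x"
  show "snd (push t) (fadd B e e') = snd (push t) e + snd (push t) e'" if "e' \<in> fibre B x" for e'
    unfolding push_def snd_conv \<Psi>_add[OF e that] by (rule triv_add[OF ft x \<Psi>_in[OF e] \<Psi>_in[OF that]])
  show "snd (push t) (fscale B r e) = r *\<^sub>R snd (push t) e" for r
    unfolding push_def snd_conv \<Psi>_scale[OF e] by (rule triv_scale[OF ft x \<Psi>_in[OF e]])
qed

lemma frame_push:
  assumes t: "t \<in> trivs A" and x: "x \<in> fst t"
  shows "frame B (push t) x v = \<Phi> (frame A t x v)"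
proof -
  have x': "x \<in> fst (push t)" using x by (simp add: push_def)
  note f = frame_in_fibre[OF triv_fibrewise[OF t] x]
  show ?thesis
    by (rule triv_eqI[OF push_fibrewise[OF t] x' frame_in_fibre[OF push_fibrewise[OF t] x'] \<Phi>_in[OF f]])
      (simp add: triv_frame[OF push_fibrewise[OF t] x'], simp add: push_def \<Psi>_\<Phi>[OF f] triv_frame[OF triv_fibrewise[OF t] x])
qed

text \<open>A trivialisation of \<open>A\<close> carried over by \<open>\<Phi>\<close> has as frames
  the images of frames under \<open>\<omega>\<close>, which are smooth because
  \<open>\<omega>\<close> is. In particular trivialisations of the right rank exist around every
  point.\<close>

lemma push_triv:
  assumes t: "t \<in> trivs A"
  shows "push t \<in> trivs B"
  unfolding hyp_trivs_iff
proof (intro conjI allI push_fibrewise[OF t])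
  have [simp]: "fst (push t) = fst t" by (simp add: push_def)
  note op = triv_open[OF t]
  show "open (fst (push t))" using op by simp
  fix v
  have fst_frame: "fst (frame B (push t) x v) = \<omega> (frame A t x v)" if "x \<in> fst t" for x
    unfolding frame_push[OF t that] \<Phi>_def by simp
  show "smooth_into_killing (restrict_charts (fst (push t)) M) (\<lambda>x. fst (frame B (push t) x v))"
    unfolding smooth_into_killing_def
  proof (intro conjI allI impI)
    show "(\<lambda>x. fst (frame B (push t) x v)) ` (\<Union>c\<in>restrict_charts (fst (push t)) M. fst c) \<subseteq> killing_fields"
    proof
      fix Z assume "Z \<in> (\<lambda>x. fst (frame B (push t) x v)) ` (\<Union>c\<in>restrict_charts (fst (push t)) M. fst c)"
      then obtain x where x: "x \<in> fst t" "Z = fst (frame B (push t) x v)"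
        unfolding restrict_charts_def by auto
      then show "Z \<in> killing_fields"
        using \<omega>_killing[OF frame_in_fibre[OF triv_fibrewise[OF t] x(1)]] fst_frame[OF x(1)] by simp
    qed
    fix l :: "(real^'m \<Rightarrow> real^'m) \<Rightarrow> real" assume "killing_functional l"
    then have "smooth_map (bundle_charts M A) euclidean_charts (\<lambda>a. l (\<omega> a))"
      using \<omega>_smooth unfolding smooth_into_killing_def by simp
    from smooth_map_comp[OF frame_smooth[OF t] this] restrict_charts_inj A_charts_inj
    have "msmooth M (fst t) (\<lambda>x. l (\<omega> (frame A t x v)))"
      unfolding smooth_map_restrict_iff[OF op] by simp
    then have "msmooth M (fst t) (\<lambda>x. l (fst (frame B (push t) x v)))"
      by (rule iffD1[OF msmooth_cong, rotated]) (simp add: fst_frame)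
    then show "smooth_map (restrict_charts (fst (push t)) M) euclidean_charts (\<lambda>x. l (fst (frame B (push t) x v)))"
      by (simp add: smooth_map_restrict_iff[OF op])
  qed
qed

text \<open>Injectivity in the coordinate vector is what makes the Gram matrix of a frame invertible
  in \<open>B_transition\<close>.\<close>

lemma kpar_fst_linear:
  assumes s: "fibrewise_triv B s" "x \<in> fst s"
  shows "linear (\<lambda>z. kpar (fst (frame B s x z)))"
    and "kpar (fst (frame B s x z)) = 0 \<Longrightarrow> z = 0"
proof -
  note f = frame_in_fibre[OF s]
  have kp: "kfield (kpar (fst e)) = fst e" if "e \<in> fibre B x" for e
  proof -
    have "fst e = \<omega> (\<Psi> e)" using \<Phi>_\<Psi>[OF that] by (metis \<Phi>_def fst_conv)
    then show ?thesis using kfield_par[OF \<Psi>_in[OF that]] by (simp add: par_def)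
  qed
  have add: "frame B s x (v + w) = fadd B (frame B s x v) (frame B s x w)" for v w
    by (rule triv_eqI[OF s f B_fadd_fibre[OF f f]])
      (simp only: triv_add[OF s f f] triv_frame[OF s])
  have scale: "frame B s x (r *\<^sub>R v) = fscale B r (frame B s x v)" for r v
    by (rule triv_eqI[OF s f B_fscale_fibre[OF f]])
      (simp only: triv_scale[OF s f] triv_frame[OF s])
  show lin: "linear (\<lambda>z. kpar (fst (frame B s x z)))"
  proof (rule linearI)
    fix v w :: "real^'k" and r :: real
    have "fst (frame B s x (v + w)) = kfield (kpar (fst (frame B s x v)) + kpar (fst (frame B s x w)))"
      unfolding add kfield_add kp[OF f] by simp
    then show "kpar (fst (frame B s x (v + w))) = kpar (fst (frame B s x v)) + kpar (fst (frame B s x w))"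
      by simp
    have "fst (frame B s x (r *\<^sub>R v)) = kfield (r *\<^sub>R kpar (fst (frame B s x v)))"
      unfolding scale kfield_scaleR kp[OF f] by simp
    then show "kpar (fst (frame B s x (r *\<^sub>R v))) = r *\<^sub>R kpar (fst (frame B s x v))" by simp
  qed
  show "z = 0" if z: "kpar (fst (frame B s x z)) = 0"
  proof -
    have "kpar (fst (frame B s x z)) = kpar (fst (frame B s x 0))"
      using z linear_0[OF lin] by simp
    then have "kfield (kpar (fst (frame B s x z))) = kfield (kpar (fst (frame B s x 0)))" by simp
    then have "fst (frame B s x z) = fst (frame B s x 0)" unfolding kp[OF f] .
    moreover have "snd (frame B s x z) = snd (frame B s x 0)"
      using fibreD(2)[OF f[of z]] fibreD(2)[OF f[of 0]] by simp
    ultimately have "frame B s x z = frame B s x 0" by (rule prod_eqI)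
    then have "snd s (frame B s x z) = snd s (frame B s x 0)" by simp
    then show ?thesis unfolding triv_frame[OF s] .
  qed
qed

text \<open>The change of frame solves a linear system whose matrix is the Gram matrix of a smooth
  frame.\<close>

lemma B_transition:
  assumes t: "t \<in> trivs B" and s: "s \<in> trivs B"
  shows "msmooth M (fst t \<inter> fst s) (\<lambda>x. snd s (frame B t x v))"
proof -
  have t': "open (fst t)" "fibrewise_triv B t"
      "smooth_into_killing (restrict_charts (fst t) M) (\<lambda>x. fst (frame B t x v))"
    using t[unfolded hyp_trivs_iff] by simp_all
  have s': "open (fst s)" "fibrewise_triv B s"
      "\<And>v. smooth_into_killing (restrict_charts (fst s) M) (\<lambda>x. fst (frame B s x v))"
    using s[unfolded hyp_trivs_iff] by simp_all
  let ?U = "fst t \<inter> fst s"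
  have U: "open ?U" by (rule open_Int[OF t'(1) s'(1)])
  \<comment> \<open>The \<open>w j\<close> are the basis fields of the frame \<open>s\<close> in
    coordinates (S, b), and \<open>u\<close> is the field of the frame \<open>t\<close> to be
    expanded in them. Inner products with the \<open>w i\<close> turn this overdetermined expansion
    into a square system.\<close>
  define w where "w j x = kpar (fst (frame B s x (axis j 1)))" for j x
  define u where "u x = kpar (fst (frame B t x v))" for x
  have w: "msmooth M ?U (w j)" for j
    unfolding w_def by (rule msmooth_subset[OF killing_map_smooth[OF s'(3,1)] _ U]) simp
  have u: "msmooth M ?U u"
    unfolding u_def by (rule msmooth_subset[OF killing_map_smooth[OF t'(3,1)] _ U]) simp
  define W where "W x = (\<chi> i j. w i x \<bullet> w j x)" for x
  have W: "msmooth M ?U W" and b: "msmooth M ?U (\<lambda>x. \<chi> i. w i x \<bullet> u x)"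
    unfolding W_def
    by (intro msmooth_vec_lambda U msmooth_bounded_bilinear[OF bounded_bilinear_inner] w u)+
  have comb: "(\<Sum>j\<in>UNIV. z $ j *\<^sub>R w j x) = kpar (fst (frame B s x z))" if x: "x \<in> fst s" for z x
  proof -
    note lin = kpar_fst_linear(1)[OF s'(2) x]
    have "kpar (fst (frame B s x z)) = kpar (fst (frame B s x (\<Sum>j\<in>UNIV. z $ j *\<^sub>R axis j 1)))"
      using basis_expansion[of z] by (simp add: scalar_mult_eq_scaleR)
    also have "\<dots> = (\<Sum>j\<in>UNIV. z $ j *\<^sub>R w j x)"
      unfolding w_def by (simp only: linear_sum[OF lin] linear_cmul[OF lin])
    finally show ?thesis by simp
  qed
  have Wz: "(W x *v z) $ i = w i x \<bullet> kpar (fst (frame B s x z))" if "x \<in> fst s" for x z i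
    unfolding comb[OF that, symmetric] W_def matrix_vector_mult_def
    by (simp add: inner_sum_right mult.commute)
  show ?thesis
  proof (rule msmooth_solve[OF W b])
    fix x assume x: "x \<in> ?U"
    then have xs: "x \<in> fst s" and xt: "x \<in> fst t" by auto
    \<comment> \<open>For a null vector \<open>z\<close> of the Gram matrix, the combination with
      coefficients \<open>z\<close> is orthogonal to all \<open>w j\<close>, hence to
      itself.\<close>
    have "z = 0" if "W x *v z = 0" for z
    proof -
      let ?k = "kpar (fst (frame B s x z))"
      have "?k \<bullet> ?k = (\<Sum>j\<in>UNIV. z $ j * (w j x \<bullet> ?k))"
        by (subst (1) comb[OF xs, symmetric]) (simp add: inner_sum_left)
      also have "\<dots> = 0" unfolding Wz[OF xs, symmetric] that by simp
      finally show ?thesis using kpar_fst_linear(2)[OF s'(2) xs, of z] by simp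
    qed
    then have "invertible (W x)" unfolding invertible_left_inverse matrix_left_invertible_ker by blast
    then show "det (W x) \<noteq> 0" by (simp add: invertible_det_nz)
    have "frame B s x (snd s (frame B t x v)) = frame B t x v"
      by (rule frame_triv[OF s'(2) xs frame_in_fibre[OF t'(2) xt]])
    then show "W x *v snd s (frame B t x v) = (\<chi> i. w i x \<bullet> u x)"
      by (simp add: vec_eq_iff Wz[OF xs] u_def)
  qed
qed

lemma vector_bundle_B: "vector_bundle M B"
  unfolding vector_bundle_def
proof (intro conjI allI ballI)
  show "smooth_atlas M" by (rule atlas)
  show "fadd B e e' \<in> fibre B x" if "e \<in> fibre B x" "e' \<in> fibre B x" for x e e'
    by (rule B_fadd_fibre[OF that])
  show "fscale B r e \<in> fibre B x" if "e \<in> fibre B x" for x r e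
    by (rule B_fscale_fibre[OF that])
  show "(\<Union>t\<in>trivs B. fst t) = UNIV"
  proof -
    have "\<exists>t\<in>trivs B. x \<in> fst t" for x
    proof -
      obtain t where "t \<in> trivs A" "x \<in> fst t" using triv_around by blast
      then show ?thesis using push_triv[of t] by (intro bexI[of _ "push t"]) (simp_all add: push_def)
    qed
    then show ?thesis by blast
  qed
  fix t assume t: "t \<in> trivs B"
  show "open (fst t)" "fibrewise_triv B t" using t unfolding hyp_trivs_iff by simp_all
  fix s v assume s: "s \<in> trivs B"
  have "open (fst t \<inter> fst s)" using s t unfolding hyp_trivs_iff by (simp add: open_Int)
  then show "smooth_map (restrict_charts (fst t \<inter> fst s) M) euclidean_charts
      (\<lambda>x. snd s (inv_into (fibre B x) (snd t) v))"
    using B_transition[OF t s, of v] by (simp add: smooth_map_restrict_iff frame_def)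
qed

section \<open>Transport of the algebroid structure\<close>

sublocale B: vector_bundle_over M B
  by unfold_locales (rule vector_bundle_B)

lemma B_charts_inj: "b \<in> bundle_charts M B \<Longrightarrow> inj_on (snd b) (fst b)"
  using bundle_charts_inj[of B b] B.triv_fibrewise by simp

text \<open>In a pushed trivialisation \<open>\<Phi>\<close> is the identity on coordinates, so any
  other coordinate expression is a change of frame in \<open>B\<close>.\<close>

lemma \<Phi>_smooth: "smooth_map (bundle_charts M A) (bundle_charts M B) \<Phi>"
proof (rule smooth_fibrewise_linear)
  show "vector_bundle_over M A" "vector_bundle_over M B" by unfold_locales
  show "msmooth M (fst t \<inter> fst s) (\<lambda>x. snd s (\<Phi> (frame A t x v)))"
    if t: "t \<in> trivs A" and s: "s \<in> trivs B" for t s v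
  proof -
    have "msmooth M (fst t \<inter> fst s) (\<lambda>x. snd s (frame B (push t) x v))"
      using B.triv_transition[OF push_triv[OF t] s, of v] by (simp add: push_def)
    then show ?thesis by (rule iffD1[OF msmooth_cong, rotated]) (simp add: frame_push[OF t])
  qed
qed (use \<Phi>_in \<Phi>_add \<Phi>_scale in auto)

lemma \<Psi>_smooth: "smooth_map (bundle_charts M B) (bundle_charts M A) \<Psi>"
proof (rule smooth_fibrewise_linear)
  show "vector_bundle_over M A" "vector_bundle_over M B" by unfold_locales
  show "msmooth M (fst t \<inter> fst s) (\<lambda>x. snd s (\<Psi> (frame B t x v)))"
    if t: "t \<in> trivs B" and s: "s \<in> trivs A" for t s v
    using B.triv_transition[OF t push_triv[OF s], of v] by (simp add: push_def)
qed (use \<Psi>_in \<Psi>_add \<Psi>_scale in auto)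

lemma \<Phi>_section:
  assumes "X \<in> sections M A"
  shows "(\<lambda>x. \<Phi> (X x)) \<in> sections M B"
  unfolding sections_def
proof (intro CollectI conjI allI)
  show "\<Phi> (X x) \<in> fibre B x" for x by (rule \<Phi>_in[OF section_fibre[OF assms]])
  show "smooth_map M (bundle_charts M B) (\<lambda>x. \<Phi> (X x))"
    by (rule smooth_map_comp[OF _ \<Phi>_smooth])
      (use assms chart_inj A_charts_inj in \<open>auto simp: sections_def\<close>)
qed

text \<open>Sections correspond under \<open>\<Phi>\<close> and its inverse, so identities for
  sections of \<open>A\<close> become identities for all sections of \<open>B\<close>.\<close>

lemma B_section:
  assumes "S \<in> sections M B"
  obtains X where "X \<in> sections M A" "S = (\<lambda>x. \<Phi> (X x))"
proof
  note f = B.section_fibre[OF assms]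
  show "(\<lambda>x. \<Psi> (S x)) \<in> sections M A"
    unfolding sections_def
  proof (intro CollectI conjI allI)
    show "\<Psi> (S x) \<in> fibre A x" for x by (rule \<Psi>_in[OF f])
    show "smooth_map M (bundle_charts M A) (\<lambda>x. \<Psi> (S x))"
      by (rule smooth_map_comp[OF _ \<Psi>_smooth])
        (use assms chart_inj B_charts_inj in \<open>auto simp: sections_def\<close>)
  qed
  show "S = (\<lambda>x. \<Phi> (\<Psi> (S x)))" by (rule ext) (simp only: \<Phi>_\<Psi>[OF f])
qed

text \<open>The anchor of A_f is the unique tangent vector that df sends to the value of the field.
  The anchor of \<open>a\<close> has this property by \<open>mdiff_anchor\<close>, and uniqueness is
  injectivity of df.\<close>

lemma hyp_anchor_\<Phi>:
  assumes a: "a \<in> fibre A x"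
  shows "anchor B (\<Phi> a) = anchor A a"
  unfolding B_simps hyp_anchor_def \<Phi>_fibre[OF a] fst_conv snd_conv
proof (rule the_equality)
  show "anchor A a \<in> tangent_space M x \<and> mdiff M dev (anchor A a) = \<omega> a (dev x)"
    using anchor_tangent[OF a] mdiff_anchor[OF a] by simp
  then show "t = anchor A a" if "t \<in> tangent_space M x \<and> mdiff M dev t = \<omega> a (dev x)" for t
    using inj_onD[OF mdiff_dev_inj[of x], of t "anchor A a"] that by simp
qed

text \<open>Once the anchors agree, the bracket defined on A_f is literally the right-hand side of
  the condition for \<open>\<omega>\<close> to be a morphism.\<close>

lemma bracket_\<Phi>:
  assumes X: "X \<in> sections M A" and Y: "Y \<in> sections M A"
  shows "bracket B (\<lambda>x. \<Phi> (X x)) (\<lambda>x. \<Phi> (Y x)) = (\<lambda>x. \<Phi> (bracket A X Y x))"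
proof
  fix x
  note f = section_fibre
  have "hyp_anchor M dev (\<Phi> (X x)) = anchor A (X x)" "hyp_anchor M dev (\<Phi> (Y x)) = anchor A (Y x)"
    using hyp_anchor_\<Phi>[OF f[OF X]] hyp_anchor_\<Phi>[OF f[OF Y]] by simp_all
  then show "bracket B (\<lambda>x. \<Phi> (X x)) (\<lambda>x. \<Phi> (Y x)) x = \<Phi> (bracket A X Y x)"
    unfolding B_bracket \<Phi>_fibre[OF f[OF bracket_section[OF X Y]]] \<omega>_bracket[OF X Y]
    by (simp add: \<Phi>_def)
qed

lemma B_tot_charts: "b \<in> bundle_charts M B \<Longrightarrow> e \<in> fst b \<Longrightarrow> \<exists>x. e \<in> fibre B x"
  unfolding bundle_charts_def fibre_def by auto

text \<open>The anchor of \<open>B\<close> is a definite description with no visible regularity;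
  smoothness comes from its equality with the anchor of \<open>A\<close> after
  \<open>\<Psi>\<close>.\<close>

lemma anchor_B_morphism: "vb_morphism M B (tangent_bundle M) (anchor B)"
proof -
  have aB: "anchor B e = anchor A (\<Psi> e)" if "e \<in> fibre B x" for e x
    using hyp_anchor_\<Phi>[OF \<Psi>_in[OF that]] unfolding \<Phi>_\<Psi>[OF that] .
  have anchor_A: "anchor A (fadd A a b) = fadd (tangent_bundle M) (anchor A a) (anchor A b)"
      "anchor A (fscale A r a) = fscale (tangent_bundle M) r (anchor A a)"
    if "a \<in> fibre A x" "b \<in> fibre A x" for a b x r
    using anchor_morphism that by blast+
  have "smooth_map (bundle_charts M B) (bundle_charts M (tangent_bundle M)) (\<lambda>e. anchor A (\<Psi> e))"
    by (rule smooth_map_comp[OF \<Psi>_smooth anchor_smooth B_charts_inj A_charts_inj])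
  then have sm: "smooth_map (bundle_charts M B) (bundle_charts M (tangent_bundle M)) (anchor B)"
  proof (rule smooth_map_cong[OF _ B_charts_inj])
    fix b e assume "b \<in> bundle_charts M B" "e \<in> fst b"
    then obtain x where "e \<in> fibre B x" using B_tot_charts by blast
    then show "anchor B e = anchor A (\<Psi> e)" by (rule aB)
  qed
  show ?thesis
    unfolding vb_morphism_def fibre_tangent_bundle
  proof (intro conjI allI ballI sm)
    fix x e assume e: "e \<in> fibre B x"
    note p = \<Psi>_in[OF e]
    show "anchor B e \<in> tangent_space M x" unfolding aB[OF e] by (rule anchor_tangent[OF p])
    show "anchor B (fscale B r e) = fscale (tangent_bundle M) r (anchor B e)" for r
      unfolding aB[OF e] aB[OF B_fscale_fibre[OF e]] \<Psi>_scale[OF e] by (rule anchor_A(2)[OF p p])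
    show "anchor B (fadd B e e') = fadd (tangent_bundle M) (anchor B e) (anchor B e')"
      if e': "e' \<in> fibre B x" for e'
      unfolding aB[OF e] aB[OF e'] aB[OF B_fadd_fibre[OF e e']] \<Psi>_add[OF e e']
      by (rule anchor_A(1)[OF p \<Psi>_in[OF e']])
  qed
qed

text \<open>Each axiom is the image under \<open>\<Phi>\<close> of the corresponding axiom of
  \<open>A\<close>. This also shows that the bracket formula of A_f yields sections of A_f, without
  differentiating the tangency condition.\<close>

lemma lie_algebroid_B: "lie_algebroid M B"
proof -
  note sf = section_fibre and bs = bracket_section
  have PA: "(\<lambda>x. fadd B (\<Phi> (Y x)) (\<Phi> (Z x))) = (\<lambda>x. \<Phi> (fadd A (Y x) (Z x)))"
    if "\<And>x. Y x \<in> fibre A x" "\<And>x. Z x \<in> fibre A x" for Y Z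
    by (rule ext) (simp only: \<Phi>_add[OF that])
  have PS: "(\<lambda>x. fscale B (h x) (\<Phi> (Y x))) = (\<lambda>x. \<Phi> (fscale A (h x) (Y x)))"
    if "\<And>x. Y x \<in> fibre A x" for Y h
    by (rule ext) (simp only: \<Phi>_scale[OF that])
  show ?thesis
    unfolding lie_algebroid_def
  proof (intro conjI ballI allI impI vector_bundle_B anchor_B_morphism)
    fix S T assume "S \<in> sections M B" "T \<in> sections M B"
    then obtain X Y where X: "X \<in> sections M A" and S: "S = (\<lambda>x. \<Phi> (X x))"
      and Y: "Y \<in> sections M A" and T: "T = (\<lambda>x. \<Phi> (Y x))" by (metis B_section)
    note XY = bs[OF X Y]
    show "bracket B S T \<in> sections M B"
      unfolding S T bracket_\<Phi>[OF X Y] by (rule \<Phi>_section[OF XY])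
    show "bracket B S (\<lambda>x. fscale B r (T x)) = (\<lambda>x. fscale B r (bracket B S T x))" for r
      unfolding S T bracket_\<Phi>[OF X Y] PS[OF sf[OF Y]] PS[OF sf[OF XY]]
        bracket_\<Phi>[OF X section_scale[OF Y msmooth_const[OF open_UNIV]]] bracket_scale[OF X Y] ..
    show "bracket B T S = (\<lambda>x. fscale B (- 1) (bracket B S T x))"
      unfolding S T bracket_\<Phi>[OF X Y] bracket_\<Phi>[OF Y X] PS[OF sf[OF XY]] bracket_antisym[OF X Y] ..
    show "bracket B S (\<lambda>x. fscale B (h x) (T x)) =
        (\<lambda>x. fadd B (fscale B (h x) (bracket B S T x)) (fscale B (mdiff M h (anchor B (S x))) (T x)))"
      if "smooth_map M euclidean_charts h" for h :: "'a \<Rightarrow> real"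
    proof -
      have h: "msmooth M UNIV h" using that unfolding smooth_map_iff .
      show ?thesis
        unfolding S T bracket_\<Phi>[OF X Y] PS[OF sf[OF Y]] bracket_\<Phi>[OF X section_scale[OF Y h]]
          bracket_leibniz[OF X Y h] hyp_anchor_\<Phi>[OF sf[OF X]]
          \<Phi>_scale[OF sf[OF XY], symmetric] \<Phi>_scale[OF sf[OF Y], symmetric]
          PA[OF fscale_fibre[OF sf[OF XY]] fscale_fibre[OF sf[OF Y]]] ..
    qed
    fix R assume "R \<in> sections M B"
    then obtain Z where Z: "Z \<in> sections M A" and R: "R = (\<lambda>x. \<Phi> (Z x))" by (metis B_section)
    note XZ = bs[OF X Z] and YZ = bs[OF Y Z] and ZX = bs[OF Z X]
    show "bracket B S (\<lambda>x. fadd B (T x) (R x)) = (\<lambda>x. fadd B (bracket B S T x) (bracket B S R x))"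
      unfolding S T R bracket_\<Phi>[OF X Y] bracket_\<Phi>[OF X Z] PA[OF sf[OF Y] sf[OF Z]]
        PA[OF sf[OF XY] sf[OF XZ]] bracket_\<Phi>[OF X section_add[OF Y Z]] bracket_add[OF X Y Z] ..
    have jac: "fadd A (fadd A (bracket A X (bracket A Y Z) x) (bracket A Y (bracket A Z X) x))
        (bracket A Z (bracket A X Y) x) = fscale A 0 (X x)" for x
      using fun_cong[OF bracket_jacobi[OF X Y Z], of x] .
    note J = sf[OF bs[OF X YZ]] sf[OF bs[OF Y ZX]] sf[OF bs[OF Z XY]]
    show "(\<lambda>x. fadd B (fadd B (bracket B S (bracket B T R) x) (bracket B T (bracket B R S) x))
        (bracket B R (bracket B S T) x)) = (\<lambda>x. fscale B 0 (S x))"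
      unfolding S T R bracket_\<Phi>[OF X Y] bracket_\<Phi>[OF Y Z] bracket_\<Phi>[OF Z X]
        bracket_\<Phi>[OF X YZ] bracket_\<Phi>[OF Y ZX] bracket_\<Phi>[OF Z XY]
        \<Phi>_add[OF J(1,2), symmetric] PA[OF fadd_fibre[OF J(1,2)] J(3)] jac
        PS[OF sf[OF X]] ..
  qed
qed

lemma \<Phi>_morphism: "algebroid_morphism M A B \<Phi>"
  unfolding algebroid_morphism_def vb_morphism_def
proof (intro conjI allI ballI lie_algebroid lie_algebroid_B \<Phi>_smooth)
  show "\<Phi> e \<in> fibre B x" if "e \<in> fibre A x" for x e by (rule \<Phi>_in[OF that])
  show "\<Phi> (fadd A e e') = fadd B (\<Phi> e) (\<Phi> e')" if "e \<in> fibre A x" "e' \<in> fibre A x" for x e e'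
    by (rule \<Phi>_add[OF that])
  show "\<Phi> (fscale A r e) = fscale B r (\<Phi> e)" if "e \<in> fibre A x" for x r e by (rule \<Phi>_scale[OF that])
  show "(\<lambda>x. \<Phi> (bracket A X Y x)) = bracket B (\<lambda>x. \<Phi> (X x)) (\<lambda>x. \<Phi> (Y x))"
    if "X \<in> sections M A" "Y \<in> sections M A" for X Y
    by (rule bracket_\<Phi>[OF that, symmetric])
qed

lemma \<Psi>_morphism: "algebroid_morphism M B A \<Psi>"
  unfolding algebroid_morphism_def vb_morphism_def
proof (intro conjI allI ballI lie_algebroid lie_algebroid_B \<Psi>_smooth)
  show "\<Psi> e \<in> fibre A x" if "e \<in> fibre B x" for x e by (rule \<Psi>_in[OF that])
  show "\<Psi> (fadd B e e') = fadd A (\<Psi> e) (\<Psi> e')" if "e \<in> fibre B x" "e' \<in> fibre B x" for x e e'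
    by (rule \<Psi>_add[OF that])
  show "\<Psi> (fscale B r e) = fscale A r (\<Psi> e)" if "e \<in> fibre B x" for x r e by (rule \<Psi>_scale[OF that])
  fix S T assume "S \<in> sections M B" "T \<in> sections M B"
  then obtain X Y where X: "X \<in> sections M A" and S: "S = (\<lambda>x. \<Phi> (X x))"
    and Y: "Y \<in> sections M A" and T: "T = (\<lambda>x. \<Phi> (Y x))" by (metis B_section)
  show "(\<lambda>x. \<Psi> (bracket B S T x)) = bracket A (\<lambda>x. \<Psi> (S x)) (\<lambda>x. \<Psi> (T x))"
    unfolding S T bracket_\<Phi>[OF X Y] \<Psi>_\<Phi>[OF section_fibre[OF bracket_section[OF X Y]]]
      \<Psi>_\<Phi>[OF section_fibre[OF X]] \<Psi>_\<Phi>[OF section_fibre[OF Y]] ..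
qed

lemma \<Phi>_iso: "algebroid_iso M A B \<Phi>"
  unfolding algebroid_iso_def \<Psi>_def[symmetric] by (intro conjI \<Phi>_morphism \<Phi>_bij \<Psi>_morphism)

end

theorem mainTheorem1:
  fixes M :: "('a::{t2_space,second_countable_topology}, real^'n) chart set"
    and A :: "('a, 'b, 'k::finite, 'n::finite) algebroid"
    and \<omega> :: "'b \<Rightarrow> (real^'m \<Rightarrow> real^'m)"
  assumes "CARD('m) = CARD('n) + 1"
    and "smooth_atlas M"
    and "orientable M"
    and "simply_connected (UNIV :: 'a set)"
    and "lie_algebroid M A"
    and "killing_morphism M A \<omega>"
    and "vb_rank A = CARD('n) * (CARD('n) + 3) div 2"
    and "\<forall>x. anchor A ` fibre A x = tangent_space M x"
    and "\<forall>x. inj_on \<omega> (fibre A x)"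
    and "\<exists>x\<^sub>0. transverse_in_killing (\<omega> ` anchor_kernel A x\<^sub>0) constant_fields"
  shows "\<exists>(f :: 'a \<Rightarrow> real^'m)
            (\<Phi> :: 'b \<Rightarrow> (real^'m \<Rightarrow> real^'m) \<times> 'a).
           immersion M f \<and>
           algebroid_iso M A
             (hypersurface_algebroid M f :: ('a, (real^'m \<Rightarrow> real^'m) \<times> 'a, 'k, 'n) algebroid) \<Phi> \<and>
           (\<forall>a\<in>tot_space A. log_derivative (\<Phi> a) = \<omega> a)"
proof -
  obtain x\<^sub>0 where tr: "transverse_in_killing (\<omega> ` anchor_kernel A x\<^sub>0) constant_fields"
    using assms(10) by blast
  have co: "connected (UNIV :: 'a set)" by (rule connected_if_simply_connected[OF assms(4)])
  interpret killing_algebroid M A \<omega> x\<^sub>0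
    by unfold_locales
      (rule assms(1,2,5,6) tr co assms(7)[unfolded vb_rank_def] assms(8,9)[rule_format])+
  have "log_derivative (\<Phi> a) = \<omega> a" for a by (simp add: log_derivative_def \<Phi>_def)
  then show ?thesis by (intro exI[of _ dev] exI[of _ \<Phi>] conjI immersion_dev \<Phi>_iso ballI)
qed

end
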